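(* Let $r\ge1$ and regard the Hamiltonian algebra $H(2r)$ as a $W(1)$-module via $x\cdot D=[\Theta_H(x),D]$, where $\Theta_H(x_1^i\partial_1)=-D_H(x_1^ix_{r+1})=x_1^i\partial_1-ix_1^{i-1}x_{r+1}\partial_{r+1}$. Then $$H(2r)\cong V(0)^{\oplus(p^{2r-2}-1)}\oplus\Big(\bigoplus_{i=1}^{p-2}L(i)^{\oplus p^{2r-2}}\Big)\oplus V(p-1)^{\oplus(p^{2r-2}-1)}\oplus L(p-1)^{\oplus2}.$$ In particular, $$[H(2r)]=(2p^{2r-2}-2)[L(0)]+p^{2r-2}\sum_{j=1}^{p-2}[L(j)]+2p^{2r-2}[L(p-1)].$$
   Context: $\mathbb F$ is an algebraically closed field of characteristic $p>2$, $I=\{0,\dots,p-1\}$. $\mathcal A(2r)$ is the truncated polynomial algebra with basis $x^\alpha$, $\alpha\in I^{2r}$ ($x^\alpha x^\beta=x^{\alpha+\beta}$, $=0$ if outside $I^{2r}$), $\partial_i(x_j)=\delta_{ij}$. For $1\le i\le 2r$: $\sigma(i)=1$, $i'=i+r$ if $i\le r$; $\sigma(i)=-1$, $i'=i-r$ if $i>r$. $D_H(f)=\sum_{i=1}^{2r}\sigma(i)\partial_i(f)\partial_{i'}$, and $H(2r)=\mathrm{span}_{\mathbb F}\{D_H(x^\alpha)\mid\alpha\in I^{2r},\alpha\ne0,\alpha\ne(p-1,\dots,p-1)\}$. $W(1)$ is the Witt algebra with basis $x_1^i\partial_1$; $W(1)_{[i]}=\mathbb Fx_1^{i+1}\partial_1$,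 $W(1)_0=\bigoplus_{i\ge0}W(1)_{[i]}$, $W(1)_1=\bigoplus_{i\ge1}W(1)_{[i]}$. For $\lambda\in I$, $\mathbb F_\lambda$ is the one-dimensional $W(1)_0$-module with $x_1\partial_1$ acting by $\lambda$ and $W(1)_1$ by $0$; $V(\lambda)=u(W(1))\otimes_{u(W(1)_0)}\mathbb F_\lambda$ ($u$ = restricted enveloping algebra) and $L(\lambda)$ its unique simple quotient. $[M]$ is the formal sum of composition factors of $M$ with multiplicity. *)

theory Defs
  imports "HOL-Computational_Algebra.Polynomial" "HOL-Library.Function_Algebras"
begin

text \<open>All vector spaces are spaces of functions into the ground field, with pointwise
  addition (HOL-Library.Function_Algebras) and the following scalar multiplication.\<close>

definition fscale :: "'a::field \<Rightarrow> ('x \<Rightarrow> 'a) \<Rightarrow> ('x \<Rightarrow> 'a)" where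
  "fscale c f = (\<lambda>x. c * f x)"

type_synonym mono = "nat \<Rightarrow> nat"   \<comment> \<open>exponent vectors, variables indexed 1..n\<close>

definition expvecs :: "nat \<Rightarrow> nat \<Rightarrow> mono set" where
  "expvecs p n = {\<alpha>. (\<forall>i. \<alpha> i < p) \<and> (\<forall>i. (i = 0 \<or> n < i) \<longrightarrow> \<alpha> i = 0)}"

text \<open>An element of A(n) is its coefficient function on exponent vectors in I^n.\<close>
definition Alg :: "nat \<Rightarrow> nat \<Rightarrow> (mono \<Rightarrow> 'a::field) set" where
  "Alg p n = {f. \<forall>\<alpha>. \<alpha> \<notin> expvecs p n \<longrightarrow> f \<alpha> = 0}"

definition xmon :: "mono \<Rightarrow> (mono \<Rightarrow> 'a::field)" where
  "xmon \<alpha> = (\<lambda>\<beta>. if \<beta> = \<alpha> then 1 else 0)"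

definition tmult :: "nat \<Rightarrow> nat \<Rightarrow> (mono \<Rightarrow> 'a::field) \<Rightarrow> (mono \<Rightarrow> 'a) \<Rightarrow> (mono \<Rightarrow> 'a)" where
  "tmult p n f g = (\<lambda>\<gamma>. if \<gamma> \<in> expvecs p n then
      (\<Sum>\<alpha>\<in>expvecs p n. \<Sum>\<beta>\<in>expvecs p n. if (\<lambda>i. \<alpha> i + \<beta> i) = \<gamma> then f \<alpha> * g \<beta> else 0)
    else 0)"

definition pd :: "nat \<Rightarrow> nat \<Rightarrow> nat \<Rightarrow> (mono \<Rightarrow> 'a::field) \<Rightarrow> (mono \<Rightarrow> 'a)" where
  "pd p n j f = (\<lambda>\<alpha>. if \<alpha> \<in> expvecs p n \<and> \<alpha>(j := Suc (\<alpha> j)) \<in> expvecs p n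
      then of_nat (Suc (\<alpha> j)) * f (\<alpha>(j := Suc (\<alpha> j))) else 0)"

text \<open>A derivation D = sum_i f_i d_i of A(n) is stored as D (i, alpha) = coefficient of
  x^alpha d_i.\<close>
definition Der :: "nat \<Rightarrow> nat \<Rightarrow> (nat \<times> mono \<Rightarrow> 'a::field) set" where
  "Der p n = {D. \<forall>i \<alpha>. (i \<notin> {1..n} \<or> \<alpha> \<notin> expvecs p n) \<longrightarrow> D (i, \<alpha>) = 0}"

definition dcomp :: "(nat \<times> mono \<Rightarrow> 'a) \<Rightarrow> nat \<Rightarrow> (mono \<Rightarrow> 'a)" where
  "dcomp D i = (\<lambda>\<alpha>. D (i, \<alpha>))"

definition der_apply :: "nat \<Rightarrow> nat \<Rightarrow> (nat \<times> mono \<Rightarrow> 'a::field) \<Rightarrow> (mono \<Rightarrow> 'a) \<Rightarrow> (mono \<Rightarrow> 'a)" where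
  "der_apply p n D f = (\<lambda>\<gamma>. \<Sum>i\<in>{1..n}. tmult p n (dcomp D i) (pd p n i f) \<gamma>)"

definition bracket :: "nat \<Rightarrow> nat \<Rightarrow> (nat \<times> mono \<Rightarrow> 'a::field) \<Rightarrow> (nat \<times> mono \<Rightarrow> 'a) \<Rightarrow> (nat \<times> mono \<Rightarrow> 'a)" where
  "bracket p n D E = (\<lambda>(j, \<alpha>). der_apply p n D (dcomp E j) \<alpha> - der_apply p n E (dcomp D j) \<alpha>)"

definition sigma :: "nat \<Rightarrow> nat \<Rightarrow> int" where
  "sigma r i = (if i \<le> r then 1 else -1)"

definition iprime :: "nat \<Rightarrow> nat \<Rightarrow> nat" where
  "iprime r i = (if i \<le> r then i + r else i - r)"

definition DH :: "nat \<Rightarrow> nat \<Rightarrow> (mono \<Rightarrow> 'a::field) \<Rightarrow> (nat \<times> mono \<Rightarrow> 'a)" where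
  "DH p r f = (\<lambda>(j, \<alpha>). \<Sum>i\<in>{1..2*r}.
      if iprime r i = j then of_int (sigma r i) * pd p (2*r) i f \<alpha> else 0)"

definition Hset :: "nat \<Rightarrow> nat \<Rightarrow> (nat \<times> mono \<Rightarrow> 'a::field) set" where
  "Hset p r = module.span fscale
     {DH p r (xmon \<alpha>) | \<alpha>. \<alpha> \<in> expvecs p (2*r) \<and> \<alpha> \<noteq> (\<lambda>_. 0)
        \<and> \<alpha> \<noteq> (\<lambda>i. if 1 \<le> i \<and> i \<le> 2*r then p - 1 else 0)}"

type_synonym 'a W1elem = "nat \<times> mono \<Rightarrow> 'a"

abbreviation W1 :: "nat \<Rightarrow> 'a::field W1elem set" where
  "W1 p \<equiv> Der p 1"

definition xpow1 :: "nat \<Rightarrow> mono" where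
  "xpow1 i = (\<lambda>k. if k = 1 then i else 0)"

definition ew :: "nat \<Rightarrow> 'a::field W1elem" where
  "ew i = (\<lambda>(j, \<alpha>). if j = 1 \<and> \<alpha> = xpow1 i then 1 else 0)"

text \<open>restricted p-map of W(1): D^[p] = D^p, the derivation with value D^p(x_1) on x_1\<close>
definition ppow :: "nat \<Rightarrow> 'a::field W1elem \<Rightarrow> 'a W1elem" where
  "ppow p D = (\<lambda>(j, \<alpha>). if j = 1 then ((der_apply p 1 D) ^^ p) (xmon (xpow1 1)) \<alpha> else 0)"

definition thetaH :: "nat \<Rightarrow> nat \<Rightarrow> 'a::field W1elem \<Rightarrow> (nat \<times> mono \<Rightarrow> 'a)" where
  "thetaH p r D = (\<Sum>i<p. fscale (D (1, xpow1 i))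
      (- DH p r (xmon (\<lambda>k. if k = 1 then i else if k = r + 1 then 1 else 0))))"

definition Hact :: "nat \<Rightarrow> nat \<Rightarrow> 'a::field W1elem \<Rightarrow> (nat \<times> mono \<Rightarrow> 'a) \<Rightarrow> (nat \<times> mono \<Rightarrow> 'a)" where
  "Hact p r x D = bracket p (2*r) (thetaH p r x) D"

definition is_W1mod :: "nat \<Rightarrow> ('x \<Rightarrow> 'a::field) set \<Rightarrow> ('a W1elem \<Rightarrow> ('x \<Rightarrow> 'a) \<Rightarrow> ('x \<Rightarrow> 'a)) \<Rightarrow> bool" where
  "is_W1mod p M act \<longleftrightarrow> module.subspace fscale M
    \<and> (\<forall>D\<in>W1 p. \<forall>v\<in>M. act D v \<in> M)
    \<and> (\<forall>D\<in>W1 p. \<forall>E\<in>W1 p. \<forall>v\<in>M. act (D + E) v = act D v + act E v)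
    \<and> (\<forall>c. \<forall>D\<in>W1 p. \<forall>v\<in>M. act (fscale c D) v = fscale c (act D v))
    \<and> (\<forall>D\<in>W1 p. \<forall>u\<in>M. \<forall>v\<in>M. act D (u + v) = act D u + act D v)
    \<and> (\<forall>c. \<forall>D\<in>W1 p. \<forall>v\<in>M. act D (fscale c v) = fscale c (act D v))
    \<and> (\<forall>D\<in>W1 p. \<forall>E\<in>W1 p. \<forall>v\<in>M. act (bracket p 1 D E) v = act D (act E v) - act E (act D v))"

text \<open>restricted modules = u(W(1))-modules\<close>
definition is_restricted :: "nat \<Rightarrow> ('x \<Rightarrow> 'a::field) set \<Rightarrow> ('a W1elem \<Rightarrow> ('x \<Rightarrow> 'a) \<Rightarrow> ('x \<Rightarrow> 'a)) \<Rightarrow> bool" where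
  "is_restricted p M act \<longleftrightarrow> is_W1mod p M act
    \<and> (\<forall>D\<in>W1 p. \<forall>v\<in>M. act (ppow p D) v = (act D ^^ p) v)"

definition is_hom :: "nat \<Rightarrow> ('x \<Rightarrow> 'a::field) set \<Rightarrow> ('a W1elem \<Rightarrow> ('x \<Rightarrow> 'a) \<Rightarrow> ('x \<Rightarrow> 'a))
    \<Rightarrow> ('y \<Rightarrow> 'a) set \<Rightarrow> ('a W1elem \<Rightarrow> ('y \<Rightarrow> 'a) \<Rightarrow> ('y \<Rightarrow> 'a)) \<Rightarrow> (('x \<Rightarrow> 'a) \<Rightarrow> ('y \<Rightarrow> 'a)) \<Rightarrow> bool" where
  "is_hom p M act N act' f \<longleftrightarrow> (\<forall>v\<in>M. f v \<in> N)
    \<and> (\<forall>u\<in>M. \<forall>v\<in>M. f (u + v) = f u + f v)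
    \<and> (\<forall>c. \<forall>v\<in>M. f (fscale c v) = fscale c (f v))
    \<and> (\<forall>D\<in>W1 p. \<forall>v\<in>M. f (act D v) = act' D (f v))"

definition is_iso :: "nat \<Rightarrow> ('x \<Rightarrow> 'a::field) set \<Rightarrow> ('a W1elem \<Rightarrow> ('x \<Rightarrow> 'a) \<Rightarrow> ('x \<Rightarrow> 'a))
    \<Rightarrow> ('y \<Rightarrow> 'a) set \<Rightarrow> ('a W1elem \<Rightarrow> ('y \<Rightarrow> 'a) \<Rightarrow> ('y \<Rightarrow> 'a)) \<Rightarrow> (('x \<Rightarrow> 'a) \<Rightarrow> ('y \<Rightarrow> 'a)) \<Rightarrow> bool" where
  "is_iso p M act N act' f \<longleftrightarrow> is_hom p M act N act' f \<and> bij_betw f M N"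

definition is_submod :: "nat \<Rightarrow> ('x \<Rightarrow> 'a::field) set \<Rightarrow> ('a W1elem \<Rightarrow> ('x \<Rightarrow> 'a) \<Rightarrow> ('x \<Rightarrow> 'a)) \<Rightarrow> ('x \<Rightarrow> 'a) set \<Rightarrow> bool" where
  "is_submod p M act S \<longleftrightarrow> S \<subseteq> M \<and> module.subspace fscale S \<and> (\<forall>D\<in>W1 p. \<forall>v\<in>S. act D v \<in> S)"

definition is_simple :: "nat \<Rightarrow> ('x \<Rightarrow> 'a::field) set \<Rightarrow> ('a W1elem \<Rightarrow> ('x \<Rightarrow> 'a) \<Rightarrow> ('x \<Rightarrow> 'a)) \<Rightarrow> bool" where
  "is_simple p M act \<longleftrightarrow> is_W1mod p M act \<and> M \<noteq> {0}
    \<and> (\<forall>S. is_submod p M act S \<longrightarrow> S = {0} \<or> S = M)"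

text \<open>v spans a copy of F_lambda as W(1)_0-module: x_1 d_1 acts by lambda, W(1)_1 by 0\<close>
definition is_wt :: "nat \<Rightarrow> nat \<Rightarrow> ('a W1elem \<Rightarrow> ('x \<Rightarrow> 'a::field) \<Rightarrow> ('x \<Rightarrow> 'a)) \<Rightarrow> ('x \<Rightarrow> 'a) \<Rightarrow> bool" where
  "is_wt p lam act v \<longleftrightarrow> act (ew 1) v = fscale (of_nat lam) v
    \<and> (\<forall>i. 2 \<le> i \<and> i < p \<longrightarrow> act (ew i) v = 0)"

text \<open>Induced module V(lambda) = u(W(1)) (x)_{u(W(1)_0)} F_lambda with generator v = 1 (x) 1,
  characterised by its universal property (Frobenius reciprocity) among u(W(1))-modules.\<close>
definition is_induced :: "nat \<Rightarrow> nat \<Rightarrow> ('x \<Rightarrow> 'a::field) set \<Rightarrow> ('a W1elem \<Rightarrow> ('x \<Rightarrow> 'a) \<Rightarrow> ('x \<Rightarrow> 'a)) \<Rightarrow> ('x \<Rightarrow> 'a) \<Rightarrow> bool" where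
  "is_induced p lam M act v \<longleftrightarrow> is_restricted p M act \<and> v \<in> M \<and> is_wt p lam act v
    \<and> (\<forall>(N :: (nat \<Rightarrow> 'a) set) act' w. is_restricted p N act' \<and> w \<in> N \<and> is_wt p lam act' w \<longrightarrow>
         (\<exists>f. is_hom p M act N act' f \<and> f v = w)
       \<and> (\<forall>f g. is_hom p M act N act' f \<and> f v = w \<and> is_hom p M act N act' g \<and> g v = w
            \<longrightarrow> (\<forall>u\<in>M. f u = g u)))"

type_synonym 'a W1module = "(nat \<Rightarrow> 'a) set \<times> ('a W1elem \<Rightarrow> (nat \<Rightarrow> 'a) \<Rightarrow> (nat \<Rightarrow> 'a))"

definition Vmod :: "nat \<Rightarrow> nat \<Rightarrow> 'a::field W1module" where
  "Vmod p lam = (SOME Ma. \<exists>v. is_induced p lam (fst Ma) (snd Ma) v)"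

text \<open>L(lambda): the (unique up to isomorphism) simple quotient of V(lambda)\<close>
definition Lmod :: "nat \<Rightarrow> nat \<Rightarrow> 'a::field W1module" where
  "Lmod p lam = (SOME La. is_simple p (fst La) (snd La)
      \<and> (\<exists>f. is_hom p (fst (Vmod p lam)) (snd (Vmod p lam)) (fst La) (snd La) f
             \<and> f ` fst (Vmod p lam) = fst La))"

definition dsum :: "(('x \<Rightarrow> 'a::field) set \<times> ('a W1elem \<Rightarrow> ('x \<Rightarrow> 'a) \<Rightarrow> ('x \<Rightarrow> 'a))) list
    \<Rightarrow> (nat \<times> 'x \<Rightarrow> 'a) set \<times> ('a W1elem \<Rightarrow> (nat \<times> 'x \<Rightarrow> 'a) \<Rightarrow> (nat \<times> 'x \<Rightarrow> 'a))" where
  "dsum Ms = ({f. \<forall>k. (k < length Ms \<longrightarrow> (\<lambda>x. f (k, x)) \<in> fst (Ms ! k))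
                   \<and> (length Ms \<le> k \<longrightarrow> (\<forall>x. f (k, x) = 0))},
              \<lambda>D f (k, x). if k < length Ms then snd (Ms ! k) D (\<lambda>y. f (k, y)) x else 0)"

definition is_comp_series :: "nat \<Rightarrow> ('x \<Rightarrow> 'a::field) set \<Rightarrow> ('a W1elem \<Rightarrow> ('x \<Rightarrow> 'a) \<Rightarrow> ('x \<Rightarrow> 'a)) \<Rightarrow> ('x \<Rightarrow> 'a) set list \<Rightarrow> bool" where
  "is_comp_series p M act Cs \<longleftrightarrow> Cs \<noteq> [] \<and> hd Cs = {0} \<and> last Cs = M
    \<and> (\<forall>C\<in>set Cs. is_submod p M act C)
    \<and> (\<forall>i. Suc i < length Cs \<longrightarrow> Cs ! i \<subset> Cs ! Suc i
         \<and> (\<forall>S. is_submod p M act S \<and> Cs ! i \<subseteq> S \<and> S \<subseteq> Cs ! Suc i \<longrightarrow> S = Cs ! i \<or> S = Cs ! Suc i))"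

text \<open>the factor C'/C is isomorphic to (L, actL): there is a surjective homomorphism C' -> L
  with kernel C\<close>
definition factor_iso :: "nat \<Rightarrow> ('a W1elem \<Rightarrow> ('x \<Rightarrow> 'a::field) \<Rightarrow> ('x \<Rightarrow> 'a)) \<Rightarrow> ('x \<Rightarrow> 'a) set \<Rightarrow> ('x \<Rightarrow> 'a) set
    \<Rightarrow> ('y \<Rightarrow> 'a) set \<Rightarrow> ('a W1elem \<Rightarrow> ('y \<Rightarrow> 'a) \<Rightarrow> ('y \<Rightarrow> 'a)) \<Rightarrow> bool" where
  "factor_iso p act C C' L actL \<longleftrightarrow> (\<exists>f. is_hom p C' act L actL f \<and> f ` C' = L
      \<and> {v\<in>C'. f v = 0} = C)"

end

theory Submission
  imports Defs "HOL-Library.FuncSet"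
begin

text \<open>
  Write \<open>T\<^sub>k\<close> for the module of tensor densities: truncated polynomials in \<open>x\<close> on which
  \<open>u\<partial>\<close> acts by \<open>f \<mapsto> u f' - k u' f\<close>. The bracket satisfies
  \<open>[\<Theta>\<^sub>H(D), D\<^sub>H(f)] = D\<^sub>H(\<Theta>\<^sub>H(D) f)\<close>, and \<open>\<Theta>\<^sub>H(D)\<close> only involves
  \<open>x = x\<^sub>1\<close> and \<open>y = x\<^sub>r\<^sub>+\<^sub>1\<close> and preserves the degree in \<open>y\<close>. Hence \<open>A(2r)\<close> is the direct sum
  of the spaces \<open>T\<^sub>k y\<^sup>k z\<^sup>\<beta>\<close>, \<open>\<beta>\<close> running over the exponents of the other variables. Passing to
  \<open>H(2r)\<close> divides one copy of \<open>T\<^sub>0\<close> by the constants and drops \<open>x\<^sup>p\<^sup>-\<^sup>1\<close> from one copy of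
  \<open>T\<^sub>p\<^sub>-\<^sub>1\<close>; both results are \<open>L(p-1)\<close>, and the derivative maps the former onto the latter.

  The vector \<open>x\<^sup>p\<^sup>-\<^sup>1\<close> of weight \<open>p-1-k\<close> generates \<open>T\<^sub>k\<close> and satisfies the universal property of
  \<open>V(p-1-k)\<close>. Since \<open>x\<partial>\<close> has pairwise distinct eigenvalues on \<open>T\<^sub>k\<close>, submodules are spanned by
  monomials; so \<open>T\<^sub>k\<close> is simple for \<open>0 < k < p-1\<close>, and \<open>T\<^sub>0\<close>, \<open>T\<^sub>p\<^sub>-\<^sub>1\<close> have length two. The
  composition factors of an arbitrary series are then read off by the Jordan-Hoelder argument.
\<close>

text \<open>\<open>Vmod\<close> and \<open>Lmod\<close> are chosen by \<open>SOME\<close>, so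
  nothing is known about them until a module with the defining property is exhibited and shown
  unique up to isomorphism. The density modules and explicit submodules of them serve this purpose.
  The universal property is stated for restricted modules, so T_k must respect the p-map. That
  condition is not linear in the derivation and cannot be tested on the basis x^i d alone. It is
  reduced to an identity for twisted derivations of the untruncated polynomial ring; congruence
  modulo x^p is compatible with differentiation because the characteristic is p. Conversely, a
  target N must be restricted for x^(p-1) to be sent to a given weight vector: d^p has to act on it
  by 0. For k = p-1, which is -1 in the field, the action is f -> (uf)', and derivatives have no
  x^(p-1) term. This is the source of both exceptional cases. Multiplicities in an arbitrary series
  can be counted because the L(j) are pairwise non-isomorphic; the weight of the vectors killed by
  W(1)_1 tells them apart. Quotients are never formed: a surjective homomorphism with the right
  kernel stands for one.\<close>

interpretation fscale: vector_space "fscale :: 'a::field \<Rightarrow> ('x \<Rightarrow> 'a) \<Rightarrow> 'x \<Rightarrow> 'a"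
  by unfold_locales (auto simp: fscale_def fun_eq_iff algebra_simps)

lemma fscale_apply [simp]: "fscale c f x = c * f x"
  by (simp add: fscale_def)

lemma bracket_in_Der [simp]:
  assumes "D \<in> Der p n" "E \<in> Der p n"
  shows "bracket p n D E \<in> Der p n"
proof -
  have pd0: "pd p n j (\<lambda>\<alpha>. 0) = (\<lambda>\<alpha>. 0 :: 'a)" for j
    by (auto simp: pd_def)
  have tm0: "tmult p n f (\<lambda>\<alpha>. 0) \<gamma> = (0 :: 'a)" for f \<gamma>
    by (auto simp: tmult_def intro!: sum.neutral)
  have out: "dcomp D j = (\<lambda>\<alpha>. 0)" "dcomp E j = (\<lambda>\<alpha>. 0)" if "j \<notin> {1..n}" for j
    using assms that by (auto simp: Der_def dcomp_def fun_eq_iff)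
  have "bracket p n D E (j, \<alpha>) = 0" if "j \<notin> {1..n} \<or> \<alpha> \<notin> expvecs p n" for j \<alpha>
  proof (cases "\<alpha> \<in> expvecs p n")
    case False
    then show ?thesis
      by (simp add: bracket_def der_apply_def tmult_def)
  next
    case True
    then have "j \<notin> {1..n}" using that by blast
    note out[OF this]
    then show ?thesis
      by (simp add: bracket_def der_apply_def pd0 tm0)
  qed
  then show ?thesis by (auto simp: Der_def)
qed

lemma add_in_Der [simp]: "D \<in> Der p n \<Longrightarrow> E \<in> Der p n \<Longrightarrow> D + E \<in> Der p n"
  by (auto simp: Der_def)

lemma fscale_in_Der [simp]: "D \<in> Der p n \<Longrightarrow> fscale c D \<in> Der p n"
  by (auto simp: Der_def)

section \<open>Submodules and homomorphisms\<close>

lemma W1mod_subspace: "is_W1mod p M act \<Longrightarrow> module.subspace fscale M"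
  and W1mod_closed: "is_W1mod p M act \<Longrightarrow> D \<in> W1 p \<Longrightarrow> v \<in> M \<Longrightarrow> act D v \<in> M"
  and W1mod_add: "is_W1mod p M act \<Longrightarrow> D \<in> W1 p \<Longrightarrow> u \<in> M \<Longrightarrow> v \<in> M \<Longrightarrow> act D (u + v) = act D u + act D v"
  and W1mod_scale: "is_W1mod p M act \<Longrightarrow> D \<in> W1 p \<Longrightarrow> v \<in> M \<Longrightarrow> act D (fscale c v) = fscale c (act D v)"
  and W1mod_addl: "is_W1mod p M act \<Longrightarrow> D \<in> W1 p \<Longrightarrow> E \<in> W1 p \<Longrightarrow> v \<in> M \<Longrightarrow> act (D + E) v = act D v + act E v"
  and W1mod_scalel: "is_W1mod p M act \<Longrightarrow> D \<in> W1 p \<Longrightarrow> v \<in> M \<Longrightarrow> act (fscale c D) v = fscale c (act D v)"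
  and W1mod_bracket: "is_W1mod p M act \<Longrightarrow> D \<in> W1 p \<Longrightarrow> E \<in> W1 p \<Longrightarrow> v \<in> M \<Longrightarrow>
    act (bracket p 1 D E) v = act D (act E v) - act E (act D v)"
  by (simp_all add: is_W1mod_def)

lemma W1mod_zero:
  assumes "is_W1mod p M act" "D \<in> W1 p"
  shows "act D 0 = 0"
proof -
  have "act D (fscale 0 0) = fscale 0 (act D 0)"
    using assms W1mod_scale W1mod_subspace fscale.subspace_0 by blast
  then show ?thesis by simp
qed

lemma submod_subspace: "is_submod p M act S \<Longrightarrow> module.subspace fscale S"
  and submod_subset: "is_submod p M act S \<Longrightarrow> S \<subseteq> M"
  and submod_closed: "is_submod p M act S \<Longrightarrow> D \<in> W1 p \<Longrightarrow> v \<in> S \<Longrightarrow> act D v \<in> S"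
  by (auto simp: is_submod_def)

lemma submod_self: "is_W1mod p M act \<Longrightarrow> is_submod p M act M"
  by (simp add: is_submod_def is_W1mod_def)

lemma submod_zero: "is_W1mod p M act \<Longrightarrow> is_submod p M act {0}"
  using W1mod_zero[of p M act] W1mod_subspace[of p M act] fscale.subspace_0[of M]
  by (auto simp: is_submod_def fscale.subspace_single_0)

lemma submod_trans: "is_submod p M act N \<Longrightarrow> is_submod p N act S \<Longrightarrow> is_submod p M act S"
  by (auto simp: is_submod_def)

lemma submod_W1mod:
  assumes M: "is_W1mod p M act" and S: "is_submod p M act S"
  shows "is_W1mod p S act"
  using M S unfolding is_W1mod_def is_submod_def by (simp add: subset_iff)

lemma submod_Int: "is_submod p M act S \<Longrightarrow> is_submod p M act T \<Longrightarrow> is_submod p M act (S \<inter> T)"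
  by (auto simp: is_submod_def fscale.subspace_inter)

lemma submod_sum:
  fixes act :: "'a::field W1elem \<Rightarrow> ('x \<Rightarrow> 'a) \<Rightarrow> 'x \<Rightarrow> 'a"
  assumes M: "is_W1mod p M act" and S: "is_submod p M act S" and T: "is_submod p M act T"
  shows "is_submod p M act {u + v | u v. u \<in> S \<and> v \<in> T}" (is "is_submod _ _ _ ?U")
  unfolding is_submod_def
proof (intro conjI ballI)
  have sub: "S \<subseteq> M" "T \<subseteq> M" using S T by (auto dest: submod_subset)
  show "?U \<subseteq> M"
    using sub fscale.subspace_add[OF W1mod_subspace[OF M]] by blast
  show "module.subspace fscale ?U"
    using fscale.subspace_sums[OF submod_subspace[OF S] submod_subspace[OF T]] .
  fix D :: "'a W1elem" and v assume D: "D \<in> W1 p" and "v \<in> ?U"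
  then obtain u w where v: "v = u + w" "u \<in> S" "w \<in> T" by blast
  then have "act D v = act D u + act D w"
    using sub W1mod_add[OF M D] by blast
  then show "act D v \<in> ?U"
    using submod_closed[OF S D] submod_closed[OF T D] v by blast
qed

lemma hom_in: "is_hom p M act N act' f \<Longrightarrow> v \<in> M \<Longrightarrow> f v \<in> N"
  and hom_add: "is_hom p M act N act' f \<Longrightarrow> u \<in> M \<Longrightarrow> v \<in> M \<Longrightarrow> f (u + v) = f u + f v"
  and hom_scale: "is_hom p M act N act' f \<Longrightarrow> v \<in> M \<Longrightarrow> f (fscale c v) = fscale c (f v)"
  and hom_act: "is_hom p M act N act' f \<Longrightarrow> D \<in> W1 p \<Longrightarrow> v \<in> M \<Longrightarrow> f (act D v) = act' D (f v)"
  by (simp_all add: is_hom_def)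

lemma hom_zero:
  assumes "is_hom p M act N act' f" "module.subspace fscale M"
  shows "f 0 = 0"
  using hom_scale[OF assms(1), of 0 0] fscale.subspace_0[OF assms(2)] by simp

lemma hom_diff:
  fixes f :: "('c \<Rightarrow> 'b::field) \<Rightarrow> 'd \<Rightarrow> 'b"
  assumes f: "is_hom p M act N act' f" and M: "module.subspace fscale M" and "u \<in> M" "v \<in> M"
  shows "f (u - v) = f u - f v"
proof -
  have "x - y = x + fscale (-1) y" for x y :: "'d \<Rightarrow> 'b"
    by (simp add: fun_eq_iff)
  moreover have "u - v = u + fscale (-1) v"
    by (simp add: fun_eq_iff)
  ultimately show ?thesis
    using hom_add[OF f assms(3) fscale.subspace_scale[OF M assms(4)], of "-1"]
      hom_scale[OF f assms(4), of "-1"] by metis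
qed

lemma hom_comp:
  "is_hom p M act N act' f \<Longrightarrow> is_hom p N act' K act'' g \<Longrightarrow> is_hom p M act K act'' (g \<circ> f)"
  by (simp add: is_hom_def)

lemma hom_restrict: "is_hom p M act N act' f \<Longrightarrow> S \<subseteq> M \<Longrightarrow> is_hom p S act N act' f"
  by (auto simp: is_hom_def subset_iff)

lemma hom_incl: "S \<subseteq> M \<Longrightarrow> is_hom p S act M act (\<lambda>v. v)"
  by (auto simp: is_hom_def)

text \<open>Every axiom on \<open>N\<close> is the image of the same axiom on \<open>M\<close>. In
  this way \<open>Hact\<close> is later recognised as an action on \<open>Hset\<close> without
  verifying the Jacobi identity for brackets.\<close>

lemma W1mod_image:
  assumes f: "is_hom p M act N act' f" and N: "f ` M = N" and M: "is_W1mod p M act"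
  shows "is_W1mod p N act'"
proof -
  note cl = W1mod_closed[OF M] fscale.subspace_add[OF W1mod_subspace[OF M]]
    fscale.subspace_scale[OF W1mod_subspace[OF M]] fscale.subspace_diff[OF W1mod_subspace[OF M]]
  note h = hom_add[OF f, symmetric] hom_scale[OF f, symmetric] hom_act[OF f, symmetric]
    hom_diff[OF f W1mod_subspace[OF M], symmetric]
  have "module.subspace fscale N"
    unfolding N[symmetric]
  proof (intro fscale.subspaceI)
    show "0 \<in> f ` M"
      using hom_zero[OF f W1mod_subspace[OF M]] fscale.subspace_0[OF W1mod_subspace[OF M]] by force
  qed (auto simp: h cl)
  then show ?thesis
    unfolding is_W1mod_def N[symmetric]
    by (auto simp: h cl W1mod_add[OF M] W1mod_addl[OF M] W1mod_scale[OF M] W1mod_scalel[OF M]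
        W1mod_bracket[OF M, unfolded One_nat_def])
qed

lemma submod_preimage:
  assumes f: "is_hom p M act N act' f" and M: "is_W1mod p M act" and S: "is_submod p N act' S"
  shows "is_submod p M act {v \<in> M. f v \<in> S}"
  unfolding is_submod_def
proof (intro conjI ballI)
  note M0 = W1mod_subspace[OF M] and S0 = submod_subspace[OF S]
  show "module.subspace fscale {v \<in> M. f v \<in> S}"
    using fscale.subspace_0[OF M0] fscale.subspace_0[OF S0] fscale.subspace_add[OF M0]
      fscale.subspace_add[OF S0] fscale.subspace_scale[OF M0] fscale.subspace_scale[OF S0]
    by (intro fscale.subspaceI) (auto simp: hom_zero[OF f M0] hom_add[OF f] hom_scale[OF f])
qed (auto simp: hom_act[OF f] W1mod_closed[OF M] submod_closed[OF S])

lemma submod_kernel: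
  assumes "is_hom p M act N act' f" "is_W1mod p M act" "is_W1mod p N act'"
  shows "is_submod p M act {v \<in> M. f v = 0}"
  using submod_preimage[OF assms(1,2) submod_zero[OF assms(3)]] by simp

lemma submod_image:
  assumes f: "is_hom p M act N act' f" and M: "is_W1mod p M act" and S: "is_submod p M act S"
  shows "is_submod p N act' (f ` S)"
proof -
  have "is_W1mod p (f ` S) act'"
    using W1mod_image[of p S act "f ` S" act' f] hom_restrict[OF f submod_subset[OF S]]
      submod_W1mod[OF M S] by (auto simp: is_hom_def)
  then show ?thesis
    using hom_in[OF f] submod_subset[OF S] by (auto simp: is_submod_def is_W1mod_def)
qed

lemma isoI:
  assumes f: "is_hom p M act N act' f" and M: "module.subspace fscale M"
    and "\<And>v. v \<in> M \<Longrightarrow> f v = 0 \<Longrightarrow> v = 0" and "f ` M = N"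
  shows "is_iso p M act N act' f"
proof -
  have "inj_on f M"
  proof (rule inj_onI)
    fix u v assume uv: "u \<in> M" "v \<in> M" "f u = f v"
    then have "f (u - v) = 0" using hom_diff[OF f M] by simp
    then show "u = v"
      using assms(3) uv fscale.subspace_diff[OF M] by (metis eq_iff_diff_eq_0)
  qed
  then show ?thesis using assms by (simp add: is_iso_def bij_betw_def)
qed

lemma iso_hom: "is_iso p M act N act' f \<Longrightarrow> is_hom p M act N act' f"
  and iso_image: "is_iso p M act N act' f \<Longrightarrow> f ` M = N"
  and iso_inj: "is_iso p M act N act' f \<Longrightarrow> inj_on f M"
  by (simp_all add: is_iso_def bij_betw_def)

lemma iso_kernel:
  assumes "is_iso p M act N act' f" "module.subspace fscale M"
  shows "{v \<in> M. f v = 0} = {0}"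
  using hom_zero[OF iso_hom[OF assms(1)] assms(2)] iso_inj[OF assms(1)] fscale.subspace_0[OF assms(2)]
  by (auto simp: inj_on_def)

text \<open>The source is only asked to be a subspace closed under the action, because this is
  applied to \<open>Balg\<close> with \<open>bact\<close> before any module axioms are available
  there.\<close>

lemma iso_inv_closed:
  assumes f: "is_iso p M act N act' f" and M: "module.subspace fscale M"
    and cl: "\<And>D v. D \<in> W1 p \<Longrightarrow> v \<in> M \<Longrightarrow> act D v \<in> M"
  shows "is_iso p N act' M act (inv_into M f)"
proof -
  note h = iso_hom[OF f]
  have N: "f ` M = N" and inj: "inj_on f M" using f by (auto simp: is_iso_def bij_betw_def)
  have "is_hom p N act' M act (inv_into M f)"
    unfolding is_hom_def N[symmetric]
    by (auto simp: inv_into_f_f[OF inj] hom_add[OF h, symmetric] hom_scale[OF h, symmetric]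
        hom_act[OF h, symmetric] cl fscale.subspace_add[OF M] fscale.subspace_scale[OF M])
  then show ?thesis
    using f by (auto simp: is_iso_def bij_betw_inv_into)
qed

lemma iso_inv:
  assumes "is_iso p M act N act' f" "is_W1mod p M act"
  shows "is_iso p N act' M act (inv_into M f)"
  using iso_inv_closed[OF assms(1) W1mod_subspace[OF assms(2)] W1mod_closed[OF assms(2)]] .

lemma iso_comp:
  "is_iso p M act N act' f \<Longrightarrow> is_iso p N act' K act'' g \<Longrightarrow> is_iso p M act K act'' (g \<circ> f)"
  by (auto simp: is_iso_def intro: hom_comp bij_betw_trans)

text \<open>The universal property of the quotient of \<open>M\<close> by the kernel of
  \<open>f\<close>, with \<open>L\<close> in the role of the quotient: \<open>h\<close> evaluates
  \<open>g\<close> at a chosen preimage, and the kernel condition makes the choice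
  irrelevant.\<close>

lemma hom_factor:
  assumes M: "is_W1mod p M act" and f: "is_hom p M act L actL f" and fL: "f ` M = L"
    and g: "is_hom p M act N act' g" and ker: "\<And>v. v \<in> M \<Longrightarrow> f v = 0 \<Longrightarrow> g v = 0"
  shows "\<exists>h. is_hom p L actL N act' h \<and> (\<forall>v\<in>M. h (f v) = g v)"
proof -
  note M0 = W1mod_subspace[OF M]
  define h where "h = g \<circ> inv_into M f"
  have hf: "h (f v) = g v" if "v \<in> M" for v
  proof -
    let ?w = "inv_into M f (f v)"
    have w: "?w \<in> M" "f ?w = f v" using that by (auto simp: inv_into_into f_inv_into_f)
    then have "f (?w - v) = 0" using hom_diff[OF f M0] that by simp
    then have "g (?w - v) = 0" using ker w that fscale.subspace_diff[OF M0] by blast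
    then show ?thesis using hom_diff[OF g M0] w that by (simp add: h_def)
  qed
  have "is_hom p L actL N act' h"
    unfolding is_hom_def fL[symmetric]
    by (auto simp: hf hom_add[OF f, symmetric] hom_scale[OF f, symmetric] hom_act[OF f, symmetric]
        W1mod_closed[OF M] fscale.subspace_add[OF M0] fscale.subspace_scale[OF M0]
        hom_in[OF g] hom_add[OF g] hom_scale[OF g] hom_act[OF g])
  then show ?thesis using hf by blast
qed

lemma iso_of_same_kernel:
  assumes M: "is_W1mod p M act" and f: "is_hom p M act L actL f" "f ` M = L"
    and g: "is_hom p M act N act' g" "g ` M = N"
    and ker: "{v \<in> M. f v = 0} = {v \<in> M. g v = 0}"
  shows "\<exists>h. is_iso p L actL N act' h"
proof -
  have "\<And>v. v \<in> M \<Longrightarrow> f v = 0 \<Longrightarrow> g v = 0" using ker by blast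
  from hom_factor[OF M f g(1) this]
  obtain h where h: "is_hom p L actL N act' h" "\<And>v. v \<in> M \<Longrightarrow> h (f v) = g v"
    by blast
  have "is_iso p L actL N act' h"
  proof (rule isoI[OF h(1) W1mod_subspace[OF W1mod_image[OF f M]]])
    show "h ` L = N"
      unfolding f(2)[symmetric] g(2)[symmetric] image_image by (rule image_cong) (auto simp: h(2))
    fix v assume "v \<in> L" "h v = 0"
    then obtain u where u: "u \<in> M" "v = f u" unfolding f(2)[symmetric] by blast
    then have "g u = 0" using h(2)[OF u(1)] \<open>h v = 0\<close> by simp
    then show "v = 0" using u ker by blast
  qed
  then show ?thesis by blast
qed

text \<open>The image of \<open>S\<close> is a submodule of the simple module \<open>L\<close>. If
  it is 0, then \<open>S\<close> is the kernel; if it is \<open>L\<close>, every element of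
  \<open>M\<close> differs from one of \<open>S\<close> by a kernel element, which lies in
  \<open>S\<close>.\<close>

lemma kernel_maximal:
  assumes M: "is_W1mod p M act" and f: "is_hom p M act L actL f" "f ` M = L"
    and L: "is_simple p L actL" and S: "is_submod p M act S" "{v \<in> M. f v = 0} \<subseteq> S"
  shows "S = {v \<in> M. f v = 0} \<or> S = M"
proof -
  have "f ` S = {0} \<or> f ` S = L"
    using submod_image[OF f(1) M S(1)] L by (auto simp: is_simple_def)
  then show ?thesis
  proof
    assume "f ` S = {0}"
    then show ?thesis using S submod_subset[OF S(1)] by auto
  next
    assume eq: "f ` S = L"
    have "m \<in> S" if m: "m \<in> M" for m
    proof -
      obtain s where s: "s \<in> S" "f m = f s" using eq m f(2) by (metis imageE imageI)
      then have sM: "s \<in> M" using submod_subset[OF S(1)] by blast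
      have "m - s \<in> S"
        using s m sM S(2) hom_diff[OF f(1) W1mod_subspace[OF M]] fscale.subspace_diff[OF W1mod_subspace[OF M]]
        by (auto simp: subset_iff)
      then have "(m - s) + s \<in> S" using s fscale.subspace_add[OF submod_subspace[OF S(1)]] by blast
      then show ?thesis by simp
    qed
    then show ?thesis using submod_subset[OF S(1)] by blast
  qed
qed

lemma simple_W1mod: "is_simple p L act \<Longrightarrow> is_W1mod p L act"
  by (simp add: is_simple_def)

text \<open>Second isomorphism theorem: \<open>P\<close> together with \<open>C\<close> spans
  \<open>C'\<close>, and \<open>f\<close> has kernel P \<inter> C on \<open>P\<close>, so C'/C is
  P/(P \<inter> C), which is \<open>L\<close>.\<close>

lemma factor_iso_of_complement:
  assumes M: "is_W1mod p M act" and C: "is_submod p M act C" and C': "is_submod p M act C'"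
    and P: "is_submod p M act P" and "C \<subseteq> C'" "P \<subseteq> C'" and sum: "\<And>x. x \<in> C' \<Longrightarrow> \<exists>d\<in>P. x - d \<in> C"
    and f: "is_hom p P act L actL f" and fL: "f ` P = L"
    and ker: "\<And>d. d \<in> P \<Longrightarrow> f d = 0 \<longleftrightarrow> d \<in> C"
  shows "factor_iso p act C C' L actL"
proof -
  note P0 = submod_subspace[OF P] and C0 = submod_subspace[OF C] and C'0 = submod_subspace[OF C']
  \<comment> \<open>An element of \<open>C'\<close> is sent to the value of \<open>f\<close> at some
    \<open>P\<close>-part of it; two such parts differ by an element of P \<inter> C, where
    \<open>f\<close> vanishes.\<close>
  define g where "g x = f (SOME d. d \<in> P \<and> x - d \<in> C)" for x
  have g: "g x = f d" if "d \<in> P" "x - d \<in> C" for x d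
  proof -
    let ?e = "SOME d. d \<in> P \<and> x - d \<in> C"
    have e: "?e \<in> P" "x - ?e \<in> C" using someI[of "\<lambda>d. d \<in> P \<and> x - d \<in> C" d] that by auto
    have "d - ?e = (x - ?e) - (x - d)" by simp
    then have "d - ?e \<in> C" using fscale.subspace_diff[OF C0] e(2) that(2) by presburger
    then have "f (d - ?e) = 0" using ker e(1) that fscale.subspace_diff[OF P0] by blast
    then show ?thesis using hom_diff[OF f P0] e(1) that by (simp add: g_def)
  qed
  have "is_hom p C' act L actL g"
    unfolding is_hom_def
  proof (intro conjI ballI allI)
    fix u v c D assume u: "u \<in> C'"
    then obtain d where d: "d \<in> P" "u - d \<in> C" using sum by blast
    have dM: "d \<in> M" "u \<in> M" using d u submod_subset[OF P] submod_subset[OF C'] by auto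
    show "g u \<in> L" using g[OF d] hom_in[OF f] d by simp
    have "fscale c u - fscale c d \<in> C"
      using fscale.subspace_scale[OF C0 d(2), of c] by (simp add: fscale.scale_right_diff_distrib)
    then show "g (fscale c u) = fscale c (g u)"
      using g[OF d] g[of "fscale c d" "fscale c u"] d fscale.subspace_scale[OF P0] hom_scale[OF f] by simp
    show "g (act D u) = actL D (g u)" if D: "D \<in> W1 p"
    proof -
      have "act D ((u - d) + d) = act D (u - d) + act D d"
        using W1mod_add[OF M D] dM fscale.subspace_diff[OF W1mod_subspace[OF M]] by blast
      then have "act D u - act D d = act D (u - d)" by simp
      then have "act D u - act D d \<in> C" using submod_closed[OF C D d(2)] by simp
      then show ?thesis
        using g[OF d] g[of "act D d" "act D u"] submod_closed[OF P D d(1)] hom_act[OF f D d(1)] by simp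
    qed
    show "g (u + v) = g u + g v" if v: "v \<in> C'"
    proof -
      obtain e where e: "e \<in> P" "v - e \<in> C" using sum v by blast
      have "(u + v) - (d + e) = (u - d) + (v - e)" by simp
      then have "(u + v) - (d + e) \<in> C" using fscale.subspace_add[OF C0 d(2) e(2)] by presburger
      then show ?thesis
        using g[OF d] g[OF e] g[of "d + e" "u + v"] fscale.subspace_add[OF P0 d(1) e(1)]
          hom_add[OF f d(1) e(1)] by simp
    qed
  qed
  moreover have "g ` C' = L"
  proof
    show "g ` C' \<subseteq> L" using calculation by (auto dest: hom_in)
    have "f d \<in> g ` C'" if "d \<in> P" for d
      using g[of d d] that assms(6) fscale.subspace_0[OF C0] by (metis diff_self image_eqI subsetD)
    then show "L \<subseteq> g ` C'" using fL by auto
  qed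
  moreover have "{v \<in> C'. g v = 0} = C"
  proof -
    have "g x = 0 \<longleftrightarrow> x \<in> C" if x: "x \<in> C'" for x
    proof -
      obtain d where d: "d \<in> P" "x - d \<in> C" using sum x by blast
      have "g x = 0 \<longleftrightarrow> d \<in> C" using g[OF d] ker d by simp
      also have "\<dots> \<longleftrightarrow> x \<in> C"
        using fscale.subspace_add[OF C0 d(2), of d] fscale.subspace_diff[OF C0 _ d(2), of x] by auto
      finally show ?thesis .
    qed
    then show ?thesis using \<open>C \<subseteq> C'\<close> by blast
  qed
  ultimately show ?thesis unfolding factor_iso_def by blast
qed

section \<open>Composition series\<close>

text \<open>Zassenhaus' lemma for simple factors. The last two assumptions say that A' \<inter> B'
  is not contained in \<open>A\<close> but A' \<inter> B is. By maximality A' \<inter> B' maps onto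
  both A'/A and B'/B, and the two kernels coincide, so the factors are isomorphic.\<close>

lemma butterfly:
  assumes M: "is_W1mod p M act"
    and A: "is_submod p M act A" and A': "is_submod p M act A'" and "A \<subseteq> A'"
    and B: "is_submod p M act B" and B': "is_submod p M act B'" and "B \<subseteq> B'"
    and maxA: "\<And>S. is_submod p M act S \<Longrightarrow> A \<subseteq> S \<Longrightarrow> S \<subseteq> A' \<Longrightarrow> S = A \<or> S = A'"
    and maxB: "\<And>S. is_submod p M act S \<Longrightarrow> B \<subseteq> S \<Longrightarrow> S \<subseteq> B' \<Longrightarrow> S = B \<or> S = B'"
    and n: "\<not> A' \<inter> B' \<subseteq> A" and s: "A' \<inter> B \<subseteq> A"
  shows "\<not> B' \<inter> A' \<subseteq> B" and "B' \<inter> A \<subseteq> B"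
    and "factor_iso p act B B' L actL \<Longrightarrow> factor_iso p act A A' L actL"
proof -
  note sub = submod_subspace
  have sum: "U = {u + v | u v. u \<in> X \<and> v \<in> Y} \<Longrightarrow> is_submod p M act U \<and> X \<subseteq> U \<and> Y \<subseteq> U"
    if X: "is_submod p M act X" and Y: "is_submod p M act Y" for X Y U
    using submod_sum[OF M X Y] fscale.subspace_0[OF sub[OF X]] fscale.subspace_0[OF sub[OF Y]]
    by (auto, metis add.right_neutral, metis add.left_neutral)
  show 1: "\<not> B' \<inter> A' \<subseteq> B" using n s by blast
  show 2: "B' \<inter> A \<subseteq> B"
  proof -
    define U where "U = {u + v | u v. u \<in> B \<and> v \<in> B' \<inter> A}"
    note U = sum[OF B submod_Int[OF B' A] U_def]
    have "U \<subseteq> B'" using fscale.subspace_add[OF sub[OF B']] \<open>B \<subseteq> B'\<close> by (auto simp: U_def)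
    then have "U = B \<or> U = B'" using maxB U by blast
    moreover have "U \<noteq> B'"
    \<comment> \<open>If B + (B' \<inter> A) were all of \<open>B'\<close>, an element of A'
      \<inter> B' outside \<open>A\<close> would be b + a with b in A' \<inter> B, hence b in
      \<open>A\<close>, a contradiction.\<close>
    proof
      assume eq: "U = B'"
      obtain d where d: "d \<in> A'" "d \<in> B'" "d \<notin> A" using n by blast
      then have "d \<in> U" using eq by simp
      then obtain b a where ba: "d = b + a" "b \<in> B" "a \<in> B'" "a \<in> A" unfolding U_def by blast
      then have "b \<in> A'" using fscale.subspace_diff[OF sub[OF A'] d(1), of a] \<open>A \<subseteq> A'\<close> by auto
      then have "b + a \<in> A" using s ba fscale.subspace_add[OF sub[OF A]] by blast
      then show False using d ba by simp
    qed
    ultimately show ?thesis using U by blast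
  qed
  assume "factor_iso p act B B' L actL"
  then obtain f where f: "is_hom p B' act L actL f" "f ` B' = L" "{v \<in> B'. f v = 0} = B"
    unfolding factor_iso_def by blast
  let ?P = "A' \<inter> B'"
  note P = submod_Int[OF A' B']
  show "factor_iso p act A A' L actL"
  proof (rule factor_iso_of_complement[OF M A A' P \<open>A \<subseteq> A'\<close>])
    show "is_hom p ?P act L actL f" using hom_restrict[OF f(1)] by blast
    show "f d = 0 \<longleftrightarrow> d \<in> A" if "d \<in> ?P" for d
      using that f(3) 2 s by blast
    show "\<exists>d\<in>?P. x - d \<in> A" if x: "x \<in> A'" for x
    proof -
      define U where "U = {u + v | u v. u \<in> A \<and> v \<in> ?P}"
      note U = sum[OF A P U_def]
      have "U \<subseteq> A'" using fscale.subspace_add[OF sub[OF A']] \<open>A \<subseteq> A'\<close> by (auto simp: U_def)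
      then have "U = A'" using maxA U n by blast
      then have "x \<in> U" using x by simp
      then obtain a d where "x = a + d" "a \<in> A" "d \<in> ?P" unfolding U_def by blast
      then show ?thesis by (intro bexI[of _ d]) auto
    qed
    show "f ` ?P = L"
    proof
      show "f ` ?P \<subseteq> L" using f by blast
      define U where "U = {u + v | u v. u \<in> B \<and> v \<in> ?P}"
      note U = sum[OF B P U_def]
      have "U \<subseteq> B'" using fscale.subspace_add[OF sub[OF B']] \<open>B \<subseteq> B'\<close> by (auto simp: U_def)
      then have eq: "U = B'" using maxB U 1 by blast
      show "L \<subseteq> f ` ?P"
      proof
        fix y assume "y \<in> L"
        then obtain x where x: "x \<in> B'" "y = f x" using f(2) by blast
        then have "x \<in> U" using eq by simp
        then obtain b d where bd: "x = b + d" "b \<in> B" "d \<in> ?P" unfolding U_def by blast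
        moreover have "f b = 0" "b \<in> B'" using bd(2) f(3) by auto
        ultimately have "y = f d" using hom_add[OF f(1), of b d] x by simp
        then show "y \<in> f ` ?P" using bd by blast
      qed
    qed
  qed auto
qed

lemma comp_series_mono:
  assumes "is_comp_series p M act Cs" "i \<le> j" "j < length Cs"
  shows "Cs ! i \<subseteq> Cs ! j"
  using assms(2,3)
proof (induction rule: dec_induct)
  case (step k)
  then have "Cs ! k \<subseteq> Cs ! Suc k" using assms(1) by (auto simp: is_comp_series_def)
  then show ?case using step by auto
qed simp

lemma comp_series_submod: "is_comp_series p M act Cs \<Longrightarrow> i < length Cs \<Longrightarrow> is_submod p M act (Cs ! i)"
  by (simp add: is_comp_series_def)

lemma comp_series_step:
  "is_comp_series p M act Cs \<Longrightarrow> Suc i < length Cs \<Longrightarrow> Cs ! i \<subset> Cs ! Suc i"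
  by (simp add: is_comp_series_def)

lemma comp_series_max:
  "is_comp_series p M act Cs \<Longrightarrow> Suc i < length Cs \<Longrightarrow> is_submod p M act S \<Longrightarrow> Cs ! i \<subseteq> S \<Longrightarrow>
    S \<subseteq> Cs ! Suc i \<Longrightarrow> S = Cs ! i \<or> S = Cs ! Suc i"
  by (simp add: is_comp_series_def)

text \<open>The factors \<open>Cs ! Suc i / Cs ! i\<close> and \<open>Ks ! Suc t / Ks ! t\<close> are matched when the
  filtration that \<open>Ks\<close> induces on the former jumps at \<open>t\<close>. By the butterfly lemma this relation
  is symmetric, so it is a bijection between the factors of the two series.\<close>

definition jump :: "'b set list \<Rightarrow> 'b set list \<Rightarrow> nat \<Rightarrow> nat \<Rightarrow> bool" where
  "jump Cs Ks i t \<longleftrightarrow> \<not> Cs ! Suc i \<inter> Ks ! Suc t \<subseteq> Cs ! i \<and> Cs ! Suc i \<inter> Ks ! t \<subseteq> Cs ! i"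

lemma jump_sym:
  assumes "is_W1mod p M act" "is_comp_series p M act Cs" "is_comp_series p M act Ks"
    "Suc i < length Cs" "Suc t < length Ks" "jump Cs Ks i t"
  shows "jump Ks Cs t i"
    and "factor_iso p act (Ks ! t) (Ks ! Suc t) L actL \<Longrightarrow> factor_iso p act (Cs ! i) (Cs ! Suc i) L actL"
proof -
  note 1 = butterfly[OF assms(1) comp_series_submod[OF assms(2)] comp_series_submod[OF assms(2)] _
      comp_series_submod[OF assms(3)] comp_series_submod[OF assms(3)] _
      comp_series_max[OF assms(2,4)] comp_series_max[OF assms(3,5)]]
  have 2: "i < length Cs" "t < length Ks" "Cs ! i \<subseteq> Cs ! Suc i" "Ks ! t \<subseteq> Ks ! Suc t"
    using assms(4,5) comp_series_step[OF assms(2,4)] comp_series_step[OF assms(3,5)] by auto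
  show "jump Ks Cs t i"
    using 1(1,2)[OF 2(1) assms(4) 2(3) 2(2) assms(5) 2(4)] assms(6) by (auto simp: jump_def)
  show "factor_iso p act (Cs ! i) (Cs ! Suc i) L actL" if "factor_iso p act (Ks ! t) (Ks ! Suc t) L actL"
    using 1(3)[OF 2(1) assms(4) 2(3) 2(2) assms(5) 2(4)] assms(6) that by (auto simp: jump_def)
qed

text \<open>The intersections with \<open>Ks ! t\<close> start inside \<open>Cs ! i\<close> (at 0)
  and end outside it (at \<open>M\<close>); the jump is just before the first index at which they
  leave it.\<close>

lemma jump_exists:
  assumes C: "is_comp_series p M act Cs" and K: "is_comp_series p M act Ks" and i: "Suc i < length Cs"
  obtains t where "Suc t < length Ks" "jump Cs Ks i t"
proof -
  let ?n = "length Ks - 1"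
  have K0: "Ks ! 0 = {0}" "Ks ! ?n = M" "Ks \<noteq> []"
    using K by (auto simp: is_comp_series_def hd_conv_nth last_conv_nth)
  define P where "P t \<longleftrightarrow> \<not> Cs ! Suc i \<inter> Ks ! t \<subseteq> Cs ! i" for t
  have "P ?n"
    using comp_series_step[OF C i] submod_subset[OF comp_series_submod[OF C i]] K0 by (auto simp: P_def)
  have "\<not> P 0"
    using fscale.subspace_0[OF submod_subspace[OF comp_series_submod[OF C, of i]]] i K0 by (auto simp: P_def)
  define m where "m = (LEAST t. P t)"
  have m: "P m" "m \<le> ?n" "\<And>t. t < m \<Longrightarrow> \<not> P t"
    unfolding m_def using \<open>P ?n\<close> by (auto intro: LeastI Least_le dest: not_less_Least)
  then have "m \<noteq> 0" using \<open>\<not> P 0\<close> by metis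
  then obtain t where t: "m = Suc t" using not0_implies_Suc by blast
  have "Suc t < length Ks" using m(2) t K0(3) by (cases Ks) auto
  moreover have "jump Cs Ks i t" using m(1) m(3)[of t] t by (auto simp: jump_def P_def)
  ultimately show ?thesis using that by blast
qed

lemma jump_unique:
  assumes K: "is_comp_series p M act Ks" and "jump Cs Ks i t" "jump Cs Ks i t'"
    "Suc t < length Ks" "Suc t' < length Ks"
  shows "t = t'"
proof -
  have "\<not> a < b" if "jump Cs Ks i a" "jump Cs Ks i b" "Suc b < length Ks" for a b
  proof
    assume "a < b"
    then have "Ks ! Suc a \<subseteq> Ks ! b" using comp_series_mono[OF K, of "Suc a" b] that(3) by simp
    then show False using that(1,2) unfolding jump_def by blast
  qed
  then have "\<not> t < t'" "\<not> t' < t" using assms by blast+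
  then show ?thesis by simp
qed

text \<open>The index \<open>t\<close> is fixed before \<open>L\<close>, so one factor of
  \<open>Ks\<close> serves for every module it is isomorphic to.\<close>

lemma jordan_hoelder_factor:
  fixes act :: "'a::field W1elem \<Rightarrow> ('x \<Rightarrow> 'a) \<Rightarrow> 'x \<Rightarrow> 'a"
  assumes M: "is_W1mod p M act" and C: "is_comp_series p M act Cs" and K: "is_comp_series p M act Ks"
    and i: "Suc i < length Cs"
  shows "\<exists>t. Suc t < length Ks \<and> (\<forall>(L :: ('y \<Rightarrow> 'a) set) actL.
    factor_iso p act (Ks ! t) (Ks ! Suc t) L actL \<longrightarrow> factor_iso p act (Cs ! i) (Cs ! Suc i) L actL)"
proof -
  obtain t where t: "Suc t < length Ks" "jump Cs Ks i t" using jump_exists[OF C K i] .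
  show ?thesis using t(1) jump_sym(2)[OF M C K i t] by (intro exI[of _ t] conjI allI impI)
qed

text \<open>Matching each factor of \<open>Cs\<close> with its jump in \<open>Ks\<close> is
  injective, since by symmetry \<open>i\<close> is the jump of \<open>tt i\<close> back in
  \<open>Cs\<close> and jumps are unique. Exchanging the series gives the reverse
  inequality.\<close>

lemma jordan_hoelder_card_le:
  assumes M: "is_W1mod p M act" and C: "is_comp_series p M act Cs" and K: "is_comp_series p M act Ks"
  shows "card {i. Suc i < length Cs \<and> factor_iso p act (Cs ! i) (Cs ! Suc i) L actL}
       \<le> card {i. Suc i < length Ks \<and> factor_iso p act (Ks ! i) (Ks ! Suc i) L actL}"
proof -
  define tt where "tt i = (SOME t. Suc t < length Ks \<and> jump Cs Ks i t)" for i
  have tt: "Suc (tt i) < length Ks \<and> jump Cs Ks i (tt i)" if "Suc i < length Cs" for i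
  proof -
    obtain t where "Suc t < length Ks" "jump Cs Ks i t" using jump_exists[OF C K \<open>Suc i < length Cs\<close>] .
    then show ?thesis unfolding tt_def using someI[of "\<lambda>t. Suc t < length Ks \<and> jump Cs Ks i t" t] by blast
  qed
  have sym: "jump Ks Cs (tt i) i" if "Suc i < length Cs" for i
    using jump_sym(1)[OF M C K that] tt[OF that] by blast
  show ?thesis
  proof (rule card_inj_on_le[of tt])
    show "inj_on tt {i. Suc i < length Cs \<and> factor_iso p act (Cs ! i) (Cs ! Suc i) L actL}"
    proof (rule inj_onI, clarify)
      fix i j assume ij: "Suc i < length Cs" "Suc j < length Cs" "tt i = tt j"
      show "i = j" using jump_unique[OF C sym[OF ij(1)] sym[OF ij(2), folded ij(3)] ij(1,2)] .
    qed
    show "finite {i. Suc i < length Ks \<and> factor_iso p act (Ks ! i) (Ks ! Suc i) L actL}"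
      by (rule finite_subset[of _ "{..<length Ks}"]) auto
    show "tt ` {i. Suc i < length Cs \<and> factor_iso p act (Cs ! i) (Cs ! Suc i) L actL}
      \<subseteq> {i. Suc i < length Ks \<and> factor_iso p act (Ks ! i) (Ks ! Suc i) L actL}"
    proof (rule image_subsetI, clarify)
      fix i assume i: "Suc i < length Cs" "factor_iso p act (Cs ! i) (Cs ! Suc i) L actL"
      show "Suc (tt i) < length Ks \<and> factor_iso p act (Ks ! tt i) (Ks ! Suc (tt i)) L actL"
        using jump_sym(2)[OF M K C _ i(1) sym[OF i(1)] i(2)] tt[OF i(1)] by simp
    qed
  qed
qed

section \<open>Modules with prescribed composition factors\<close>

text \<open>The list is read from the top factor down.\<close>

primrec has_factors ::
  "nat \<Rightarrow> ('a::field W1elem \<Rightarrow> ('x \<Rightarrow> 'a) \<Rightarrow> 'x \<Rightarrow> 'a) \<Rightarrow> nat list \<Rightarrow> ('x \<Rightarrow> 'a) set \<Rightarrow> bool" where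
  "has_factors p act [] M \<longleftrightarrow> M = {0}"
| "has_factors p act (j # js) M \<longleftrightarrow> (\<exists>N. is_submod p M act N \<and>
     factor_iso p act N M (fst (Lmod p j)) (snd (Lmod p j)) \<and> has_factors p act js N)"

text \<open>A composition series ascends from 0 whereas the list descends from the top, hence
  \<open>rev\<close>. Simplicity of the factors enters through \<open>kernel_maximal\<close>, which
  excludes intermediate submodules.\<close>

lemma has_factors_comp_series:
  fixes act :: "'a::field W1elem \<Rightarrow> ('x \<Rightarrow> 'a) \<Rightarrow> 'x \<Rightarrow> 'a"
  assumes simple: "\<And>j. j < p \<Longrightarrow> is_simple p (fst (Lmod p j :: 'a W1module)) (snd (Lmod p j))"
  shows "is_W1mod p M act \<Longrightarrow> has_factors p act js M \<Longrightarrow> (\<forall>j\<in>set js. j < p) \<Longrightarrow>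
    \<exists>Cs. is_comp_series p M act Cs \<and> length Cs = Suc (length js) \<and>
      (\<forall>i<length js. factor_iso p act (Cs ! i) (Cs ! Suc i) (fst (Lmod p (rev js ! i))) (snd (Lmod p (rev js ! i))))"
proof (induction js arbitrary: M)
  case Nil
  then show ?case
    by (intro exI[of _ "[M]"]) (auto simp: is_comp_series_def submod_self)
next
  case (Cons j js)
  note M = Cons.prems(1)
  obtain N where N: "is_submod p M act N"
    "factor_iso p act N M (fst (Lmod p j)) (snd (Lmod p j))" "has_factors p act js N"
    using Cons.prems(2) by auto
  obtain Cs where Cs: "is_comp_series p N act Cs" "length Cs = Suc (length js)"
    "\<And>i. i < length js \<Longrightarrow> factor_iso p act (Cs ! i) (Cs ! Suc i) (fst (Lmod p (rev js ! i))) (snd (Lmod p (rev js ! i)))"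
    using Cons.IH[OF submod_W1mod[OF M N(1)] N(3)] Cons.prems(3) by auto
  obtain f where f: "is_hom p M act (fst (Lmod p j)) (snd (Lmod p j)) f" "f ` M = fst (Lmod p j)"
    "{v \<in> M. f v = 0} = N"
    using N(2) unfolding factor_iso_def by blast
  have sj: "is_simple p (fst (Lmod p j :: 'a W1module)) (snd (Lmod p j))"
    using simple Cons.prems(3) by simp
  have last: "Cs ! length js = N"
    using Cs(1,2) by (auto simp: is_comp_series_def last_conv_nth)
  have "N \<noteq> M"
  proof
    assume "N = M"
    then have "f ` M \<subseteq> {0}" using f(3) by auto
    then show False
      using f(2) sj fscale.subspace_0[OF W1mod_subspace[OF simple_W1mod[OF sj]]]
      by (auto simp: is_simple_def)
  qed
  have max: "S = N \<or> S = M" if "is_submod p M act S" "N \<subseteq> S" for S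
    using kernel_maximal[OF M f(1,2) sj] that f(3) by auto
  have "is_comp_series p M act (Cs @ [M])"
    unfolding is_comp_series_def
  proof (intro conjI allI impI)
    show "hd (Cs @ [M]) = {0}" using Cs(1) by (auto simp: is_comp_series_def)
    show "\<forall>C\<in>set (Cs @ [M]). is_submod p M act C"
      using Cs(1) submod_trans[OF N(1)] submod_self[OF M] by (auto simp: is_comp_series_def)
    fix i assume i: "Suc i < length (Cs @ [M])"
    show "(Cs @ [M]) ! i \<subset> (Cs @ [M]) ! Suc i"
    proof (cases "i = length js")
      case True
      then show ?thesis using last Cs(2) \<open>N \<noteq> M\<close> submod_subset[OF N(1)] by (auto simp: nth_append)
    next
      case False
      then have "Suc i < length Cs" using i Cs(2) by simp
      then show ?thesis using comp_series_step[OF Cs(1)] by (simp add: nth_append)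
    qed
    fix S assume S: "is_submod p M act S \<and> (Cs @ [M]) ! i \<subseteq> S \<and> S \<subseteq> (Cs @ [M]) ! Suc i"
    show "S = (Cs @ [M]) ! i \<or> S = (Cs @ [M]) ! Suc i"
    proof (cases "i = length js")
      case True
      then show ?thesis using last Cs(2) S max by (auto simp: nth_append)
    next
      case False
      then have i: "Suc i < length Cs" using i Cs(2) by simp
      then have "S \<subseteq> Cs ! Suc i" using S by (simp add: nth_append)
      then have "is_submod p N act S"
        using S submod_subset[OF comp_series_submod[OF Cs(1) i]] by (auto simp: is_submod_def)
      then show ?thesis using comp_series_max[OF Cs(1) i] S i by (simp add: nth_append)
    qed
  qed auto
  moreover have "factor_iso p act ((Cs @ [M]) ! i) ((Cs @ [M]) ! Suc i)
      (fst (Lmod p (rev (j # js) ! i))) (snd (Lmod p (rev (j # js) ! i)))" if "i < length (j # js)" for i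
  proof (cases "i = length js")
    case True
    then show ?thesis using last Cs(2) N(2) by (simp add: nth_append)
  next
    case False
    then show ?thesis using that Cs(2) Cs(3)[of i] by (simp add: nth_append)
  qed
  ultimately show ?case using Cs(2) by (intro exI[of _ "Cs @ [M]"]) auto
qed

text \<open>The filtration of the quotient \<open>M'\<close> is pulled back along \<open>g\<close>
  and continued by that of the kernel; hence the factors of \<open>M'\<close> come first in the
  list.\<close>

lemma has_factors_extension:
  assumes "is_W1mod p M act" "is_hom p M act M' act' g" "g ` M = M'" "{v \<in> M. g v = 0} = N"
    "is_W1mod p M' act'" "has_factors p act js N" "has_factors p act' js' M'"
  shows "has_factors p act (js' @ js) M"
  using assms
proof (induction js' arbitrary: M M')
  case Nil
  have "g ` M = {0}" using Nil.prems(3,7) by simp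
  then have "N = M" using Nil.prems(4) by blast
  then show ?case using Nil by simp
next
  case (Cons j js')
  obtain N' where N': "is_submod p M' act' N'"
    "factor_iso p act' N' M' (fst (Lmod p j)) (snd (Lmod p j))" "has_factors p act' js' N'"
    using Cons.prems by auto
  let ?M2 = "{v \<in> M. g v \<in> N'}"
  have M2: "is_submod p M act ?M2" using submod_preimage[OF Cons.prems(2,1) N'(1)] .
  obtain f where f: "is_hom p M' act' (fst (Lmod p j)) (snd (Lmod p j)) f" "f ` M' = fst (Lmod p j)"
    "{v \<in> M'. f v = 0} = N'"
    using N'(2) unfolding factor_iso_def by blast
  have "factor_iso p act ?M2 M (fst (Lmod p j)) (snd (Lmod p j))"
    unfolding factor_iso_def
  proof (intro exI[of _ "f \<circ> g"] conjI)
    show "is_hom p M act (fst (Lmod p j)) (snd (Lmod p j)) (f \<circ> g)"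
      using hom_comp[OF Cons.prems(2) f(1)] .
    show "(f \<circ> g) ` M = fst (Lmod p j)" using f(2) Cons.prems(3) by (metis image_comp)
    show "{v \<in> M. (f \<circ> g) v = 0} = ?M2" using f(3) Cons.prems(3) by auto
  qed
  moreover have "has_factors p act (js' @ js) ?M2"
  proof (rule Cons.IH[OF submod_W1mod[OF Cons.prems(1) M2] _ _ _ submod_W1mod[OF Cons.prems(5) N'(1)] Cons.prems(6) N'(3)])
    show "is_hom p ?M2 act N' act' g" using Cons.prems(2) by (auto simp: is_hom_def)
    show "g ` ?M2 = N'" using Cons.prems(3) submod_subset[OF N'(1)] by blast
    show "{v \<in> ?M2. g v = 0} = N"
      unfolding Cons.prems(4)[symmetric] using fscale.subspace_0[OF submod_subspace[OF N'(1)]] by force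
  qed
  ultimately show ?case using M2 by auto
qed

lemma has_factors_iso:
  assumes M: "is_W1mod p M act" and g: "is_iso p M act M' act' g" and js: "has_factors p act' js M'"
  shows "has_factors p act js M"
  using has_factors_extension[OF M iso_hom[OF g] iso_image[OF g] iso_kernel[OF g W1mod_subspace[OF M]]
      W1mod_image[OF iso_hom[OF g] iso_image[OF g] M], of "[]" js] js by simp

lemma has_factors_Lmod:
  assumes "is_W1mod p (fst (Lmod p j :: 'a::field W1module)) (snd (Lmod p j))"
  shows "has_factors p (snd (Lmod p j)) [j] (fst (Lmod p j :: 'a W1module))"
proof -
  have "factor_iso p (snd (Lmod p j)) {0} (fst (Lmod p j)) (fst (Lmod p j :: 'a W1module)) (snd (Lmod p j))"
    unfolding factor_iso_def
    using fscale.subspace_0[OF W1mod_subspace[OF assms]] hom_incl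
    by (intro exI[of _ "\<lambda>v. v"]) auto
  then show ?thesis using submod_zero[OF assms] by auto
qed

section \<open>Direct sums\<close>

lemma dsum_mem: "f \<in> fst (dsum Ms) \<longleftrightarrow>
    (\<forall>k<length Ms. (\<lambda>x. f (k, x)) \<in> fst (Ms ! k)) \<and> (\<forall>k x. length Ms \<le> k \<longrightarrow> f (k, x) = 0)"
  by (auto simp: dsum_def)

lemma dsum_Cons_mem: "f \<in> fst (dsum (m # Ms)) \<longleftrightarrow>
    (\<lambda>x. f (0, x)) \<in> fst m \<and> (\<lambda>(k, x). f (Suc k, x)) \<in> fst (dsum Ms)"
proof -
  have "(\<forall>k x. Suc (length Ms) \<le> k \<longrightarrow> f (k, x) = 0) \<longleftrightarrow> (\<forall>k x. length Ms \<le> k \<longrightarrow> f (Suc k, x) = 0)"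
    (is "?l \<longleftrightarrow> ?r")
  proof
    assume ?r
    show ?l
    proof (intro allI impI)
      fix k x assume "Suc (length Ms) \<le> k"
      then show "f (k, x) = 0" using \<open>?r\<close> by (cases k) auto
    qed
  qed auto
  then show ?thesis by (simp add: dsum_mem All_less_Suc2)
qed

lemma dsum_act: "snd (dsum Ms) D f (k, x) = (if k < length Ms then snd (Ms ! k) D (\<lambda>y. f (k, y)) x else 0)"
  by (simp add: dsum_def)

lemma slice_add: "(\<lambda>y. (f + g) (k, y)) = (\<lambda>y. f (k, y)) + (\<lambda>y. g (k, y))"
  and slice_scale: "(\<lambda>y. fscale c f (k, y)) = fscale c (\<lambda>y. f (k, y))"
  by (auto simp: fun_eq_iff)

lemma slice_dsum_act: "k < length Ms \<Longrightarrow> (\<lambda>y. snd (dsum Ms) D f (k, y)) = snd (Ms ! k) D (\<lambda>y. f (k, y))"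
  by (simp add: dsum_act)

lemma dsum_W1mod:
  assumes Ms: "\<And>m. m \<in> set Ms \<Longrightarrow> is_W1mod p (fst m) (snd m)"
  shows "is_W1mod p (fst (dsum Ms)) (snd (dsum Ms))"
proof -
  have W: "is_W1mod p (fst (Ms ! k)) (snd (Ms ! k))" if "k < length Ms" for k
    using Ms that by simp
  have "0 \<in> fst (dsum Ms)"
    using fscale.subspace_0[OF W1mod_subspace[OF W]] by (simp add: dsum_mem zero_fun_def)
  then have "module.subspace fscale (fst (dsum Ms))"
    using fscale.subspace_add[OF W1mod_subspace[OF W]] fscale.subspace_scale[OF W1mod_subspace[OF W]]
    by (intro fscale.subspaceI)
      (auto simp: dsum_mem slice_add slice_scale simp del: plus_fun_apply fscale_apply,
        auto)
  then show ?thesis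
    unfolding is_W1mod_def
    by (auto simp: fun_eq_iff dsum_act dsum_mem slice_dsum_act W1mod_add[OF W, unfolded plus_fun_def]
        W1mod_addl[OF W] W1mod_scale[OF W, unfolded fscale_def] W1mod_scalel[OF W] W1mod_closed[OF W]
        W1mod_bracket[OF W, unfolded One_nat_def])
qed

text \<open>Recognises a direct sum by its coordinate maps. \<open>M\<close> enters only as a
  subspace, so the lemma applies to \<open>Balg\<close> before it is known to be a module.\<close>

lemma dsum_iso:
  assumes M: "module.subspace fscale M"
    and hom: "\<And>k. k < length Ms \<Longrightarrow> is_hom p M act (fst (Ms ! k)) (snd (Ms ! k)) (\<phi> k)"
    and inj: "\<And>v. v \<in> M \<Longrightarrow> (\<And>k. k < length Ms \<Longrightarrow> \<phi> k v = 0) \<Longrightarrow> v = 0"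
    and surj: "\<And>w. (\<And>k. k < length Ms \<Longrightarrow> w k \<in> fst (Ms ! k)) \<Longrightarrow>
      \<exists>v\<in>M. \<forall>k<length Ms. \<phi> k v = w k"
  shows "is_iso p M act (fst (dsum Ms)) (snd (dsum Ms)) (\<lambda>v (k, x). if k < length Ms then \<phi> k v x else 0)"
    (is "is_iso _ _ _ _ _ ?F")
proof -
  have slice: "(\<lambda>y. ?F v (k, y)) = \<phi> k v" if "k < length Ms" for v k using that by simp
  have homF: "is_hom p M act (fst (dsum Ms)) (snd (dsum Ms)) ?F"
    unfolding is_hom_def
    by (auto simp: dsum_mem fun_eq_iff dsum_act slice hom_in[OF hom] hom_add[OF hom] hom_scale[OF hom] hom_act[OF hom])
  show ?thesis
  proof (rule isoI[OF homF M])
    fix v assume v: "v \<in> M" "?F v = 0"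
    have "\<phi> k v = 0" if "k < length Ms" for k
      using slice[OF that, of v] unfolding v(2) by (simp add: zero_fun_def)
    then show "v = 0" using inj v by blast
  next
    have "f \<in> ?F ` M" if f: "f \<in> fst (dsum Ms)" for f
    proof -
      obtain v where v: "v \<in> M" "\<forall>k<length Ms. \<phi> k v = (\<lambda>x. f (k, x))"
        using surj[of "\<lambda>k x. f (k, x)"] f by (auto simp: dsum_mem)
      then have "?F v = f" using f by (auto simp: fun_eq_iff dsum_mem)
      then show ?thesis using v by blast
    qed
    then show "?F ` M = fst (dsum Ms)" using hom_in[OF homF] by blast
  qed
qed

text \<open>Projection to slot 0 has as kernel a copy of the sum of the remaining modules, shifted
  by one slot.\<close>

lemma dsum_has_factors:
  assumes "list_all2 (\<lambda>m js. is_W1mod p (fst m) (snd m) \<and> has_factors p (snd m) js (fst m)) Ms jss"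
  shows "has_factors p (snd (dsum Ms)) (concat jss) (fst (dsum Ms))"
  using assms
proof (induction rule: list_all2_induct)
  case Nil
  show ?case by (auto simp: dsum_mem fun_eq_iff)
next
  case (Cons m Ms js jss)
  let ?A = "fst (dsum (m # Ms))" and ?act = "snd (dsum (m # Ms))"
  have Ms: "is_W1mod p (fst m') (snd m')" if "m' \<in> set (m # Ms)" for m'
    using that Cons(1,2) by (auto simp: list_all2_conv_all_nth in_set_conv_nth)
  note W = dsum_W1mod[OF Ms]
  define g where "g f = (\<lambda>x. f (0::nat, x))" for f :: "nat \<times> 'a \<Rightarrow> 'b"
  have g: "is_hom p ?A ?act (fst m) (snd m) g"
    unfolding is_hom_def by (auto simp: g_def dsum_Cons_mem fun_eq_iff dsum_act)
  have gA: "g ` ?A = fst m"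
  proof -
    have "u \<in> g ` ?A" if "u \<in> fst m" for u
    proof (rule image_eqI)
      show "(\<lambda>(k, x). if k = 0 then u x else 0) \<in> ?A"
        using that fscale.subspace_0[OF W1mod_subspace[OF dsum_W1mod[OF Ms, of Ms]]]
        by (simp add: dsum_Cons_mem zero_fun_def case_prod_unfold)
    qed (simp add: g_def)
    then show ?thesis using hom_in[OF g] by blast
  qed
  let ?N = "{f \<in> ?A. g f = 0}"
  have N: "is_submod p ?A ?act ?N" using submod_kernel[OF g W] Ms by simp
  define h where "h f = (\<lambda>(k::nat, x). f (Suc k, x))" for f :: "nat \<times> 'a \<Rightarrow> 'b"
  have "is_iso p ?N ?act (fst (dsum Ms)) (snd (dsum Ms)) h"
  proof (rule isoI)
    show h: "is_hom p ?N ?act (fst (dsum Ms)) (snd (dsum Ms)) h"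
      unfolding is_hom_def by (auto simp: h_def dsum_Cons_mem fun_eq_iff dsum_act)
    show "module.subspace fscale ?N" using submod_subspace[OF N] .
    show "v = 0" if "v \<in> ?N" "h v = 0" for v
    proof -
      have "v (k, x) = 0" for k x
        using that by (cases k) (auto simp: h_def g_def fun_eq_iff)
      then show ?thesis by (auto simp: fun_eq_iff)
    qed
    have "u \<in> h ` ?N" if u: "u \<in> fst (dsum Ms)" for u
    proof (rule image_eqI)
      show "(\<lambda>(k, x). case k of 0 \<Rightarrow> 0 | Suc k \<Rightarrow> u (k, x)) \<in> ?N"
        using u fscale.subspace_0[OF W1mod_subspace[OF Ms, of m]]
        by (auto simp: dsum_Cons_mem g_def zero_fun_def)
    qed (auto simp: h_def)
    then show "h ` ?N = fst (dsum Ms)" using hom_in[OF h] by blast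
  qed
  then have "has_factors p ?act (concat jss) ?N"
    using has_factors_iso[OF submod_W1mod[OF W N]] Cons.IH by blast
  then show ?case
    using has_factors_extension[OF W g gA refl Ms] Cons.hyps(1) by simp
qed

section \<open>The p-th power of a twisted derivation\<close>

text \<open>Three operators occur because the two arguments and the value of the product
  \<open>B\<close> will be densities of different weights.\<close>

lemma leibniz_funpow:
  fixes E1 E2 E3 :: "'b::comm_ring_1 \<Rightarrow> 'b" and B :: "'b \<Rightarrow> 'b \<Rightarrow> 'b"
  assumes add: "\<And>x y. E3 (x + y) = E3 x + E3 y"
    and leib: "\<And>f g. E3 (B f g) = B (E1 f) g + B f (E2 g)"
  shows "(E3 ^^ n) (B f g) = (\<Sum>k\<le>n. of_nat (n choose k) * B ((E1 ^^ k) f) ((E2 ^^ (n - k)) g))"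
proof (induction n)
  case (Suc n)
  have E0: "E3 0 = 0" using add[of 0 0] by simp
  \<comment> \<open>Additivity gives compatibility with integer multiples, which is all that
    binomial coefficients require.\<close>
  have mult: "E3 (of_nat c * z) = of_nat c * E3 z" for c z
    by (induction c) (simp_all add: E0 add algebra_simps)
  have sum: "E3 (sum h A) = (\<Sum>k\<in>A. E3 (h k))" for h and A :: "nat set"
    by (induction A rule: infinite_finite_induct) (simp_all add: E0 add)
  define a where "a k m = B ((E1 ^^ k) f) ((E2 ^^ m) g)" for k m
  have "(E3 ^^ Suc n) (B f g) = (\<Sum>k\<le>n. of_nat (n choose k) * (a (Suc k) (n - k) + a k (Suc n - k)))"
    by (auto simp: Suc.IH sum mult leib a_def Suc_diff_le intro!: sum.cong)
  also have "\<dots> = (\<Sum>k\<le>n. of_nat (n choose k) * a (Suc k) (n - k)) + (\<Sum>k\<le>n. of_nat (n choose k) * a k (Suc n - k))"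
    by (simp add: distrib_left sum.distrib)
  also have "(\<Sum>k\<le>n. of_nat (n choose k) * a k (Suc n - k)) = (\<Sum>k\<le>Suc n. of_nat (n choose k) * a k (Suc n - k))"
    by (simp add: binomial_eq_0)
  also have "\<dots> = a 0 (Suc n) + (\<Sum>k\<le>n. of_nat (n choose Suc k) * a (Suc k) (n - k))"
    by (subst sum.atMost_Suc_shift) simp
  also have "(\<Sum>k\<le>n. of_nat (n choose k) * a (Suc k) (n - k)) + \<dots> =
      a 0 (Suc n) + (\<Sum>k\<le>n. of_nat (Suc n choose Suc k) * a (Suc k) (n - k))"
    by (simp add: sum.distrib algebra_simps)
  also have "\<dots> = (\<Sum>k\<le>Suc n. of_nat (Suc n choose k) * a k (Suc n - k))"
    by (subst sum.atMost_Suc_shift) simp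
  finally show ?case by (simp add: a_def)
qed simp

text \<open>All middle binomial coefficients are divisible by p, so only the two extreme terms of
  the Leibniz formula survive.\<close>

lemma leibniz_funpow_prime:
  fixes E1 E2 E3 :: "'b::comm_ring_1 \<Rightarrow> 'b" and B :: "'b \<Rightarrow> 'b \<Rightarrow> 'b"
  assumes add: "\<And>x y. E3 (x + y) = E3 x + E3 y"
    and leib: "\<And>f g. E3 (B f g) = B (E1 f) g + B f (E2 g)"
    and p: "prime p" "of_nat p = (0 :: 'b)"
  shows "(E3 ^^ p) (B f g) = B ((E1 ^^ p) f) g + B f ((E2 ^^ p) g)"
proof -
  define h where "h k = of_nat (p choose k) * B ((E1 ^^ k) f) ((E2 ^^ (p - k)) g)" for k
  have "h k = 0" if "k \<in> {..p} - {0, p}" for k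
  proof -
    have "p dvd (p choose k)"
      by (rule dvd_choose_prime) (use that p(1) in auto)
    then have "of_nat (p choose k) = (0 :: 'b)" using p(2) by (auto elim!: dvdE)
    then show ?thesis by (simp add: h_def)
  qed
  then have "sum h {..p} = sum h {0, p}"
    by (intro sum.mono_neutral_right) auto
  also have "\<dots> = B ((E1 ^^ p) f) g + B f ((E2 ^^ p) g)"
    using prime_gt_0_nat[OF p(1)] by (simp add: h_def add.commute)
  finally show ?thesis using leibniz_funpow[of E3 B E1 E2 p f g, OF add leib] by (simp add: h_def)
qed

text \<open>The Lie derivative along U d on densities F (dx)^(-k), before truncation. Thus k = 0
  gives functions, k = 1 vector fields, and k = -1 one-forms.\<close>

definition tder :: "nat \<Rightarrow> 'a::field poly \<Rightarrow> 'a poly \<Rightarrow> 'a poly" where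
  "tder k U F = U * pderiv F - of_nat k * pderiv U * F"

lemma tder_add: "tder k U (F + G) = tder k U F + tder k U G"
  by (simp add: tder_def pderiv_add algebra_simps)

lemma tder_mult: "tder (k + l) U (F * G) = tder k U F * G + F * tder l U G"
  by (simp add: tder_def pderiv_mult algebra_simps)

text \<open>For k = 1, \<open>tder 1 U G\<close> is the coefficient of [U d, G d], and F' G is the
  vector field G d applied to F; the identity says that this evaluation is invariant.\<close>

lemma tder_pderiv_mult: "tder 0 U (pderiv F * G) = pderiv (tder 0 U F) * G + pderiv F * tder 1 U G"
  by (simp add: tder_def pderiv_mult algebra_simps)

lemma pderiv_of_nat_poly [simp]: "pderiv (of_nat k :: 'a::field poly) = 0"
  by (simp add: of_nat_poly)

lemma tder_commutator:
  "tder k (U * pderiv V - V * pderiv U) F = tder k U (tder k V F) - tder k V (tder k U F)"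
  by (simp add: tder_def pderiv_mult pderiv_diff algebra_simps)

lemma tder_0: "tder k U 0 = 0"
  by (simp add: tder_def)

lemma funpow_tder_0: "(tder k U ^^ n) 0 = 0"
  by (induction n) (simp_all add: tder_0)

lemma funpow_tder_add: "(tder k U ^^ n) (F + G) = (tder k U ^^ n) F + (tder k U ^^ n) G"
  by (induction n) (simp_all add: tder_add)

text \<open>Both products are invariant: the multiplication of densities of weights \<open>k\<close> and \<open>l\<close>, and
  the map \<open>(F, G) \<mapsto> F' G\<close> on weights \<open>0\<close> and \<open>1\<close>. In characteristic \<open>p\<close> the p-th power is
  therefore again a derivation for them, which determines it from its value on \<open>x\<close>.\<close>

lemma funpow_tder_char:
  fixes U F :: "'a::field poly"
  assumes p: "prime p" "CHAR('a) = p"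
  shows "(tder k U ^^ p) F = tder k ((tder 0 U ^^ p) [:0, 1:]) F"
proof -
  have p0: "of_nat p = (0 :: 'a poly)"
    using p(2) by (simp add: of_nat_poly of_nat_eq_0_iff_char_dvd)
  have L1: "(tder (k + l) U ^^ p) (F * G) = (tder k U ^^ p) F * G + F * (tder l U ^^ p) G" for k l F G
    by (rule leibniz_funpow_prime[of "tder (k + l) U" "(*)" "tder k U" "tder l U", OF tder_add tder_mult p(1) p0])
  note L2 = leibniz_funpow_prime[of "tder 0 U" "\<lambda>F G. pderiv F * G" "tder 0 U" "tder 1 U" p, OF tder_add tder_pderiv_mult p(1) p0]
  define w where "w = (tder 0 U ^^ p) [:0, 1:]"
  obtain n where n: "p = Suc n" using prime_gt_0_nat[OF p(1)] gr0_implies_Suc by blast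
  have const: "(tder 0 U ^^ p) [:a:] = 0" for a
  proof -
    have "(tder 0 U ^^ p) [:a:] = (tder 0 U ^^ n) (tder 0 U [:a:])"
      unfolding n by (simp only: funpow_Suc_right o_apply)
    also have "tder 0 U [:a:] = 0" by (simp add: tder_def pderiv_pCons)
    finally show ?thesis by (simp add: funpow_tder_0)
  qed
  \<comment> \<open>The p-th power is a derivation killing constants, so it is determined by its
    value \<open>w\<close> on x; the induction peels off one factor x.\<close>
  have E0: "(tder 0 U ^^ p) F = w * pderiv F" for F
  proof (induction F)
    case 0
    show ?case by (simp add: funpow_tder_0)
  next
    case (pCons a F)
    have "pCons a F = [:a:] + [:0, 1:] * F" by simp
    then have "(tder 0 U ^^ p) (pCons a F) = (tder 0 U ^^ p) [:a:] + (tder 0 U ^^ p) ([:0, 1:] * F)"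
      by (metis funpow_tder_add)
    also have "(tder 0 U ^^ p) ([:0, 1:] * F) = w * F + [:0, 1:] * (w * pderiv F)"
      using L1[of 0 0 "[:0, 1:]" F] by (simp only: add_0 pCons.IH w_def)
    finally show ?case by (simp add: const pderiv_pCons algebra_simps)
  qed
  \<comment> \<open>Take F = x and G = 1 in the second product: F' G = 1 is killed by the power on
    functions, which leaves 0 = w' + (the value on 1 in weight 1).\<close>
  have E1: "(tder 1 U ^^ p) 1 = - pderiv w"
  proof -
    have "(tder 0 U ^^ p) (pderiv [:0, 1:] * 1) = pderiv w * 1 + pderiv [:0, 1:] * (tder 1 U ^^ p) 1"
      using L2[of "[:0, 1:]" 1] by (simp only: w_def)
    moreover have "pderiv [:0, 1 :: 'a:] = 1" by (simp add: pderiv_pCons)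
    ultimately show ?thesis
      using const[of 1] by (simp add: one_pCons[symmetric] eq_neg_iff_add_eq_0 add.commute)
  qed
  \<comment> \<open>Weights add under multiplication, so each factor in 1 = 1 * 1 of weight one
    contributes another -w'.\<close>
  have Ek: "(tder k U ^^ p) 1 = - of_nat k * pderiv w" for k
  proof (induction k)
    case 0
    show ?case using const[of 1] by (simp add: one_pCons[symmetric])
  next
    case (Suc k)
    have "(tder (k + 1) U ^^ p) (1 * 1) = (tder k U ^^ p) 1 * 1 + 1 * (tder 1 U ^^ p) 1"
      by (rule L1)
    then show ?case using Suc E1 by (simp add: algebra_simps)
  qed
  have "(tder (0 + k) U ^^ p) (F * 1) = (tder 0 U ^^ p) F * 1 + F * (tder k U ^^ p) 1"
    by (rule L1)
  then have "(tder k U ^^ p) F = tder k w F" by (simp add: E0 Ek tder_def algebra_simps)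
  then show ?thesis by (simp only: w_def)
qed

section \<open>Truncated polynomials in one variable\<close>

text \<open>Congruence modulo x^p, which lets identities be proved in the polynomial ring and then
  truncated.\<close>

definition eqp :: "nat \<Rightarrow> 'a::field poly \<Rightarrow> 'a poly \<Rightarrow> bool" where
  "eqp p F G \<longleftrightarrow> (\<forall>b<p. coeff F b = coeff G b)"

lemma eqp_refl [simp]: "eqp p F F"
  and eqp_sym: "eqp p F G \<Longrightarrow> eqp p G F"
  and eqp_trans [trans]: "eqp p F G \<Longrightarrow> eqp p G H \<Longrightarrow> eqp p F H"
  by (simp_all add: eqp_def)

lemma eqp_mult: "eqp p F F' \<Longrightarrow> eqp p G G' \<Longrightarrow> eqp p (F * G) (F' * G')"
  by (auto simp: eqp_def coeff_mult intro!: sum.cong)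

lemma eqp_diff: "eqp p F F' \<Longrightarrow> eqp p G G' \<Longrightarrow> eqp p (F - G) (F' - G')"
  by (auto simp: eqp_def)

text \<open>The coefficient of x^(p-1) in a derivative involves the uncontrolled coefficient of x^p,
  but with factor p = 0; so the ideal generated by x^p is stable under differentiation.\<close>

lemma eqp_pderiv:
  fixes F G :: "'a::field poly"
  assumes "CHAR('a) = p" "eqp p F G"
  shows "eqp p (pderiv F) (pderiv G)"
proof -
  have "of_nat (Suc b) * coeff F (Suc b) = of_nat (Suc b) * coeff G (Suc b)" if "b < p" for b
  proof (cases "Suc b = p")
    case True
    then have "of_nat (Suc b) = (0 :: 'a)" using assms(1) of_nat_CHAR by metis
    then show ?thesis by (simp only: mult_zero_left)
  next
    case False
    then show ?thesis using assms(2) that by (simp add: eqp_def)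
  qed
  then show ?thesis by (simp add: eqp_def coeff_pderiv del: of_nat_Suc)
qed

lemma eqp_tder:
  fixes F G :: "'a::field poly"
  assumes "CHAR('a) = p" "eqp p F G" "eqp p U V"
  shows "eqp p (tder k U F) (tder k V G)"
  unfolding tder_def using assms by (intro eqp_diff eqp_mult eqp_pderiv eqp_refl)

definition toP :: "nat \<Rightarrow> (nat \<Rightarrow> 'a::field) \<Rightarrow> 'a poly" where
  "toP p f = (\<Sum>a<p. monom (f a) a)"

lemma coeff_toP: "coeff (toP p f) a = (if a < p then f a else 0)"
proof -
  have "coeff (toP p f) a = (\<Sum>b<p. if a = b then f a else 0)"
    unfolding toP_def coeff_sum by (rule sum.cong) auto
  then show ?thesis by (simp add: sum.delta)
qed

lemma eqp_toP_iff: "eqp p (toP p f) G \<longleftrightarrow> (\<forall>a<p. f a = coeff G a)"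
  by (simp add: eqp_def coeff_toP)

lemma xpow1_inj: "xpow1 i = xpow1 j \<longleftrightarrow> i = j"
  by (auto simp: xpow1_def fun_eq_iff)

lemma expvecs_1: "0 < p \<Longrightarrow> expvecs p 1 = xpow1 ` {..<p}"
proof
  assume p: "0 < p"
  show "expvecs p 1 \<subseteq> xpow1 ` {..<p}"
  proof
    fix \<alpha> assume "\<alpha> \<in> expvecs p 1"
    then have "\<alpha> 1 < p" and 0: "\<And>i. i = 0 \<or> 1 < i \<Longrightarrow> \<alpha> i = 0" by (auto simp: expvecs_def)
    moreover have "\<alpha> i = 0" if "i \<noteq> 1" for i using 0[of i] that by linarith
    ultimately have "\<alpha> 1 < p" "\<And>i. i \<noteq> 1 \<Longrightarrow> \<alpha> i = 0" by blast+
    then show "\<alpha> \<in> xpow1 ` {..<p}"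
      by (intro image_eqI[of _ _ "\<alpha> 1"]) (auto simp: xpow1_def fun_eq_iff)
  qed
qed (auto simp: expvecs_def xpow1_def)

lemma xpow1_in_expvecs: "0 < p \<Longrightarrow> xpow1 i \<in> expvecs p 1 \<longleftrightarrow> i < p"
  using expvecs_1[of p] by (auto simp: xpow1_inj)

lemma tmult_1:
  assumes p: "0 < p" and c: "c < p"
  shows "tmult p 1 f g (xpow1 c) = (\<Sum>i\<le>c. f (xpow1 i) * g (xpow1 (c - i)))"
proof -
  have inj: "inj_on xpow1 A" for A by (auto simp: inj_on_def xpow1_inj)
  have "tmult p 1 f g (xpow1 c) = (\<Sum>\<alpha>\<in>xpow1 ` {..<p}. \<Sum>\<beta>\<in>xpow1 ` {..<p}.
      if (\<lambda>i. \<alpha> i + \<beta> i) = xpow1 c then f \<alpha> * g \<beta> else 0)"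
    unfolding tmult_def using xpow1_in_expvecs[OF p, of c] c by (simp only: expvecs_1[OF p] if_True)
  also have "\<dots> = (\<Sum>i<p. \<Sum>j<p. if (\<lambda>k. xpow1 i k + xpow1 j k) = xpow1 c then f (xpow1 i) * g (xpow1 j) else 0)"
    by (simp add: sum.reindex[OF inj])
  also have "\<dots> = (\<Sum>i<p. \<Sum>j<p. if j = c - i then (if i \<le> c then f (xpow1 i) * g (xpow1 (c - i)) else 0) else 0)"
    by (intro sum.cong refl) (auto simp: xpow1_def fun_eq_iff)
  also have "\<dots> = (\<Sum>i<p. if i \<le> c then f (xpow1 i) * g (xpow1 (c - i)) else 0)"
    using c by (intro sum.cong refl) (auto simp: sum.delta)
  also have "\<dots> = (\<Sum>i\<in>{..<p} \<inter> {i. i \<le> c}. f (xpow1 i) * g (xpow1 (c - i)))"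
    by (simp add: sum.inter_restrict)
  also have "{..<p} \<inter> {i. i \<le> c} = {..c}" using c by auto
  finally show ?thesis .
qed

lemma pd_1:
  assumes p: "0 < p" and c: "c < p"
  shows "pd p 1 1 f (xpow1 c) = (if Suc c < p then of_nat (Suc c) * f (xpow1 (Suc c)) else 0)"
proof -
  have "(xpow1 c)(1 := Suc (xpow1 c 1)) = xpow1 (Suc c)" and x: "xpow1 c 1 = c"
    by (auto simp: xpow1_def)
  then show ?thesis
    unfolding pd_def using xpow1_in_expvecs[OF p] c x by auto
qed

definition wpoly :: "nat \<Rightarrow> 'a::field W1elem \<Rightarrow> 'a poly" where
  "wpoly p D = toP p (\<lambda>i. D (1, xpow1 i))"

text \<open>In a Cauchy product the coefficients below p never see terms of degree p or more, so
  truncated multiplication agrees with polynomial multiplication modulo x^p.\<close>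

lemma der_apply_1:
  fixes D :: "'a::field W1elem"
  assumes p: "0 < p" "CHAR('a) = p"
  shows "eqp p (toP p (\<lambda>i. der_apply p 1 D f (xpow1 i))) (tder 0 (wpoly p D) (toP p (\<lambda>i. f (xpow1 i))))"
proof -
  have "der_apply p 1 D f (xpow1 c) = coeff (wpoly p D * pderiv (toP p (\<lambda>i. f (xpow1 i)))) c" if c: "c < p" for c
  proof -
    have "of_nat (Suc (c - i)) * coeff (toP p (\<lambda>i. f (xpow1 i))) (Suc (c - i)) = pd p 1 1 f (xpow1 (c - i))" for i
      using c by (simp add: coeff_toP pd_1[OF p(1), unfolded One_nat_def] del: of_nat_Suc)
    then show ?thesis
      using c by (simp add: der_apply_def tmult_1[OF p(1) c, unfolded One_nat_def] dcomp_def coeff_mult wpoly_def coeff_pderiv coeff_toP del: of_nat_Suc)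
  qed
  then show ?thesis by (simp add: eqp_toP_iff tder_def)
qed

lemma wpoly_bracket:
  fixes D E :: "'a::field W1elem"
  assumes p: "0 < p" "CHAR('a) = p"
  shows "eqp p (wpoly p (bracket p 1 D E)) (wpoly p D * pderiv (wpoly p E) - wpoly p E * pderiv (wpoly p D))"
  using der_apply_1[OF p, of D "dcomp E 1"] der_apply_1[OF p, of E "dcomp D 1"]
  by (simp add: wpoly_def[of p "bracket p 1 D E"] wpoly_def[of p "bracket p (Suc 0) D E"] eqp_toP_iff bracket_def) (simp add: dcomp_def wpoly_def tder_def eqp_toP_iff)

text \<open>The p-map is recorded by the value of D^p on x, so D is iterated p times starting from
  x; each iteration respects the congruence.\<close>

lemma wpoly_ppow:
  fixes D :: "'a::field W1elem"
  assumes p: "1 < p" "CHAR('a) = p"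
  shows "eqp p (wpoly p (ppow p D)) ((tder 0 (wpoly p D) ^^ p) [:0, 1:])"
proof -
  have p0: "0 < p" using p by simp
  have "eqp p (toP p (\<lambda>i. (der_apply p 1 D ^^ n) f (xpow1 i))) ((tder 0 (wpoly p D) ^^ n) (toP p (\<lambda>i. f (xpow1 i))))" for n f
  proof (induction n)
    case (Suc n)
    have "eqp p (toP p (\<lambda>i. (der_apply p 1 D ^^ Suc n) f (xpow1 i)))
        (tder 0 (wpoly p D) (toP p (\<lambda>i. (der_apply p 1 D ^^ n) f (xpow1 i))))"
      using der_apply_1[OF p0 p(2), of D "(der_apply p 1 D ^^ n) f"] by simp
    also have "eqp p \<dots> (tder 0 (wpoly p D) ((tder 0 (wpoly p D) ^^ n) (toP p (\<lambda>i. f (xpow1 i)))))"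
      by (rule eqp_tder[OF p(2) Suc.IH eqp_refl])
    finally show ?case by simp
  qed simp
  note 1 = this[of p "xmon (xpow1 1)"]
  have "toP p (\<lambda>i. xmon (xpow1 1) (xpow1 i)) = [:0, 1 :: 'a:]"
    using p(1) by (auto simp: poly_eq_iff coeff_toP xmon_def xpow1_inj coeff_pCons split: nat.splits)
  moreover have "wpoly p (ppow p D) = toP p (\<lambda>i. (der_apply p 1 D ^^ p) (xmon (xpow1 1)) (xpow1 i))"
    by (simp add: wpoly_def ppow_def)
  ultimately show ?thesis using 1 by simp
qed

lemma ppow_in_W1: "0 < p \<Longrightarrow> ppow p D \<in> W1 p"
proof -
  assume p: "0 < p"
  then obtain n where n: "p = Suc n" using gr0_implies_Suc by blast
  have "(der_apply p 1 D ^^ Suc n) f \<alpha> = 0" if "\<alpha> \<notin> expvecs p 1" for f \<alpha>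
    using that by (simp add: der_apply_def tmult_def)
  then show ?thesis by (auto simp: Der_def ppow_def n[symmetric])
qed

section \<open>The modules of tensor densities\<close>

text \<open>\<open>dens_act p k\<close> is the action \<open>u\<partial> \<cdot> f = u f' - k u' f\<close> on truncated polynomials in one
  variable, that is, the action of \<open>\<Theta>\<^sub>H\<close> on \<open>f(x\<^sub>1) x\<^sub>r\<^sub>+\<^sub>1\<^sup>k\<close>.\<close>

definition dens :: "nat \<Rightarrow> (nat \<Rightarrow> 'a::field) set" where
  "dens p = {f. \<forall>a\<ge>p. f a = 0}"

definition dens_act :: "nat \<Rightarrow> nat \<Rightarrow> 'a::field W1elem \<Rightarrow> (nat \<Rightarrow> 'a) \<Rightarrow> nat \<Rightarrow> 'a" where
  "dens_act p k D f = (\<lambda>b. if b < p then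
     (\<Sum>i\<le>Suc b. D (1, xpow1 i) * (of_nat (Suc b - i) - of_nat i * of_nat k) * f (Suc b - i)) else 0)"

lemma dens_subspace: "module.subspace fscale (dens p)"
  by (intro fscale.subspaceI) (auto simp: dens_def)

lemma dens_act_in [simp]: "dens_act p k D f \<in> dens p"
  by (simp add: dens_def dens_act_def)

lemma dens_act_add: "dens_act p k D (f + g) = dens_act p k D f + dens_act p k D g"
  by (auto simp: dens_act_def fun_eq_iff distrib_left sum.distrib)

lemma dens_act_scale: "dens_act p k D (fscale c f) = fscale c (dens_act p k D f)"
  by (auto simp: dens_act_def fun_eq_iff sum_distrib_left mult_ac simp del: sum.atMost_Suc)

lemma dens_act_addl: "dens_act p k (D + E) f = dens_act p k D f + dens_act p k E f"
  by (auto simp: dens_act_def fun_eq_iff distrib_right sum.distrib)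

lemma dens_act_scalel: "dens_act p k (fscale c D) f = fscale c (dens_act p k D f)"
  by (auto simp: dens_act_def fun_eq_iff sum_distrib_left mult_ac simp del: sum.atMost_Suc)

lemma W1_coeff_0: "0 < p \<Longrightarrow> D \<in> W1 p \<Longrightarrow> p \<le> i \<Longrightarrow> D (1, xpow1 i) = 0"
  using xpow1_in_expvecs[of p i] by (simp add: Der_def)

lemma toP_dens_act:
  fixes D :: "'a::field W1elem"
  assumes p: "0 < p" and D: "D \<in> W1 p" and f: "f \<in> dens p"
  shows "eqp p (toP p (dens_act p k D f)) (tder k (wpoly p D) (toP p f))"
proof -
  have D': "coeff (wpoly p D) i = D (1, xpow1 i)" for i
    using W1_coeff_0[OF p D, of i] by (simp add: wpoly_def coeff_toP)
  have f': "coeff (toP p f) a = f a" for a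
    using f by (simp add: coeff_toP dens_def)
  have "dens_act p k D f b = coeff (tder k (wpoly p D) (toP p f)) b" if b: "b < p" for b
  proof -
    define u where "u i = D (1, xpow1 i)" for i
    have "coeff (wpoly p D * pderiv (toP p f)) b = (\<Sum>i\<le>b. u i * (of_nat (Suc b - i) * f (Suc b - i)))"
      by (auto simp: coeff_mult coeff_pderiv D' f' u_def Suc_diff_le simp del: of_nat_Suc intro!: sum.cong)
    \<comment> \<open>The added term i = b+1 carries the factor 0.\<close>
    also have "\<dots> = (\<Sum>i\<le>Suc b. u i * (of_nat (Suc b - i) * f (Suc b - i)))"
      by simp
    finally have 1: "coeff (wpoly p D * pderiv (toP p f)) b = \<dots>" .
    have "coeff (pderiv (wpoly p D) * toP p f) b = (\<Sum>i\<le>b. of_nat (Suc i) * u (Suc i) * f (Suc b - Suc i))"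
      by (simp add: coeff_mult coeff_pderiv D' f' u_def del: of_nat_Suc)
    \<comment> \<open>Index shift; the new term i = 0 carries the factor 0.\<close>
    also have "\<dots> = (\<Sum>i\<le>Suc b. of_nat i * u i * f (Suc b - i))"
      by (simp add: sum.atMost_Suc_shift del: sum.atMost_Suc of_nat_Suc)
    finally have 2: "coeff (pderiv (wpoly p D) * toP p f) b = \<dots>" .
    have "coeff (of_nat k * pderiv (wpoly p D) * toP p f) b = of_nat k * coeff (pderiv (wpoly p D) * toP p f) b"
      by (simp add: of_nat_poly mult.assoc)
    then have "coeff (tder k (wpoly p D) (toP p f)) b =
       (\<Sum>i\<le>Suc b. u i * (of_nat (Suc b - i) * f (Suc b - i))) - of_nat k * (\<Sum>i\<le>Suc b. of_nat i * u i * f (Suc b - i))"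
      unfolding tder_def by (simp only: coeff_diff 1 2)
    also have "\<dots> = (\<Sum>i\<le>Suc b. u i * (of_nat (Suc b - i) - of_nat i * of_nat k) * f (Suc b - i))"
      by (simp add: sum_distrib_left sum_subtractf[symmetric] algebra_simps del: sum.atMost_Suc)
    finally show ?thesis using b by (simp add: dens_act_def u_def)
  qed
  then show ?thesis by (simp add: eqp_toP_iff)
qed

lemma dens_eqI: "f \<in> dens p \<Longrightarrow> g \<in> dens p \<Longrightarrow> eqp p (toP p f) (toP p g) \<Longrightarrow> f = g"
  by (auto simp: dens_def eqp_toP_iff coeff_toP fun_eq_iff) (metis not_le)

text \<open>The commutator rule holds exactly for \<open>tder\<close> on all polynomials and
  descends modulo x^p.\<close>

lemma dens_W1mod:
  assumes p: "0 < p" "CHAR('a::field) = p"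
  shows "is_W1mod p (dens p :: (nat \<Rightarrow> 'a) set) (dens_act p k)"
proof -
  have "dens_act p k (bracket p 1 D E) v = dens_act p k D (dens_act p k E v) - dens_act p k E (dens_act p k D v)"
    if D: "D \<in> W1 p" and E: "E \<in> W1 p" and v: "v \<in> dens p" for D E :: "'a W1elem" and v
  proof (rule dens_eqI)
    let ?U = "wpoly p D" and ?V = "wpoly p E" and ?F = "toP p v"
    show "dens_act p k D (dens_act p k E v) - dens_act p k E (dens_act p k D v) \<in> dens p"
      by (simp add: fscale.subspace_diff[OF dens_subspace])
    have "eqp p (toP p (dens_act p k (bracket p 1 D E) v)) (tder k (wpoly p (bracket p 1 D E)) ?F)"
      using toP_dens_act[OF p(1) _ v] D E by simp
    also have "eqp p \<dots> (tder k (?U * pderiv ?V - ?V * pderiv ?U) ?F)"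
      by (rule eqp_tder[OF p(2) eqp_refl wpoly_bracket[OF p]])
    also have "\<dots> = tder k ?U (tder k ?V ?F) - tder k ?V (tder k ?U ?F)" by (rule tder_commutator)
    finally have 1: "eqp p (toP p (dens_act p k (bracket p 1 D E) v)) (tder k ?U (tder k ?V ?F) - tder k ?V (tder k ?U ?F))" .
    have 2: "eqp p (toP p (dens_act p k D' (dens_act p k E' v))) (tder k (wpoly p D') (tder k (wpoly p E') ?F))"
      if "D' \<in> W1 p" "E' \<in> W1 p" for D' E'
      using eqp_trans[OF toP_dens_act[OF p(1) that(1)] eqp_tder[OF p(2) toP_dens_act[OF p(1) that(2) v] eqp_refl]] by simp
    show "eqp p (toP p (dens_act p k (bracket p 1 D E) v)) (toP p (dens_act p k D (dens_act p k E v) - dens_act p k E (dens_act p k D v)))"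
      using 1 2[OF D E] 2[OF E D] by (simp add: eqp_def coeff_toP)
  qed simp
  then show ?thesis
    unfolding is_W1mod_def
    by (simp add: dens_subspace dens_act_add dens_act_addl dens_act_scale dens_act_scalel)
qed

text \<open>Since \<open>ppow\<close> is not additive, the check on x^i d would not suffice; the
  condition follows for all D at once from the p-th power formula for \<open>tder\<close>.\<close>

lemma dens_restricted:
  assumes p: "prime p" "CHAR('a::field) = p"
  shows "is_restricted p (dens p :: (nat \<Rightarrow> 'a) set) (dens_act p k)"
  unfolding is_restricted_def
proof (intro conjI ballI)
  have p1: "0 < p" "1 < p" using prime_gt_1_nat[OF p(1)] by auto
  show "is_W1mod p (dens p :: (nat \<Rightarrow> 'a) set) (dens_act p k)" using dens_W1mod[OF p1(1) p(2)] .
  fix D :: "'a W1elem" and v :: "nat \<Rightarrow> 'a" assume D: "D \<in> W1 p" and v: "v \<in> dens p"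
  have in_dens: "(dens_act p k D ^^ n) v \<in> dens p" for n
    by (induction n) (simp_all add: v)
  have pow: "eqp p (toP p ((dens_act p k D ^^ n) v)) ((tder k (wpoly p D) ^^ n) (toP p v))" for n
  proof (induction n)
    case (Suc n)
    show ?case
      using eqp_trans[OF toP_dens_act[OF p1(1) D in_dens[of n]] eqp_tder[OF p(2) Suc.IH eqp_refl]] by simp
  qed simp
  have "eqp p (toP p (dens_act p k (ppow p D) v)) (tder k (wpoly p (ppow p D)) (toP p v))"
    by (rule toP_dens_act[OF p1(1) ppow_in_W1[OF p1(1)] v])
  also have "eqp p \<dots> (tder k ((tder 0 (wpoly p D) ^^ p) [:0, 1:]) (toP p v))"
    by (rule eqp_tder[OF p(2) eqp_refl wpoly_ppow[OF p1(2) p(2)]])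
  also have "\<dots> = (tder k (wpoly p D) ^^ p) (toP p v)"
    by (rule funpow_tder_char[OF p, symmetric])
  finally show "dens_act p k (ppow p D) v = (dens_act p k D ^^ p) v"
    using dens_eqI[OF dens_act_in in_dens] eqp_trans eqp_sym[OF pow] by blast
qed

section \<open>Induced modules and their simple quotients\<close>

definition delta :: "nat \<Rightarrow> nat \<Rightarrow> 'a::field" where
  "delta a = (\<lambda>b. if b = a then 1 else 0)"

lemma delta_in_dens: "a < p \<Longrightarrow> delta a \<in> dens p"
  by (auto simp: delta_def dens_def)

lemma delta_nonzero: "delta a \<noteq> 0"
  by (auto simp: delta_def fun_eq_iff)

lemma sum_delta: "(\<Sum>a<n. fscale (f a) (delta a)) = (\<lambda>b. if b < n then f b else 0)"
proof
  fix b
  have "(\<Sum>a<n. fscale (f a) (delta a)) b = (\<Sum>a<n. fscale (f a) (delta a) b)"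
    by (induction n) auto
  also have "\<dots> = (\<Sum>a<n. if b = a then f a else 0)"
    by (intro sum.cong) (auto simp: delta_def)
  finally show "(\<Sum>a<n. fscale (f a) (delta a)) b = (if b < n then f b else 0)"
    by (simp add: sum.delta)
qed

lemma subspace_delta:
  assumes S: "module.subspace fscale S" and "\<And>a. a < n \<Longrightarrow> delta a \<in> S" and f: "\<And>a. n \<le> a \<Longrightarrow> f a = 0"
  shows "f \<in> S"
proof -
  have "f = (\<Sum>a<n. fscale (f a) (delta a))"
    using f by (auto simp: sum_delta fun_eq_iff not_less)
  also have "\<dots> \<in> S"
    using assms by (intro fscale.subspace_sum[OF S] fscale.subspace_scale[OF S]) auto
  finally show ?thesis .
qed

lemma subspace_unscale:
  assumes "module.subspace fscale S" "fscale c v \<in> S" "c \<noteq> 0"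
  shows "v \<in> S"
  using fscale.subspace_scale[OF assms(1,2), of "inverse c"] assms(3) by simp

lemma W1_eqI:
  assumes "0 < p" "D \<in> W1 p" "E \<in> W1 p" "\<And>c. c < p \<Longrightarrow> D (1, xpow1 c) = E (1, xpow1 c)"
  shows "D = E"
proof
  fix x :: "nat \<times> mono"
  obtain j \<alpha> where x: "x = (j, \<alpha>)" by (cases x)
  show "D x = E x"
  proof (cases "j = 1 \<and> \<alpha> \<in> expvecs p 1")
    case True
    then show ?thesis using assms(4) expvecs_1[OF assms(1)] x by auto
  next
    case False
    then have "j \<notin> {1..1} \<or> \<alpha> \<notin> expvecs p 1" by auto
    then have "D (j, \<alpha>) = 0" "E (j, \<alpha>) = 0" using assms(2,3) unfolding Der_def by blast+
    then show ?thesis by (simp add: x)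
  qed
qed

lemma ew_apply: "ew i (1, xpow1 j) = (if i = j then 1 else 0)"
  by (auto simp: ew_def xpow1_inj)

lemma ew_in_W1: "i < p \<Longrightarrow> ew i \<in> W1 p"
  using xpow1_in_expvecs[of p i] by (auto simp: Der_def ew_def)

lemma zero_in_Der [simp]: "0 \<in> Der p n"
  by (simp add: Der_def)

lemma W1_expand:
  assumes p: "0 < p" and D: "D \<in> W1 p"
  shows "D = (\<Sum>i<p. fscale (D (1, xpow1 i)) (ew i))"
proof (rule W1_eqI[OF p D])
  have "(\<Sum>i<n. fscale (D (1, xpow1 i)) (ew i)) \<in> W1 p" if "n \<le> p" for n
    using that by (induction n) (auto simp: ew_in_W1[unfolded One_nat_def])
  then show "(\<Sum>i<p. fscale (D (1, xpow1 i)) (ew i)) \<in> W1 p" by blast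
  fix c assume c: "c < p"
  have "(\<Sum>i<n. fscale (D (1, xpow1 i)) (ew i)) (1, xpow1 c) = (\<Sum>i<n. if c = i then D (1, xpow1 i) else 0)" for n
    by (induction n) (auto simp: ew_apply[unfolded One_nat_def])
  then show "D (1, xpow1 c) = (\<Sum>i<p. fscale (D (1, xpow1 i)) (ew i)) (1, xpow1 c)"
    using c by (simp add: sum.delta)
qed

lemma W1mod_zerol:
  assumes "is_W1mod p M act" "v \<in> M"
  shows "act 0 v = 0"
  using W1mod_scalel[OF assms(1) _ assms(2), of 0 0] by simp

lemma W1mod_expand:
  assumes p: "0 < p" and M: "is_W1mod p M act" and D: "D \<in> W1 p" and v: "v \<in> M"
  shows "act D v = (\<Sum>i<p. fscale (D (1, xpow1 i)) (act (ew i) v))"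
proof -
  have "(\<Sum>i<n. fscale (D (1, xpow1 i)) (ew i)) \<in> W1 p \<and>
    act (\<Sum>i<n. fscale (D (1, xpow1 i)) (ew i)) v = (\<Sum>i<n. fscale (D (1, xpow1 i)) (act (ew i) v))"
    if "n \<le> p" for n
    using that
  proof (induction n)
    case 0
    show ?case using W1mod_zerol[OF M v] by (simp only: lessThan_0 sum.empty zero_in_Der simp_thms)
  next
    case (Suc n)
    have n: "n < p" "n \<le> p" using Suc.prems by auto
    note IH = conjunct1[OF Suc.IH[OF n(2)]] conjunct2[OF Suc.IH[OF n(2)]]
    have e: "fscale (D (1, xpow1 n)) (ew n) \<in> W1 p"
      "act (fscale (D (1, xpow1 n)) (ew n)) v = fscale (D (1, xpow1 n)) (act (ew n) v)"
      using ew_in_W1[OF n(1)] W1mod_scalel[OF M _ v] by (blast intro: fscale_in_Der)+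
    show ?case
      using W1mod_addl[OF M IH(1) e(1) v] add_in_Der[OF IH(1) e(1)] by (simp only: sum.lessThan_Suc IH(2) e(2) simp_thms)
  qed
  note conjunct2[OF this[OF order_refl]]
  with fun_cong[OF arg_cong[OF W1_expand[OF p D], of act], of v] show ?thesis by (rule trans)
qed

lemma dens_act_ew:
  "dens_act p k (ew i) f b = (if b < p \<and> i \<le> Suc b then (of_nat (Suc b - i) - of_nat i * of_nat k) * f (Suc b - i) else 0)"
proof -
  have "(\<Sum>j\<le>Suc b. ew i (1, xpow1 j) * (of_nat (Suc b - j) - of_nat j * of_nat k) * f (Suc b - j)) =
    (\<Sum>j\<le>Suc b. if i = j then (of_nat (Suc b - i) - of_nat i * of_nat k) * f (Suc b - i) else 0)"
    by (intro sum.cong) (auto simp: ew_apply[unfolded One_nat_def])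
  also have "\<dots> = (if i \<in> {..Suc b} then (of_nat (Suc b - i) - of_nat i * of_nat k) * f (Suc b - i) else 0)"
    by (rule sum.delta') simp
  finally show ?thesis by (simp add: dens_act_def del: sum.atMost_Suc)
qed

text \<open>The guard \<open>1 \<le> a + i\<close> excludes only d applied to 1, where the exponent
  would be a truncated subtraction; \<open>a + i \<le> p\<close> is the truncation in degree
  p.\<close>

lemma dens_act_ew_delta:
  assumes "a < p"
  shows "dens_act p k (ew i) (delta a) =
    (if 1 \<le> a + i \<and> a + i \<le> p then fscale (of_nat a - of_nat i * of_nat k) (delta (a + i - 1)) else 0)"
  using assms by (auto simp: fun_eq_iff dens_act_ew delta_def)

text \<open>Both actions are linear in the derivation and in the vector, so it suffices that the
  \<open>z a\<close> transform like the monomials x^a under the basis x^i d.\<close>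

lemma dens_hom:
  fixes N :: "('y \<Rightarrow> 'a::field) set"
  assumes p: "0 < p" "CHAR('a) = p" and N: "is_W1mod p N act'" and z: "\<And>a. a < p \<Longrightarrow> z a \<in> N"
    and eq: "\<And>i a. i < p \<Longrightarrow> a < p \<Longrightarrow> act' (ew i) (z a) =
      (if 1 \<le> a + i \<and> a + i \<le> p then fscale (of_nat a - of_nat i * of_nat k) (z (a + i - 1)) else 0)"
  shows "is_hom p (dens p) (dens_act p k) N act' (\<lambda>f. \<Sum>a<p. fscale (f a) (z a))"
proof -
  define F where "F = (\<lambda>f. \<Sum>a<p. fscale (f a) (z a))"
  note N0 = W1mod_subspace[OF N]
  have Fin: "F f \<in> N" for f
    unfolding F_def using z by (intro fscale.subspace_sum[OF N0] fscale.subspace_scale[OF N0]) auto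
  have Fadd: "F (f + g) = F f + F g" for f g
    by (simp add: F_def fscale.scale_left_distrib sum.distrib)
  have Fscale: "F (fscale c f) = fscale c (F f)" for c f
    by (simp add: F_def fscale.scale_sum_right)
  have Fdelta: "F (delta a) = z a" if "a < p" for a
  proof -
    have "F (delta a) = (\<Sum>b<p. if a = b then z b else 0)"
      unfolding F_def by (intro sum.cong) (auto simp: delta_def)
    then show ?thesis using that by (simp add: sum.delta)
  qed
  have F0: "F 0 = 0" by (simp add: F_def)
  have ew: "F (dens_act p k (ew i) f) = act' (ew i) (F f)" if i: "i < p" and f: "f \<in> dens p" for i f
  proof -
    let ?S = "{f. F (dens_act p k (ew i) f) = act' (ew i) (F f)}"
    note e = ew_in_W1[OF i]
    have "dens_act p k (ew i) 0 = (0 :: nat \<Rightarrow> 'a)"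
      by (auto simp: fun_eq_iff dens_act_ew)
    then have "F (dens_act p k (ew i) 0) = 0" by (simp only: F0)
    moreover have "act' (ew i) (F 0) = 0" using W1mod_zero[OF N e] by (simp only: F0)
    ultimately have "0 \<in> ?S" by simp
    then have sub: "module.subspace fscale ?S"
      by (intro fscale.subspaceI)
        (auto simp: Fadd Fscale dens_act_add dens_act_scale W1mod_add[OF N e Fin Fin] W1mod_scale[OF N e Fin]
          simp del: plus_fun_apply fscale_apply)
    have "delta a \<in> ?S" if a: "a < p" for a
    proof -
      have "a + i - 1 < p" if "1 \<le> a + i" "a + i \<le> p" using that a by linarith
      then show ?thesis
        using Fdelta eq[OF i a] a Fscale F0 by (simp add: dens_act_ew_delta del: fscale_apply)
    qed
    then have "f \<in> ?S"
      by (rule subspace_delta[OF sub, of p]) (use f in \<open>simp_all add: dens_def\<close>)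
    then show ?thesis by simp
  qed
  have Fsum: "F (sum h A) = (\<Sum>j\<in>A. F (h j))" if "finite A" for h and A :: "nat set"
    using that
  proof (induction A rule: finite_induct)
    case (insert x A)
    then show ?case using Fadd[of "h x" "sum h A"] by (simp only: sum.insert simp_thms)
  qed (simp only: sum.empty F0)
  have "F (dens_act p k D f) = act' D (F f)" if D: "D \<in> W1 p" and f: "f \<in> dens p" for D f
  proof -
    have "F (dens_act p k D f) = (\<Sum>i<p. F (fscale (D (1, xpow1 i)) (dens_act p k (ew i) f)))"
      unfolding W1mod_expand[OF p(1) dens_W1mod[OF p] D f] by (rule Fsum) simp
    also have "\<dots> = (\<Sum>i<p. fscale (D (1, xpow1 i)) (act' (ew i) (F f)))"
      by (intro sum.cong refl) (metis Fscale ew f lessThan_iff)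
    also have "\<dots> = act' D (F f)" by (rule W1mod_expand[OF p(1) N D Fin, symmetric])
    finally show ?thesis .
  qed
  then show ?thesis unfolding is_hom_def F_def[symmetric] using Fin Fadd Fscale by blast
qed

lemma induced_universal:
  fixes N :: "(nat \<Rightarrow> 'a::field) set"
  assumes M: "is_induced p lam M act v" and N: "is_restricted p N act'" "w \<in> N" "is_wt p lam act' w"
  shows "\<exists>f. is_hom p M act N act' f \<and> f v = w"
    and "is_hom p M act N act' f \<Longrightarrow> f v = w \<Longrightarrow> is_hom p M act N act' g \<Longrightarrow> g v = w \<Longrightarrow> u \<in> M \<Longrightarrow> f u = g u"
proof -
  have "is_restricted p N act' \<and> w \<in> N \<and> is_wt p lam act' w \<longrightarrow>
      (\<exists>f. is_hom p M act N act' f \<and> f v = w) \<and>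
      (\<forall>f g. is_hom p M act N act' f \<and> f v = w \<and> is_hom p M act N act' g \<and> g v = w \<longrightarrow> (\<forall>u\<in>M. f u = g u))"
    using M unfolding is_induced_def
    by (elim conjE, drule_tac x = N in spec, drule_tac x = act' in spec, drule_tac x = w in spec) assumption
  then have 1: "\<exists>f. is_hom p M act N act' f \<and> f v = w" and
    2: "\<forall>f g. is_hom p M act N act' f \<and> f v = w \<and> is_hom p M act N act' g \<and> g v = w \<longrightarrow> (\<forall>u\<in>M. f u = g u)"
    using N by blast+
  show "\<exists>f. is_hom p M act N act' f \<and> f v = w" by (rule 1)
  show "f u = g u" if "is_hom p M act N act' f" "f v = w" "is_hom p M act N act' g" "g v = w" "u \<in> M"
    using 2 that by blast
qed

lemma inducedD:
  assumes "is_induced p lam M act v"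
  shows "is_restricted p M act" "v \<in> M" "is_wt p lam act v"
  using assms by (simp_all add: is_induced_def)

section \<open>The density modules as induced modules\<close>

context
  fixes p :: nat
  assumes prime: "prime p" and p2: "2 < p" and char: "CHAR('a::field) = p"
begin

lemma p_pos: "0 < p"
  using p2 by simp

lemma of_nat_p: "of_nat p = (0 :: 'a)"
  using char of_nat_CHAR by metis

lemma of_nat_eq_0: "of_nat n = (0 :: 'a) \<longleftrightarrow> p dvd n"
  using char by (simp add: of_nat_eq_0_iff_char_dvd)

lemma of_nat_inj: "a < p \<Longrightarrow> b < p \<Longrightarrow> of_nat a = (of_nat b :: 'a) \<longleftrightarrow> a = b"
proof -
  have "\<not> a < b" if "of_nat a = (of_nat b :: 'a)" "b < p" for a b
  proof
    assume "a < b"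
    then have "of_nat (b - a) = (0 :: 'a)" using that by (simp add: of_nat_diff)
    then have "p dvd b - a" by (simp add: of_nat_eq_0)
    then show False using \<open>a < b\<close> that(2) by (auto dest: dvd_imp_le)
  qed
  then show "a < p \<Longrightarrow> b < p \<Longrightarrow> of_nat a = (of_nat b :: 'a) \<longleftrightarrow> a = b"
    by (metis linorder_neqE_nat)
qed

lemma of_nat_nonzero: "0 < n \<Longrightarrow> n < p \<Longrightarrow> of_nat n \<noteq> (0 :: 'a)"
  using of_nat_inj[of n 0] by simp

lemma of_nat_p_minus: "i \<le> p \<Longrightarrow> of_nat (p - i) = (- of_nat i :: 'a)"
  by (simp add: of_nat_diff of_nat_p)

lemma two_nonzero: "(2 :: 'a) \<noteq> 0"
  using of_nat_inj[of 2 0] p2 by simp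

lemma delta_top: "delta (p - 1) \<in> (dens p :: (nat \<Rightarrow> 'a) set)"
  using p_pos by (intro delta_in_dens) simp

lemma dens_mod: "is_W1mod p (dens p :: (nat \<Rightarrow> 'a) set) (dens_act p k)"
  using dens_W1mod[OF p_pos char] .

lemma bracket_ew_0:
  assumes "1 \<le> i" "i < p"
  shows "bracket p 1 (ew i) (ew 0) = fscale (- of_nat i) (ew (i - 1) :: 'a W1elem)"
proof (rule W1_eqI[OF p_pos])
  have w: "wpoly p (ew j :: 'a W1elem) = monom 1 j" if "j < p" for j
    using that by (auto simp: poly_eq_iff wpoly_def coeff_toP ew_apply[unfolded One_nat_def])
  show "bracket p 1 (ew i) (ew 0 :: 'a W1elem) \<in> W1 p"
    using assms p_pos by (intro bracket_in_Der ew_in_W1) auto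
  show "fscale (- of_nat i) (ew (i - 1) :: 'a W1elem) \<in> W1 p"
    using assms by (intro fscale_in_Der ew_in_W1) auto
  fix c assume c: "c < p"
  have "coeff (wpoly p (bracket p 1 (ew i) (ew 0 :: 'a W1elem))) c
      = coeff (monom 1 i * pderiv (monom 1 0) - monom 1 0 * pderiv (monom 1 i)) c"
    using wpoly_bracket[OF p_pos char, of "ew i" "ew 0"] c w[OF assms(2)] w[OF p_pos] by (simp add: eqp_def)
  also have "\<dots> = - coeff (monom (of_nat i) (i - 1)) c"
    by (simp add: pderiv_monom)
  also have "\<dots> = fscale (- of_nat i) (ew (i - 1)) (1, xpow1 c)"
    by (simp add: ew_apply[unfolded One_nat_def])
  finally show "bracket p 1 (ew i) (ew 0 :: 'a W1elem) (1, xpow1 c) = fscale (- of_nat i) (ew (i - 1)) (1, xpow1 c)"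
    using c by (simp add: wpoly_def coeff_toP)
qed

lemma ppow_ew_0: "ppow p (ew 0 :: 'a W1elem) = 0"
proof (rule W1_eqI[OF p_pos ppow_in_W1[OF p_pos] zero_in_Der])
  fix c assume c: "c < p"
  have w: "wpoly p (ew 0 :: 'a W1elem) = 1"
    using p_pos by (auto simp: poly_eq_iff wpoly_def coeff_toP ew_apply[unfolded One_nat_def])
  obtain n where n: "p = Suc (Suc n)" using p2 by (metis Suc_lessD less_imp_Suc_add numeral_2_eq_2 add_Suc)
  have "tder 0 1 (tder 0 1 [:0, 1 :: 'a:]) = 0" by (simp add: tder_def pderiv_pCons)
  then have "(tder 0 1 ^^ p) [:0, 1 :: 'a:] = 0"
    unfolding n by (simp only: funpow_Suc_right o_apply funpow_tder_0)
  then have "eqp p (wpoly p (ppow p (ew 0 :: 'a W1elem))) 0"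
    using wpoly_ppow[of p "ew 0 :: 'a W1elem"] char p2 w by simp
  then show "ppow p (ew 0) (1, xpow1 c) = (0 :: 'a W1elem) (1, xpow1 c)"
    using c by (simp add: eqp_def wpoly_def coeff_toP)
qed

text \<open>Existence half of the universal property. The vectors in \<open>N\<close> that must be
  the images of the monomials are written down, and their transformation law is proved by descending
  induction from x^(p-1).\<close>

lemma restricted_hom:
  fixes N :: "('y \<Rightarrow> 'a) set"
  assumes N: "is_restricted p N act'" and w: "w \<in> N" "is_wt p (p - 1 - k) act' w" and k: "k < p"
  shows "\<exists>f. is_hom p (dens p) (dens_act p k) N act' f \<and> f (delta (p - 1)) = w"
proof -
  have M: "is_W1mod p N act'" using N by (simp add: is_restricted_def)
  note N0 = W1mod_subspace[OF M]
  have e0: "ew 0 \<in> W1 p" using ew_in_W1 p_pos by blast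
  \<comment> \<open>Forced: d sends x^a to a x^(a-1), so x^a is a!/(p-1)! times d^(p-1-a) applied to
    x^(p-1), and (p-1)! is invertible modulo p.\<close>
  define z where "z a = fscale (of_nat (fact a) / of_nat (fact (p - 1))) ((act' (ew 0) ^^ (p - 1 - a)) w)" for a
  have pow: "(act' (ew 0) ^^ n) w \<in> N" for n
    by (induction n) (auto simp: w(1) W1mod_closed[OF M e0])
  have zN: "z a \<in> N" for a using pow fscale.subspace_scale[OF N0] by (simp add: z_def)
  have "\<not> p dvd fact (p - 1)"
    using prime p_pos by (simp add: prime_dvd_fact_iff)
  then have C: "of_nat (fact (p - 1)) \<noteq> (0 :: 'a)" by (simp add: of_nat_eq_0)
  have ztop: "z (p - 1) = w" using C by (simp add: z_def)
  \<comment> \<open>Restrictedness of \<open>N\<close> is used here: d^[p] = 0, hence d^p kills w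
    and d kills \<open>z 0\<close>, as it kills the constant 1.\<close>
  have "act' (ppow p (ew 0)) w = (act' (ew 0) ^^ p) w"
    using N w(1) e0 unfolding is_restricted_def by blast
  then have "(act' (ew 0) ^^ p) w = 0"
    using W1mod_zerol[OF M w(1)] by (simp only: ppow_ew_0)
  moreover have "act' (ew 0) ((act' (ew 0) ^^ (p - 1)) w) = (act' (ew 0) ^^ p) w"
    using p_pos by (cases p) auto
  ultimately have z0: "act' (ew 0) (z 0) = 0"
    by (simp add: z_def W1mod_scale[OF M e0 pow])
  have low: "act' (ew 0) (z (Suc a)) = fscale (of_nat (Suc a)) (z a)" if "Suc a < p" for a
  proof -
    have "p - 1 - a = Suc (p - 1 - Suc a)" using that by simp
    then show ?thesis
      unfolding z_def by (simp add: W1mod_scale[OF M e0 pow] algebra_simps)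
  qed
  let ?R = "\<lambda>i a. if 1 \<le> a + i \<and> a + i \<le> p then fscale (of_nat a - of_nat i * of_nat k) (z (a + i - 1)) else 0"
  \<comment> \<open>At the top, \<open>i = 0\<close> is the definition of \<open>z\<close>, while
    \<open>i \<ge> 1\<close> is the weight condition on w.\<close>
  have "\<forall>i<p. act' (ew i) (z a) = ?R i a" if "a \<le> p - 1" for a
    using that
  proof (induction rule: inc_induct)
    case base
    show ?case
    proof (intro allI impI)
      fix i assume "i < p"
      consider "i = 0" | "i = 1" | "2 \<le> i" by linarith
      then show "act' (ew i) (z (p - 1)) = ?R i (p - 1)"
      proof cases
        case 1
        then show ?thesis using low[of "p - 2"] p2 by (simp add: numeral_2_eq_2 Suc_diff_Suc)
      next
        case 2
        then show ?thesis using w(2) ztop p2 k by (simp add: is_wt_def of_nat_diff)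
      next
        case 3
        then have "\<not> p - 1 + i \<le> p" "act' (ew i) w = 0"
          using p2 w(2) \<open>i < p\<close> by (auto simp: is_wt_def)
        then show ?thesis by (simp only: ztop simp_thms if_False)
      qed
    qed
  next
    case (step a)
    show ?case
    proof (intro allI impI)
      fix i assume i: "i < p"
      show "act' (ew i) (z a) = ?R i a"
      proof (cases "i = 0")
        case True
        then show ?thesis using z0 low[of "a - 1"] step.hyps by (cases a) auto
      next
        case False
        let ?A = "of_nat (Suc a) :: 'a" and ?i = "of_nat i :: 'a" and ?k = "of_nat k :: 'a"
        note e = ew_in_W1[OF i]
        have A: "?A \<noteq> 0" using of_nat_inj[of "Suc a" 0] step.hyps p_pos by (metis Suc_neq_Zero Suc_less_eq Suc_pred' of_nat_0)
        have sa: "Suc a < p" using step.hyps by linarith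
        have i1: "1 \<le> i" and i1': "i - 1 < p" using False i by auto
        \<comment> \<open>Since (a+1) \<open>z a\<close> is d applied to \<open>z (Suc a)\<close>,
          moving x^i d past d by [x^i d, d] = -i x^(i-1) d reduces the claim for a to the claim for
          a+1; the factor a+1 is cancelled at the end.\<close>
        have "fscale ?A (act' (ew i) (z a)) = act' (ew i) (act' (ew 0) (z (Suc a)))"
          using low[OF sa] W1mod_scale[OF M e zN] by simp
        also have "\<dots> = act' (ew 0) (act' (ew i) (z (Suc a))) + act' (bracket p 1 (ew i) (ew 0)) (z (Suc a))"
          using W1mod_bracket[OF M e e0 zN] by simp
        also have "act' (bracket p 1 (ew i) (ew 0)) (z (Suc a)) = fscale (- ?i) (act' (ew (i - 1)) (z (Suc a)))"
          unfolding bracket_ew_0[OF i1 i] by (rule W1mod_scalel[OF M ew_in_W1[OF i1'] zN])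
        also have "act' (ew (i - 1)) (z (Suc a)) = ?R (i - 1) (Suc a)"
          using step.IH i1' by blast
        also have "act' (ew i) (z (Suc a)) = ?R i (Suc a)" using step.IH i by blast
        also have "act' (ew 0) (?R i (Suc a)) + fscale (- ?i) (?R (i - 1) (Suc a)) = fscale ?A (?R i a)"
        proof -
          have im: "of_nat (i - 1) = ?i - 1" using False by (simp add: of_nat_diff)
          consider "a + i < p" | "a + i = p" | "p < a + i" by linarith
          then show ?thesis
          proof cases
            case 1
            obtain j where j: "i = Suc j" using False not0_implies_Suc by blast
            have "act' (ew 0) (z (a + i)) = fscale (of_nat (a + i)) (z (a + i - 1))"
              using low[of "a + j"] 1 j by simp
            then have "act' (ew 0) (?R i (Suc a)) = fscale ((?A - ?i * ?k) * of_nat (a + i)) (z (a + i - 1))"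
              using 1 j by (simp add: W1mod_scale[OF M e0 zN])
            moreover have "?R (i - 1) (Suc a) = fscale (?A - (?i - 1) * ?k) (z (a + i - 1))"
              using 1 j im by simp
            moreover have "?R i a = fscale (of_nat a - ?i * ?k) (z (a + i - 1))"
              using 1 j by simp
            moreover have "(?A - ?i * ?k) * of_nat (a + i) + (- ?i) * (?A - (?i - 1) * ?k) = ?A * (of_nat a - ?i * ?k)"
              by (simp add: algebra_simps)
            ultimately show ?thesis
              by (simp only: fscale.scale_scale fscale.scale_left_distrib[symmetric])
          next
            case 2
            \<comment> \<open>On the boundary the monomial x^p is missing from the first summand,
              and consistently its coefficient a+i = p is 0.\<close>
            have ia: "?i = - of_nat a" using 2 of_nat_p by (metis add_eq_0_iff of_nat_add)
            have "act' (ew 0) (?R i (Suc a)) = 0"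
              using 2 W1mod_zero[OF M e0] by simp
            moreover have "?R (i - 1) (Suc a) = fscale (?A - (?i - 1) * ?k) (z (a + i - 1))"
              using 2 False im by simp
            moreover have "?R i a = fscale (of_nat a - ?i * ?k) (z (a + i - 1))"
              using 2 p_pos by simp
            moreover have "(- ?i) * (?A - (?i - 1) * ?k) = ?A * (of_nat a - ?i * ?k)"
              by (simp add: ia algebra_simps)
            ultimately show ?thesis by (simp only: fscale.scale_scale add_0_left)
          next
            case 3
            then show ?thesis using W1mod_zero[OF M e0] False by simp
          qed
        qed
        finally have "fscale ?A (act' (ew i) (z a)) = fscale ?A (?R i a)" .
        then show ?thesis by (rule fscale.scale_left_imp_eq[OF A])
      qed
    qed
  qed
  then have "is_hom p (dens p) (dens_act p k) N act' (\<lambda>f. \<Sum>a<p. fscale (f a) (z a))"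
    using zN by (intro dens_hom[OF p_pos char M]) (auto simp: Suc_le_eq)
  moreover have "(\<Sum>a<p. fscale (delta (p - 1) a) (z a)) = (\<Sum>a<p. if p - 1 = a then z a else 0)"
    by (intro sum.cong) (auto simp: delta_def)
  then have "(\<Sum>a<p. fscale (delta (p - 1) a) (z a)) = w"
    using ztop p_pos by (simp add: sum.delta)
  ultimately show ?thesis by blast
qed

section \<open>Submodules of the density modules\<close>

lemma submod_lower:
  assumes S: "is_submod p (dens p :: (nat \<Rightarrow> 'a) set) (dens_act p k) S" and "delta a \<in> S" "a < p" "b \<le> a"
  shows "delta b \<in> S"
  using assms(4,2,3)
proof (induction rule: inc_induct)
  case (step b)
  have "dens_act p k (ew 0) (delta (Suc b)) \<in> S"
    using submod_closed[OF S ew_in_W1[OF p_pos]] step by simp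
  moreover have "Suc b < p" using step by simp
  ultimately have "fscale (of_nat (Suc b)) (delta b) \<in> S"
    by (simp add: dens_act_ew_delta del: of_nat_Suc)
  moreover have "of_nat (Suc b) \<noteq> (0 :: 'a)" using of_nat_inj[of "Suc b" 0] \<open>Suc b < p\<close> p_pos
    by (simp del: of_nat_Suc)
  ultimately show ?case using subspace_unscale[OF submod_subspace[OF S]] by blast
qed

lemma submod_top:
  assumes S: "is_submod p (dens p :: (nat \<Rightarrow> 'a) set) (dens_act p k) S" and "delta (p - 1) \<in> S"
  shows "S = dens p"
proof -
  have "delta a \<in> S" if "a < p" for a
    using submod_lower[OF assms, of a] that by simp
  then have "f \<in> S" if "f \<in> dens p" for f
    by (rule subspace_delta[OF submod_subspace[OF S], of p]) (use that in \<open>simp_all add: dens_def\<close>)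
  then show ?thesis using submod_subset[OF S] by blast
qed

text \<open>The weights of \<open>dens p k\<close> are pairwise distinct, so a submodule contains the homogeneous
  components of its elements; the other components are removed one at a time.\<close>

lemma submod_delta:
  assumes S: "is_submod p (dens p :: (nat \<Rightarrow> 'a) set) (dens_act p k) S" and "f \<in> S" "f a \<noteq> 0"
  shows "delta a \<in> S"
  using assms(2,3)
proof (induction "card {b. f b \<noteq> 0}" arbitrary: f rule: less_induct)
  case less
  note S0 = submod_subspace[OF S]
  have f: "f \<in> dens p" using less.prems submod_subset[OF S] by blast
  have ap: "b < p" if "f b \<noteq> 0" for b
  proof (rule ccontr)
    assume "\<not> b < p"
    then show False using f that by (simp add: dens_def)
  qed
  then have fin: "finite {b. f b \<noteq> 0}"
    by (auto intro!: finite_subset[of _ "{..<p}"])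
  show ?case
  proof (cases "\<exists>b. b \<noteq> a \<and> f b \<noteq> 0")
    case False
    then have "f = fscale (f a) (delta a)" by (auto simp: fun_eq_iff delta_def)
    then have "fscale (f a) (delta a) \<in> S" using less.prems(1) by simp
    then show ?thesis using subspace_unscale[OF S0] less.prems(2) by blast
  next
    case True
    then obtain b where b: "b \<noteq> a" "f b \<noteq> 0" by blast
    define g where "g = dens_act p k (ew 1) f - fscale (of_nat b - of_nat k) f"
    have gS: "g \<in> S"
      unfolding g_def
      using fscale.subspace_diff[OF S0 submod_closed[OF S ew_in_W1 less.prems(1)] fscale.subspace_scale[OF S0 less.prems(1)]] p2
      by simp
    have g: "g c = (of_nat c - of_nat b) * f c" for c
    proof (cases "c < p")
      case True
      then show ?thesis by (simp add: g_def dens_act_ew algebra_simps)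
    next
      case False
      then have "f c = 0" using ap[of c] by blast
      then show ?thesis using False by (simp add: g_def dens_act_ew)
    qed
    have "{c. g c \<noteq> 0} \<subset> {c. f c \<noteq> 0}" using b by (auto simp: g)
    then have "card {c. g c \<noteq> 0} < card {c. f c \<noteq> 0}" using fin by (rule psubset_card_mono[rotated])
    moreover have "g a \<noteq> 0" using g[of a] less.prems(2) of_nat_inj[of a b] ap b by auto
    ultimately show ?thesis using less.hyps gS by blast
  qed
qed

text \<open>All proper submodules lie in the hyperplane of polynomials without x^(p-1) term. Hence
  the sum of two proper submodules is proper, and the simple quotient is unique.\<close>

lemma submod_proper:
  assumes S: "is_submod p (dens p :: (nat \<Rightarrow> 'a) set) (dens_act p k) S" "S \<noteq> dens p" and "f \<in> S"
  shows "f (p - 1) = 0"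
  using submod_delta[OF S(1) assms(3)] submod_top[OF S(1)] S(2) by blast

text \<open>Existence of the map is \<open>restricted_hom\<close>. For uniqueness, the set where two
  maps agree is a submodule containing the generator x^(p-1), hence everything.\<close>

lemma dens_induced:
  assumes k: "k < p"
  shows "is_induced p (p - 1 - k) (dens p :: (nat \<Rightarrow> 'a) set) (dens_act p k) (delta (p - 1))"
  unfolding is_induced_def
proof (intro conjI allI impI)
  show "is_restricted p (dens p :: (nat \<Rightarrow> 'a) set) (dens_act p k)" using dens_restricted[OF prime char] .
  show "delta (p - 1) \<in> (dens p :: (nat \<Rightarrow> 'a) set)" by (rule delta_top)
  show "is_wt p (p - 1 - k) (dens_act p k) (delta (p - 1) :: nat \<Rightarrow> 'a)"
    using p2 k by (auto simp: is_wt_def dens_act_ew_delta of_nat_diff)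
  fix N :: "(nat \<Rightarrow> 'a) set" and act' w
  assume N: "is_restricted p N act' \<and> w \<in> N \<and> is_wt p (p - 1 - k) act' w"
  then show "\<exists>f. is_hom p (dens p) (dens_act p k) N act' f \<and> f (delta (p - 1)) = w"
    using restricted_hom k by blast
  fix f g
  assume fg: "is_hom p (dens p) (dens_act p k) N act' f \<and> f (delta (p - 1)) = w \<and>
    is_hom p (dens p) (dens_act p k) N act' g \<and> g (delta (p - 1)) = w"
  let ?S = "{u \<in> dens p. f u = g u}"
  have f: "is_hom p (dens p) (dens_act p k) N act' f" and g: "is_hom p (dens p) (dens_act p k) N act' g"
    using fg by auto
  have "is_submod p (dens p) (dens_act p k) ?S"
    unfolding is_submod_def
    using hom_zero[OF f dens_subspace] hom_zero[OF g dens_subspace]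
    by (auto intro!: fscale.subspaceI fscale.subspace_add[OF dens_subspace] fscale.subspace_scale[OF dens_subspace] fscale.subspace_0[OF dens_subspace]
        simp: hom_add[OF f] hom_add[OF g] hom_scale[OF f] hom_scale[OF g] hom_act[OF f, unfolded One_nat_def] hom_act[OF g, unfolded One_nat_def])
  moreover have "delta (p - 1) \<in> ?S" using fg delta_top by simp
  ultimately have "?S = dens p" by (rule submod_top)
  then show "\<forall>u\<in>dens p. f u = g u" by blast
qed

text \<open>\<open>dens\<close> shows that the choice in \<open>Vmod\<close> is not vacuous. Both
  modules consist of functions on \<open>nat\<close>, so each can be inserted into the universal
  property of the other, and the two maps so obtained are mutually inverse.\<close>

lemma dens_iso_Vmod:
  assumes k: "k < p"
  shows "\<exists>f. is_iso p (dens p :: (nat \<Rightarrow> 'a) set) (dens_act p k) (fst (Vmod p (p - 1 - k))) (snd (Vmod p (p - 1 - k))) f"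
proof -
  let ?lam = "p - 1 - k"
  let ?V = "fst (Vmod p ?lam) :: (nat \<Rightarrow> 'a) set" and ?a = "snd (Vmod p ?lam) :: 'a W1elem \<Rightarrow> _"
  let ?T = "dens p :: (nat \<Rightarrow> 'a) set" and ?t = "dens_act p k"
  let ?d = "delta (p - 1) :: nat \<Rightarrow> 'a"
  note T = dens_induced[OF k]
  have "\<exists>v. is_induced p ?lam (fst (?T, ?t)) (snd (?T, ?t)) v" using T by auto
  then have "\<exists>v. is_induced p ?lam ?V ?a v"
    unfolding Vmod_def by (rule someI)
  then obtain v where V: "is_induced p ?lam ?V ?a v" by blast
  obtain f where f: "is_hom p ?T ?t ?V ?a f" "f ?d = v"
    using induced_universal(1)[OF T inducedD[OF V]] by blast
  obtain g where g: "is_hom p ?V ?a ?T ?t g" "g v = ?d"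
    using induced_universal(1)[OF V inducedD[OF T]] by blast
  have "(g \<circ> f) u = u" if "u \<in> ?T" for u
    by (rule induced_universal(2)[OF T inducedD[OF T] hom_comp[OF f(1) g(1)] _ hom_incl[OF order_refl] _ that])
      (simp_all only: o_apply f(2) g(2))
  then have gf: "g (f u) = u" if "u \<in> ?T" for u using that by simp
  have "(f \<circ> g) u = u" if "u \<in> ?V" for u
    by (rule induced_universal(2)[OF V inducedD[OF V] hom_comp[OF g(1) f(1)] _ hom_incl[OF order_refl] _ that])
      (simp_all only: o_apply f(2) g(2))
  then have fg: "f (g u) = u" if "u \<in> ?V" for u using that by simp
  have "bij_betw f ?T ?V"
    by (rule bij_betw_byWitness[of _ g]) (use gf fg hom_in[OF f(1)] hom_in[OF g(1)] in auto)
  then show ?thesis using f(1) by (auto simp: is_iso_def)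
qed

text \<open>Both kernels are proper, so their sum misses x^(p-1) and is proper too; by maximality
  each kernel equals the sum.\<close>

lemma simple_quotient_unique:
  fixes L L' :: "(nat \<Rightarrow> 'a) set"
  assumes f: "is_hom p (dens p :: (nat \<Rightarrow> 'a) set) (dens_act p k) L act f" "f ` dens p = L" "is_simple p L act"
    and g: "is_hom p (dens p :: (nat \<Rightarrow> 'a) set) (dens_act p k) L' act' g" "g ` dens p = L'" "is_simple p L' act'"
  shows "\<exists>h. is_iso p L act L' act' h"
proof -
  let ?T = "dens p :: (nat \<Rightarrow> 'a) set"
  have proper: "{v \<in> ?T. h v = 0} \<noteq> ?T" if "h ` ?T = N" "is_simple p N b" for h :: "(nat \<Rightarrow> 'a) \<Rightarrow> nat \<Rightarrow> 'a" and N b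
  proof
    assume "{v \<in> ?T. h v = 0} = ?T"
    then have "N \<subseteq> {0}" using that(1) by blast
    moreover have "0 \<in> N" using fscale.subspace_0[OF W1mod_subspace[OF simple_W1mod[OF that(2)]]] .
    ultimately show False using that(2) by (auto simp: is_simple_def)
  qed
  let ?K = "{v \<in> ?T. f v = 0}" and ?K' = "{v \<in> ?T. g v = 0}"
  note K = submod_kernel[OF f(1) dens_mod simple_W1mod[OF f(3)]]
  note K' = submod_kernel[OF g(1) dens_mod simple_W1mod[OF g(3)]]
  have p1: "?K \<noteq> ?T" "?K' \<noteq> ?T" using proper[OF f(2,3)] proper[OF g(2,3)] by auto
  let ?U = "{u + v | u v. u \<in> ?K \<and> v \<in> ?K'}"
  note U = submod_sum[OF dens_mod K K']
  have z: "0 \<in> ?K" "0 \<in> ?K'"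
    using fscale.subspace_0[OF submod_subspace[OF K]] fscale.subspace_0[OF submod_subspace[OF K']] by auto
  have KU: "?K \<subseteq> ?U" "?K' \<subseteq> ?U" using z by (blast intro: add_0_right[symmetric], blast intro: add_0_left[symmetric])
  have "u (p - 1) = 0" if "u \<in> ?U" for u
  proof -
    obtain a b where "u = a + b" "a \<in> ?K" "b \<in> ?K'" using \<open>u \<in> ?U\<close> by blast
    then show ?thesis using submod_proper[OF K p1(1), of a] submod_proper[OF K' p1(2), of b] by simp
  qed
  moreover have "delta (p - 1) (p - 1) \<noteq> (0 :: 'a)" by (simp add: delta_def)
  ultimately have "delta (p - 1) \<notin> ?U" by blast
  then have "?U \<noteq> ?T" using delta_top by metis
  then have "?U = ?K" "?U = ?K'"
    using kernel_maximal[OF dens_mod f U KU(1)] kernel_maximal[OF dens_mod g U KU(2)] by auto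
  then have "?K = ?K'" by simp
  then show ?thesis using iso_of_same_kernel[OF dens_mod f(1,2) g(1,2)] by blast
qed

text \<open>Lowering with d reaches the constant 1, and x^(b+1) d sends it to -(b+1) k x^b, which is
  nonzero. At b = p-1 that coefficient would be 0, so the top monomial needs a separate
  argument.\<close>

lemma submod_nonzero:
  assumes S: "is_submod p (dens p :: (nat \<Rightarrow> 'a) set) (dens_act p k) S" and "S \<noteq> {0}"
    and k: "0 < k" "k < p" and b: "b < p - 1"
  shows "delta b \<in> S"
proof -
  obtain f where f: "f \<in> S" "f \<noteq> 0"
    using assms(2) fscale.subspace_0[OF submod_subspace[OF S]] by blast
  then obtain a where a: "f a \<noteq> 0" by (auto simp: fun_eq_iff)
  have "f \<in> dens p" using f submod_subset[OF S] by blast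
  then have "a < p" using a by (auto simp: dens_def not_le[symmetric])
  then have "delta 0 \<in> S" using submod_lower[OF S submod_delta[OF S f(1) a]] by simp
  then have "dens_act p k (ew (Suc b)) (delta 0) \<in> S"
    using submod_closed[OF S ew_in_W1] b by simp
  moreover have "Suc b \<le> p" using b by simp
  ultimately have "fscale (- (of_nat (Suc b) * of_nat k)) (delta b) \<in> S"
    by (simp add: dens_act_ew_delta[OF p_pos] del: of_nat_Suc)
  moreover have "of_nat (Suc b) \<noteq> (0 :: 'a)" "of_nat k \<noteq> (0 :: 'a)"
    using of_nat_inj[of "Suc b" 0] of_nat_inj[of k 0] b k by (simp_all del: of_nat_Suc)
  then have "- (of_nat (Suc b) * of_nat k) \<noteq> (0 :: 'a)" by simp
  ultimately show ?thesis using subspace_unscale[OF submod_subspace[OF S]] by blast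
qed

text \<open>Concrete simple modules. L(0) and L(p-1) are quotients of T_(p-1) and T_0, but are
  realised inside the opposite ones: as the constants in T_0 and the polynomials of degree at most
  p-2 in T_(p-1). So every model is a submodule of some T_k.\<close>

definition Lmodel :: "nat \<Rightarrow> 'a W1module" where
  "Lmodel lam = (if lam = 0 then ({f. \<forall>a\<ge>1. f a = 0}, dens_act p 0)
     else if lam = p - 1 then ({f \<in> dens p. f (p - 1) = 0}, dens_act p (p - 1))
     else (dens p, dens_act p (p - 1 - lam)))"

text \<open>With k = -1 the action is f -> (uf)', and a derivative has no x^(p-1) term in
  characteristic p.\<close>

lemma dens_act_top:
  assumes "D \<in> W1 p"
  shows "dens_act p (p - 1) D f (p - 1) = (0 :: 'a)"
proof -
  have "(of_nat (Suc (p - 1) - i) :: 'a) - of_nat i * of_nat (p - 1) = 0" if "i \<le> Suc (p - 1)" for i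
    using that p_pos of_nat_p_minus[of i] of_nat_p_minus[of 1] by simp
  then show ?thesis
    unfolding dens_act_def using p_pos by (auto simp del: sum.atMost_Suc intro!: sum.neutral)
qed

lemma dens_act_const:
  assumes "D \<in> W1 p" "\<And>a. 1 \<le> a \<Longrightarrow> f a = (0 :: 'a)"
  shows "dens_act p 0 D f = 0"
proof
  fix b
  have "D (1, xpow1 i) * (of_nat (Suc b - i) - of_nat i * of_nat 0) * f (Suc b - i) = 0" for i
    using assms(2)[of "Suc b - i"] by (cases "Suc b - i") simp_all
  then show "dens_act p 0 D f b = 0 b"
    unfolding dens_act_def by (simp only: sum.neutral_const if_cancel zero_fun_apply)
qed

lemma Lmodel_submod_0: "is_submod p (dens p) (dens_act p 0) (fst (Lmodel 0))"
proof -
  have "module.subspace fscale {f :: nat \<Rightarrow> 'a. \<forall>a\<ge>1. f a = 0}"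
    by (intro fscale.subspaceI) auto
  then show ?thesis
    using dens_act_const p_pos by (auto simp: is_submod_def Lmodel_def dens_def)
qed

lemma Lmodel_submod_top: "is_submod p (dens p) (dens_act p (p - 1)) (fst (Lmodel (p - 1)))"
proof -
  have "module.subspace fscale {f \<in> dens p. f (p - 1) = (0 :: 'a)}"
    using fscale.subspace_add[OF dens_subspace] fscale.subspace_scale[OF dens_subspace] fscale.subspace_0[OF dens_subspace]
    by (intro fscale.subspaceI) auto
  then show ?thesis
    using dens_act_top p2 by (auto simp: is_submod_def Lmodel_def)
qed

lemma Lmodel_simple:
  assumes "lam < p"
  shows "is_simple p (fst (Lmodel lam)) (snd (Lmodel lam))"
proof -
  consider "lam = 0" | "lam = p - 1" "lam \<noteq> 0" | "lam \<noteq> 0" "lam < p - 1" using assms by linarith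
  then show ?thesis
  proof cases
    case 1
    let ?C = "fst (Lmodel 0)"
    have C: "?C = {f. \<forall>a\<ge>1. f a = 0}" and sC: "snd (Lmodel 0) = dens_act p 0" by (auto simp: Lmodel_def)
    have W: "is_W1mod p ?C (dens_act p 0)" using submod_W1mod[OF dens_mod Lmodel_submod_0] .
    have "delta 0 \<in> ?C" by (auto simp: C delta_def)
    then have "?C \<noteq> {0}" using delta_nonzero[of 0] by blast
    moreover have "S = {0} \<or> S = ?C" if S: "is_submod p ?C (dens_act p 0) S" for S
    proof (rule disjCI)
      assume "S \<noteq> ?C"
      have "f = 0" if "f \<in> S" for f
      proof (rule ccontr)
        assume "f \<noteq> 0"
        have fC: "\<And>a. 1 \<le> a \<Longrightarrow> f a = 0" using \<open>f \<in> S\<close> submod_subset[OF S] C by auto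
        have "f 0 \<noteq> 0"
        proof
          assume "f 0 = 0"
          then have "f a = 0" for a using fC[of a] by (cases a) auto
          then show False using \<open>f \<noteq> 0\<close> by (auto simp: fun_eq_iff)
        qed
        have "g \<in> S" if "g \<in> ?C" for g
        proof -
          have "g = fscale (g 0 / f 0) f"
          proof
            fix a
            show "g a = fscale (g 0 / f 0) f a"
              using that fC[of a] \<open>f 0 \<noteq> 0\<close> by (cases a) (auto simp: C)
          qed
          then show ?thesis using fscale.subspace_scale[OF submod_subspace[OF S] \<open>f \<in> S\<close>] by metis
        qed
        then show False using \<open>S \<noteq> ?C\<close> submod_subset[OF S] by blast
      qed
      then show "S = {0}" using fscale.subspace_0[OF submod_subspace[OF S]] by blast
    qed
    ultimately show ?thesis unfolding 1 is_simple_def sC using W by blast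
  next
    case 2
    let ?Q = "fst (Lmodel (p - 1))"
    have Q: "?Q = {f \<in> dens p. f (p - 1) = 0}" and sQ: "snd (Lmodel (p - 1)) = dens_act p (p - 1)"
      using p2 by (auto simp: Lmodel_def)
    have W: "is_W1mod p ?Q (dens_act p (p - 1))" using submod_W1mod[OF dens_mod Lmodel_submod_top] .
    have "delta 0 \<in> ?Q" unfolding Q using p2 by (auto simp: delta_def dens_def)
    then have "?Q \<noteq> {0}" using delta_nonzero[of 0] by blast
    moreover have "S = {0} \<or> S = ?Q" if S: "is_submod p ?Q (dens_act p (p - 1)) S" for S
    proof (cases "S = {0}")
      case False
      then have d: "delta b \<in> S" if "b < p - 1" for b
        using submod_nonzero[OF submod_trans[OF Lmodel_submod_top S]] that p2 by simp
      have "f \<in> S" if f: "f \<in> ?Q" for f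
      proof (rule subspace_delta[OF submod_subspace[OF S] d])
        show "f a = 0" if "p - 1 \<le> a" for a
          using f[unfolded Q] that by (cases "a = p - 1") (auto simp: dens_def)
      qed
      then show ?thesis using submod_subset[OF S] by blast
    qed simp
    ultimately show ?thesis unfolding 2(1) is_simple_def sQ using W by blast
  next
    case 3
    let ?k = "p - 1 - lam"
    have M: "Lmodel lam = (dens p, dens_act p ?k)" using 3 by (simp add: Lmodel_def)
    have k: "0 < ?k" "?k < p - 1" using 3 by auto
    have "dens p \<noteq> {0 :: nat \<Rightarrow> 'a}" using delta_top delta_nonzero by blast
    moreover have "S = {0} \<or> S = dens p" if S: "is_submod p (dens p :: (nat \<Rightarrow> 'a) set) (dens_act p ?k) S" for S
    proof (cases "S = {0}")
      case False
      then have d: "delta b \<in> S" if "b < p - 1" for b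
        using submod_nonzero[OF S] that k by simp
      \<comment> \<open>The missing top monomial comes from x^2 d applied to x^(p-2), with
        coefficient p-2-2k = -2(k+1); this is nonzero because p is odd and k < p-1.\<close>
      have "dens_act p ?k (ew 2) (delta (p - 2)) \<in> S"
        using submod_closed[OF S ew_in_W1] d[of "p - 2"] p2 by simp
      moreover have "dens_act p ?k (ew 2) (delta (p - 2)) = fscale (of_nat (p - 2) - 2 * of_nat ?k) (delta (p - 1) :: nat \<Rightarrow> 'a)"
      proof -
        have "p - 2 + 2 = p" "p - 2 < p" using p2 by auto
        then show ?thesis using dens_act_ew_delta[of "p - 2" p ?k 2] p_pos by (simp only: of_nat_numeral) simp
      qed
      ultimately have 1: "fscale (of_nat (p - 2) - 2 * of_nat ?k) (delta (p - 1)) \<in> S"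
        by simp
      have "of_nat (p - 2) - 2 * of_nat ?k \<noteq> (0 :: 'a)"
      proof
        assume "of_nat (p - 2) - 2 * of_nat ?k = (0 :: 'a)"
        then have "2 * (of_nat (Suc ?k) :: 'a) = 0" using of_nat_p_minus[of 2] p2 by (simp add: algebra_simps)
        then have "of_nat (Suc ?k) = (0 :: 'a)" using two_nonzero by (metis mult_eq_0_iff)
        moreover have "Suc ?k < p" using k by linarith
        ultimately show False using of_nat_nonzero[of "Suc ?k"] by blast
      qed
      then have "delta (p - 1) \<in> S" using 1 subspace_unscale[OF submod_subspace[OF S]] by blast
      then show ?thesis using submod_top[OF S] by blast
    qed simp
    ultimately show ?thesis using M dens_mod by (simp add: is_simple_def)
  qed
qed

text \<open>The coefficient of x^(p-1) plays the role of a residue: it vanishes on every (uf)',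
  hence is a homomorphism from T_(p-1) to the trivial module.\<close>

lemma hom_top_coeff:
  "is_hom p (dens p) (dens_act p (p - 1)) (fst (Lmodel 0)) (snd (Lmodel 0)) (\<lambda>f. fscale (f (p - 1)) (delta 0))" (is ?hom)
  and image_top_coeff: "(\<lambda>f. fscale (f (p - 1)) (delta 0)) ` dens p = fst (Lmodel 0)" (is ?img)
  and kernel_top_coeff: "{f \<in> dens p. fscale (f (p - 1)) (delta 0) = 0} = fst (Lmodel (p - 1))" (is ?ker)
proof -
  have C: "fst (Lmodel 0) = {f. \<forall>a\<ge>1. f a = 0}" and sC: "snd (Lmodel 0) = dens_act p 0" by (auto simp: Lmodel_def)
  have in_C: "fscale c (delta 0) \<in> fst (Lmodel 0)" for c by (auto simp: C delta_def)
  have act: "fscale (dens_act p (p - 1) D f (p - 1)) (delta 0) = dens_act p 0 D (fscale (f (p - 1)) (delta 0))"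
    if "D \<in> W1 p" for D :: "'a W1elem" and f
    using dens_act_const[OF that, of "fscale (f (p - 1)) (delta 0)"] in_C[of "f (p - 1)"]
    unfolding dens_act_top[OF that, of f] by (simp add: C)
  show ?hom
    unfolding is_hom_def sC
    by (intro conjI ballI allI in_C act) (auto simp: fun_eq_iff algebra_simps)
  show ?img
  proof
    show "(\<lambda>f. fscale (f (p - 1)) (delta 0)) ` dens p \<subseteq> fst (Lmodel 0)" using in_C by blast
    show "fst (Lmodel 0) \<subseteq> (\<lambda>f. fscale (f (p - 1)) (delta 0)) ` dens p"
    proof
      fix g assume g: "g \<in> fst (Lmodel 0)"
      show "g \<in> (\<lambda>f. fscale (f (p - 1)) (delta 0)) ` dens p"
      proof (rule image_eqI)
        show "fscale (g 0) (delta (p - 1)) \<in> dens p"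
          using fscale.subspace_scale[OF dens_subspace delta_top] .
        show "g = fscale (fscale (g 0) (delta (p - 1)) (p - 1)) (delta 0)"
          using g by (auto simp: fun_eq_iff delta_def C)
      qed
    qed
  qed
  have "fscale c (delta 0) = 0 \<longleftrightarrow> c = (0 :: 'a)" for c
    by (simp add: delta_nonzero)
  then show ?ker using p2 by (auto simp: Lmodel_def)
qed

definition dderiv :: "(nat \<Rightarrow> 'a) \<Rightarrow> nat \<Rightarrow> 'a" where
  "dderiv f = (\<lambda>a. of_nat (Suc a) * f (Suc a))"

lemma toP_dderiv: "f \<in> dens p \<Longrightarrow> toP p (dderiv f) = pderiv (toP p f)"
proof -
  assume f: "f \<in> dens p"
  have "(if a < p then of_nat (Suc a) * f (Suc a) else 0) = of_nat (Suc a) * (if Suc a < p then f (Suc a) else 0)" for a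
    using f by (auto simp: dens_def)
  then show ?thesis by (auto simp: poly_eq_iff coeff_toP coeff_pderiv dderiv_def simp del: of_nat_Suc)
qed

lemma dderiv_in: "f \<in> dens p \<Longrightarrow> dderiv f \<in> {g \<in> dens p. g (p - 1) = 0}"
  using p_pos of_nat_p by (auto simp: dderiv_def dens_def)

text \<open>The derivative intertwines functions (\<open>k = 0\<close>) with densities of weight \<open>k = -1 = p - 1\<close>;
  it identifies both copies of the nontrivial simple factor \<open>L(p - 1)\<close>.\<close>

lemma hom_dderiv:
  "is_hom p (dens p) (dens_act p 0) (fst (Lmodel (p - 1))) (snd (Lmodel (p - 1))) dderiv" (is ?hom)
  and image_dderiv: "dderiv ` dens p = fst (Lmodel (p - 1))" (is ?img)
  and kernel_dderiv: "{f \<in> dens p. dderiv f = 0} = fst (Lmodel 0)" (is ?ker)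
proof -
  have Q: "fst (Lmodel (p - 1)) = {f \<in> dens p. f (p - 1) = 0}" and sQ: "snd (Lmodel (p - 1)) = dens_act p (p - 1)"
    using p2 by (auto simp: Lmodel_def)
  have C: "fst (Lmodel 0) = {f. \<forall>a\<ge>1. f a = 0}" by (auto simp: Lmodel_def)
  have act: "dderiv (dens_act p 0 D f) = dens_act p (p - 1) D (dderiv f)" if D: "D \<in> W1 p" and f: "f \<in> dens p" for D f
  proof (rule dens_eqI[of _ p])
    let ?U = "wpoly p D" and ?F = "toP p f"
    \<comment> \<open>Weight p-1 is -1, for which the twisted action on F' is U F'' + U' F' = (U
      F')'.\<close>
    have m1: "of_nat (p - 1) = (- 1 :: 'a poly)" using of_nat_p_minus[of 1] p_pos by (simp add: of_nat_poly one_pCons)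
    have df: "dderiv f \<in> dens p" using dderiv_in[OF f] by simp
    have "eqp p (toP p (dderiv (dens_act p 0 D f))) (pderiv (tder 0 ?U ?F))"
      unfolding toP_dderiv[OF dens_act_in] by (rule eqp_pderiv[OF char toP_dens_act[OF p_pos D f]])
    also have "pderiv (tder 0 ?U ?F) = tder (p - 1) ?U (pderiv ?F)"
      unfolding tder_def m1 by (simp add: pderiv_mult algebra_simps)
    also have "\<dots> = tder (p - 1) ?U (toP p (dderiv f))" by (simp add: toP_dderiv[OF f])
    also have "eqp p \<dots> (toP p (dens_act p (p - 1) D (dderiv f)))"
      by (rule eqp_sym[OF toP_dens_act[OF p_pos D df]])
    finally show "eqp p (toP p (dderiv (dens_act p 0 D f))) (toP p (dens_act p (p - 1) D (dderiv f)))" .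
  qed (use dderiv_in in auto)
  show ?hom
    unfolding is_hom_def sQ Q using dderiv_in act
    by (auto simp: dderiv_def fun_eq_iff algebra_simps)
  have nz: "of_nat (Suc a) \<noteq> (0 :: 'a)" if "Suc a < p" for a
    using of_nat_inj[of "Suc a" 0] that by (simp del: of_nat_Suc)
  show ?img
  proof
    show "dderiv ` dens p \<subseteq> fst (Lmodel (p - 1))" unfolding Q using dderiv_in by auto
    show "fst (Lmodel (p - 1)) \<subseteq> dderiv ` dens p"
    proof
      fix g assume g: "g \<in> fst (Lmodel (p - 1))"
      show "g \<in> dderiv ` dens p"
      proof (rule image_eqI)
        \<comment> \<open>Term-by-term antiderivative. It exists because g has no x^(p-1) term, the
          only one whose integration would divide by p.\<close>
        show "(\<lambda>a. if a < p then g (a - 1) / of_nat a else 0) \<in> dens p"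
          by (simp add: dens_def)
        show "g = dderiv (\<lambda>a. if a < p then g (a - 1) / of_nat a else 0)"
        proof
          fix a
          consider "Suc a < p" | "a = p - 1" | "p \<le> a" by linarith
          then show "g a = dderiv (\<lambda>a. if a < p then g (a - 1) / of_nat a else 0) a"
            using g[unfolded Q] nz[of a] by cases (auto simp: dderiv_def dens_def simp del: of_nat_Suc)
        qed
      qed
    qed
  qed
  show ?ker
  proof (intro set_eqI iffI)
    fix f assume f: "f \<in> {f \<in> dens p. dderiv f = 0}"
    have "f a = 0" if "1 \<le> a" for a
    proof (cases "a < p")
      case True
      obtain b where b: "a = Suc b" using \<open>1 \<le> a\<close> by (cases a) auto
      have "dderiv f b = 0" using f by simp
      then show ?thesis using nz[of b] b True by (simp add: dderiv_def del: of_nat_Suc)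
    qed (use f in \<open>auto simp: dens_def\<close>)
    then show "f \<in> fst (Lmodel 0)" by (simp add: C)
  next
    fix f assume "f \<in> fst (Lmodel 0)"
    then show "f \<in> {f \<in> dens p. dderiv f = 0}"
      using p_pos by (auto simp: C dens_def dderiv_def fun_eq_iff)
  qed
qed

lemma Lmodel_quotient:
  assumes "lam < p"
  shows "\<exists>f. is_hom p (dens p) (dens_act p (p - 1 - lam)) (fst (Lmodel lam)) (snd (Lmodel lam)) f \<and> f ` dens p = fst (Lmodel lam)"
proof -
  consider "lam = 0" | "lam = p - 1" "lam \<noteq> 0" | "lam \<noteq> 0" "lam < p - 1" using assms by linarith
  then show ?thesis
  proof cases
    case 1
    show ?thesis unfolding 1 diff_zero using hom_top_coeff image_top_coeff by blast
  next
    case 2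
    show ?thesis unfolding 2(1) diff_self_eq_0 using hom_dderiv image_dderiv by blast
  next
    case 3
    then have M: "Lmodel lam = (dens p, dens_act p (p - 1 - lam))" by (simp add: Lmodel_def)
    show ?thesis unfolding M by (intro exI[of _ "\<lambda>v. v"]) (auto intro: hom_incl)
  qed
qed

text \<open>\<open>Lmodel\<close>, as a quotient of \<open>Vmod\<close> through the isomorphism with
  \<open>dens\<close>, shows that the choice in \<open>Lmod\<close> is not vacuous; the chosen
  quotient map is then pulled back to \<open>dens\<close>.\<close>

lemma dens_Lmod_quotient:
  assumes "lam < p"
  shows Lmod_simple: "is_simple p (fst (Lmod p lam :: 'a W1module)) (snd (Lmod p lam))"
    and "\<exists>f. is_hom p (dens p :: (nat \<Rightarrow> 'a) set) (dens_act p (p - 1 - lam)) (fst (Lmod p lam)) (snd (Lmod p lam)) f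
      \<and> f ` dens p = fst (Lmod p lam)"
proof -
  let ?k = "p - 1 - lam"
  let ?V = "Vmod p lam :: 'a W1module"
  have lam: "p - 1 - ?k = lam" and k: "?k < p" using assms by auto
  obtain h where h: "is_iso p (dens p :: (nat \<Rightarrow> 'a) set) (dens_act p ?k) (fst ?V) (snd ?V) h"
    using dens_iso_Vmod[OF k] unfolding lam by blast
  note h' = iso_inv[OF h dens_mod]
  obtain f where f: "is_hom p (dens p) (dens_act p ?k) (fst (Lmodel lam)) (snd (Lmodel lam)) f" "f ` dens p = fst (Lmodel lam)"
    using Lmodel_quotient[OF assms] by blast
  have "is_hom p (fst ?V) (snd ?V) (fst (Lmodel lam)) (snd (Lmodel lam)) (f \<circ> inv_into (dens p) h)"
    using hom_comp[OF iso_hom[OF h'] f(1)] .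
  moreover have "(f \<circ> inv_into (dens p) h) ` fst ?V = fst (Lmodel lam)"
    using iso_image[OF h'] f(2) by (metis image_comp)
  ultimately have "is_simple p (fst (Lmodel lam)) (snd (Lmodel lam)) \<and>
      (\<exists>f. is_hom p (fst ?V) (snd ?V) (fst (Lmodel lam)) (snd (Lmodel lam)) f \<and> f ` fst ?V = fst (Lmodel lam))"
    using Lmodel_simple[OF assms] by blast
  then have L: "is_simple p (fst (Lmod p lam :: 'a W1module)) (snd (Lmod p lam)) \<and>
      (\<exists>f. is_hom p (fst ?V) (snd ?V) (fst (Lmod p lam)) (snd (Lmod p lam)) f \<and> f ` fst ?V = fst (Lmod p lam))"
    unfolding Lmod_def by (rule someI)
  then show "is_simple p (fst (Lmod p lam :: 'a W1module)) (snd (Lmod p lam))" by blast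
  obtain g where g: "is_hom p (fst ?V) (snd ?V) (fst (Lmod p lam)) (snd (Lmod p lam)) g" "g ` fst ?V = fst (Lmod p lam)"
    using L by blast
  have "(g \<circ> h) ` dens p = fst (Lmod p lam)" using g(2) iso_image[OF h] by (metis image_comp)
  then show "\<exists>f. is_hom p (dens p :: (nat \<Rightarrow> 'a) set) (dens_act p ?k) (fst (Lmod p lam)) (snd (Lmod p lam)) f
      \<and> f ` dens p = fst (Lmod p lam)"
    using hom_comp[OF iso_hom[OF h] g(1)] by blast
qed

lemma Lmodel_iso_Lmod:
  assumes "lam < p"
  shows "\<exists>h. is_iso p (fst (Lmodel lam)) (snd (Lmodel lam)) (fst (Lmod p lam)) (snd (Lmod p lam)) h"
proof -
  obtain f where f: "is_hom p (dens p) (dens_act p (p - 1 - lam)) (fst (Lmodel lam)) (snd (Lmodel lam)) f"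
    "f ` dens p = fst (Lmodel lam)"
    using Lmodel_quotient[OF assms] by blast
  obtain g where g: "is_hom p (dens p :: (nat \<Rightarrow> 'a) set) (dens_act p (p - 1 - lam)) (fst (Lmod p lam)) (snd (Lmod p lam)) g"
    "g ` dens p = fst (Lmod p lam)"
    using dens_Lmod_quotient(2)[OF assms] by blast
  show ?thesis by (rule simple_quotient_unique[OF f Lmodel_simple[OF assms] g Lmod_simple[OF assms]])
qed

lemma Vmod_W1mod: "lam < p \<Longrightarrow> is_W1mod p (fst (Vmod p lam :: 'a W1module)) (snd (Vmod p lam))"
proof -
  assume "lam < p"
  then have lam: "p - 1 - (p - 1 - lam) = lam" "p - 1 - lam < p" by auto
  obtain h where "is_iso p (dens p :: (nat \<Rightarrow> 'a) set) (dens_act p (p - 1 - lam)) (fst (Vmod p lam)) (snd (Vmod p lam)) h"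
    using dens_iso_Vmod[OF lam(2)] unfolding lam(1) by blast
  then show ?thesis using W1mod_image[OF iso_hom iso_image dens_mod] by blast
qed

section \<open>Vectors killed by W(1)_1 separate the simple modules\<close>

lemma is_wt_hom:
  fixes M :: "('x \<Rightarrow> 'a) set"
  assumes f: "is_hom p M act N act' f" and M: "is_W1mod p M act" and v: "v \<in> M" "is_wt p j act v"
  shows "is_wt p j act' (f v)"
proof -
  have "act' (ew i) (f v) = f (act (ew i) v)" if "i < p" for i
    using hom_act[OF f ew_in_W1[OF that] v(1)] by simp
  then show ?thesis
    using v p2 hom_scale[OF f v(1)] hom_zero[OF f W1mod_subspace[OF M]] by (simp add: is_wt_def)
qed

lemma Lmodel_wt:
  assumes "lam < p"
  shows "\<exists>v\<in>fst (Lmodel lam). v \<noteq> 0 \<and> is_wt p lam (snd (Lmodel lam)) v"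
proof -
  consider "lam = 0" | "lam = p - 1" "lam \<noteq> 0" | "lam \<noteq> 0" "lam < p - 1" using assms by linarith
  then show ?thesis
  proof cases
    case 1
    have "is_wt p 0 (dens_act p 0) (delta 0 :: nat \<Rightarrow> 'a)"
      using p2 by (auto simp: is_wt_def dens_act_ew_delta)
    moreover have M: "Lmodel 0 = ({f. \<forall>a\<ge>1. f a = 0}, dens_act p 0)" by (simp add: Lmodel_def)
    moreover have "delta 0 \<in> {f. \<forall>a\<ge>1. f a = (0 :: 'a)}" by (auto simp: delta_def)
    ultimately show ?thesis unfolding 1 M fst_conv snd_conv using delta_nonzero by blast
  next
    case 2
    \<comment> \<open>Here the vector is x^(p-2). Its weight is p-2-(p-1) = -1 = p-1; x^2 d has
      coefficient p-2-2(p-1) = 0 on it, and higher x^i d leave the range of degrees.\<close>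
    have "of_nat (p - 2) - 2 * of_nat (p - 1) = (0 :: 'a)" "of_nat (p - 2) - of_nat (p - 1) = (of_nat (p - 1) :: 'a)"
      using of_nat_p_minus[of 1] of_nat_p_minus[of 2] p2 by auto
    moreover have pm: "p - 2 < p" using p2 by simp
    moreover have "dens_act p (p - 1) (ew i) (delta (p - 2)) = (0 :: nat \<Rightarrow> 'a)" if "2 \<le> i" for i
    proof (cases "i = 2")
      case True
      have "of_nat (p - 2) - of_nat 2 * of_nat (p - 1) = (0 :: 'a)" using calculation(1) by simp
      then show ?thesis unfolding dens_act_ew_delta[OF pm] True by (simp only: fscale.scale_zero_left if_cancel)
    next
      case False
      then have "\<not> p - 2 + i \<le> p" using \<open>2 \<le> i\<close> p2 by linarith
      then show ?thesis unfolding dens_act_ew_delta[OF pm] by (simp only: simp_thms if_False)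
    qed
    moreover have "p - 2 + 1 - 1 = p - 2" "1 \<le> p - 2 + 1" "p - 2 + 1 \<le> p" using p2 by auto
    ultimately have "is_wt p (p - 1) (dens_act p (p - 1)) (delta (p - 2) :: nat \<Rightarrow> 'a)"
      unfolding is_wt_def dens_act_ew_delta[OF pm, of "p - 1" 1] by (simp only: simp_thms if_True of_nat_1 mult_1_left) blast
    moreover have M: "Lmodel lam = ({f \<in> dens p. f (p - 1) = 0}, dens_act p (p - 1))"
      using 2 by (auto simp: Lmodel_def)
    moreover have "delta (p - 2) \<in> {f \<in> dens p. f (p - 1) = (0 :: 'a)}"
      using p2 by (auto simp: delta_def dens_def)
    ultimately show ?thesis unfolding 2(1)[symmetric] M fst_conv snd_conv using delta_nonzero by blast
  next
    case 3
    then have M: "Lmodel lam = (dens p, dens_act p (p - 1 - lam))" by (simp add: Lmodel_def)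
    have "p - 1 - lam < p" "p - 1 - (p - 1 - lam) = lam" using 3 by auto
    then have "is_wt p lam (dens_act p (p - 1 - lam)) (delta (p - 1) :: nat \<Rightarrow> 'a)"
      using inducedD(3)[OF dens_induced[of "p - 1 - lam"]] by simp
    then show ?thesis using delta_top delta_nonzero unfolding M by auto
  qed
qed

text \<open>Any monomial x^a occurring in v has weight a-k, so j is found by locating a. Being
  killed by x^i d forces a = ik whenever x^(a+i-1) is still in range.\<close>

lemma Lmodel_wt_unique:
  assumes "lam < p" "j < p" and v: "v \<in> fst (Lmodel lam)" "v \<noteq> 0" "is_wt p j (snd (Lmodel lam)) v"
  shows "j = lam"
proof -
  obtain a where a: "v a \<noteq> 0" using v(2) by (auto simp: fun_eq_iff)
  have wt: "of_nat a - of_nat k = (of_nat j :: 'a)" if "snd (Lmodel lam) = dens_act p k" "a < p" for k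
  proof -
    have "dens_act p k (ew 1) v a = of_nat j * v a" using v(3) that(1) by (simp add: is_wt_def)
    then have "(of_nat a - of_nat k) * v a = of_nat j * v a" using that(2) by (simp add: dens_act_ew)
    then show ?thesis using a by simp
  qed
  have kill: "of_nat a = (of_nat i * of_nat k :: 'a)" if "snd (Lmodel lam) = dens_act p k" "2 \<le> i" "i < p" "a + i \<le> p" for i k
  proof -
    have "dens_act p k (ew i) v (a + i - 1) = 0" using v(3) that by (simp add: is_wt_def)
    moreover have "Suc (a + i - 1) = a + i" "a + i - 1 < p" using that by auto
    ultimately have "(of_nat a - of_nat i * of_nat k) * v a = 0" by (simp add: dens_act_ew)
    then show ?thesis using a by simp
  qed
  consider "lam = 0" | "lam = p - 1" "lam \<noteq> 0" | "lam \<noteq> 0" "lam < p - 1" using assms by linarith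
  then show ?thesis
  proof cases
    case 1
    then have "a = 0" using v(1) a by (cases a) (auto simp: Lmodel_def)
    then show ?thesis using wt[of 0] 1 of_nat_inj[of j 0] assms(2) p_pos by (simp add: Lmodel_def)
  next
    case 2
    then have M: "fst (Lmodel lam) = {f \<in> dens p. f (p - 1) = 0}" "snd (Lmodel lam) = dens_act p (p - 1)"
      by (auto simp: Lmodel_def)
    have "\<not> p \<le> a" "a \<noteq> p - 1" using v(1) a by (auto simp: M dens_def)
    then have a': "a + 2 \<le> p" "a < p" by auto
    have m: "of_nat (p - 1) = (- 1 :: 'a)" "of_nat (p - 2) = (- 2 :: 'a)"
      using of_nat_p_minus[of 1] of_nat_p_minus[of 2] p2 by auto
    then have "of_nat a = (of_nat (p - 2) :: 'a)" using kill[OF M(2), of 2] a' p2 by simp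
    then have "(of_nat j :: 'a) = of_nat (p - 1)" using wt[OF M(2) a'(2)] m by simp
    then show ?thesis using of_nat_inj[of j "p - 1"] assms(2) 2(1) p_pos by simp
  next
    case 3
    let ?k = "p - 1 - lam"
    have M: "fst (Lmodel lam) = dens p" "snd (Lmodel lam) = dens_act p ?k" using 3 by (auto simp: Lmodel_def)
    have k: "0 < ?k" "?k < p - 1" using 3 by auto
    then have k0: "of_nat ?k \<noteq> (0 :: 'a)" using of_nat_inj[of ?k 0] by simp
    have ap: "a < p" using v(1) a by (auto simp: M dens_def not_le[symmetric])
    have m2: "of_nat (p - 2) = (- 2 :: 'a)" using of_nat_p_minus[of 2] p2 by auto
    \<comment> \<open>Below the top, x^2 d gives a = 2k. If x^3 d is also in range, a = 3k and so k
      = 0, which is excluded; for a = p-2 the equation reads 2(k+1) = 0, also excluded.\<close>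
    have "a = p - 1"
    proof (rule ccontr)
      assume "a \<noteq> p - 1"
      then have "a + 2 \<le> p" using ap by linarith
      then have 2: "of_nat a = (2 * of_nat ?k :: 'a)" using kill[OF M(2), of 2] p2 by simp
      show False
      proof (cases "a = p - 2")
        case True
        then have "2 * (of_nat (Suc ?k) :: 'a) = 0" using 2 m2 by (simp add: algebra_simps)
        then have "of_nat (Suc ?k) = (0 :: 'a)" using two_nonzero by (metis mult_eq_0_iff)
        moreover have "Suc ?k < p" using k by linarith
        ultimately show False using of_nat_nonzero[of "Suc ?k"] by blast
      next
        case False
        then have a3: "a + 3 \<le> p" using \<open>a + 2 \<le> p\<close> by linarith
        show False
        \<comment> \<open>For p = 3 there is no x^3 d in W(1), but then a = 0 and already 2k = 0 is
          impossible.\<close>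
        proof (cases "p = 3")
          case True
          then show False using a3 2 k0 two_nonzero by simp
        next
          case False
          then have "of_nat a = (3 * of_nat ?k :: 'a)" using kill[OF M(2), of 3] a3 p2 by simp
          moreover have "(3 * of_nat ?k :: 'a) = 2 * of_nat ?k + of_nat ?k" by (simp add: algebra_simps)
          ultimately show False using 2 k0 by (metis add_cancel_right_right)
        qed
      qed
    qed
    then have "of_nat j = (of_nat (p - 1) - of_nat ?k :: 'a)" using wt[OF M(2) ap] by simp
    also have "\<dots> = of_nat lam" using 3 by (simp add: of_nat_diff)
    finally show ?thesis using of_nat_inj assms by blast
  qed
qed

text \<open>An isomorphism carries the vector of weight \<open>lam\<close> to one in the model of
  \<open>lam'\<close>, where the only possible weight is \<open>lam'\<close>.\<close>

lemma Lmod_inj: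
  assumes lam: "lam < p" "lam' < p" and
    h: "is_iso p (fst (Lmod p lam :: 'a W1module)) (snd (Lmod p lam)) (fst (Lmod p lam')) (snd (Lmod p lam')) h"
  shows "lam = lam'"
proof -
  obtain f where f: "is_iso p (fst (Lmodel lam)) (snd (Lmodel lam)) (fst (Lmod p lam)) (snd (Lmod p lam)) f"
    using Lmodel_iso_Lmod[OF lam(1)] by blast
  obtain g where g: "is_iso p (fst (Lmodel lam')) (snd (Lmodel lam')) (fst (Lmod p lam')) (snd (Lmod p lam')) g"
    using Lmodel_iso_Lmod[OF lam(2)] by blast
  note W = simple_W1mod[OF Lmodel_simple[OF lam(1)]] simple_W1mod[OF Lmodel_simple[OF lam(2)]]
  note i = iso_comp[OF iso_comp[OF f h] iso_inv[OF g W(2)]]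
  let ?i = "inv_into (fst (Lmodel lam')) g \<circ> (h \<circ> f)"
  obtain v where v: "v \<in> fst (Lmodel lam)" "v \<noteq> 0" "is_wt p lam (snd (Lmodel lam)) v"
    using Lmodel_wt[OF lam(1)] by blast
  have "?i v \<in> fst (Lmodel lam')" using hom_in[OF iso_hom[OF i] v(1)] .
  moreover have "?i v \<noteq> 0" using iso_kernel[OF i W1mod_subspace[OF W(1)]] v by blast
  moreover have "is_wt p lam (snd (Lmodel lam')) (?i v)" using is_wt_hom[OF iso_hom[OF i] W(1) v(1,3)] .
  ultimately show ?thesis using Lmodel_wt_unique[OF lam(2,1)] by blast
qed

lemma factor_iso_Lmod_unique:
  fixes act :: "'a W1elem \<Rightarrow> ('x \<Rightarrow> 'a) \<Rightarrow> 'x \<Rightarrow> 'a"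
  assumes C: "is_W1mod p C' act" and j: "j < p" "j' < p"
    and f: "factor_iso p act C C' (fst (Lmod p j)) (snd (Lmod p j))"
      "factor_iso p act C C' (fst (Lmod p j')) (snd (Lmod p j'))"
  shows "j = j'"
proof -
  obtain f where f: "is_hom p C' act (fst (Lmod p j)) (snd (Lmod p j)) f" "f ` C' = fst (Lmod p j)" "{v \<in> C'. f v = 0} = C"
    using assms(4) unfolding factor_iso_def by blast
  obtain g where g: "is_hom p C' act (fst (Lmod p j')) (snd (Lmod p j')) g" "g ` C' = fst (Lmod p j')" "{v \<in> C'. g v = 0} = C"
    using assms(5) unfolding factor_iso_def by blast
  have "{v \<in> C'. f v = 0} = {v \<in> C'. g v = 0}" using f(3) g(3) by simp
  then obtain h where "is_iso p (fst (Lmod p j :: 'a W1module)) (snd (Lmod p j)) (fst (Lmod p j')) (snd (Lmod p j')) h"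
    using iso_of_same_kernel[OF C f(1,2) g(1,2)] by blast
  then show ?thesis by (rule Lmod_inj[OF j])
qed

section \<open>Composition factors of the summands\<close>

lemma Lmodel_factors:
  assumes "lam < p"
  shows "has_factors p (snd (Lmodel lam)) [lam] (fst (Lmodel lam))"
proof -
  obtain h where "is_iso p (fst (Lmodel lam)) (snd (Lmodel lam)) (fst (Lmod p lam)) (snd (Lmod p lam)) h"
    using Lmodel_iso_Lmod[OF assms] by blast
  then show ?thesis
    using has_factors_iso[OF simple_W1mod[OF Lmodel_simple[OF assms]]] has_factors_Lmod[OF simple_W1mod[OF Lmod_simple[OF assms]]]
    by blast
qed

lemma Vmod_factors:
  assumes "lam < p" "has_factors p (dens_act p (p - 1 - lam)) js (dens p :: (nat \<Rightarrow> 'a) set)"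
  shows "has_factors p (snd (Vmod p lam)) js (fst (Vmod p lam :: 'a W1module))"
proof -
  have lam: "p - 1 - (p - 1 - lam) = lam" "p - 1 - lam < p" using assms by auto
  obtain h where "is_iso p (dens p :: (nat \<Rightarrow> 'a) set) (dens_act p (p - 1 - lam)) (fst (Vmod p lam)) (snd (Vmod p lam)) h"
    using dens_iso_Vmod[OF lam(2)] unfolding lam(1) by blast
  then show ?thesis using has_factors_iso[OF Vmod_W1mod[OF assms(1)] iso_inv[OF _ dens_mod] assms(2)] by blast
qed

lemma Vmod_0_factors: "has_factors p (snd (Vmod p 0)) [0, p - 1] (fst (Vmod p 0 :: 'a W1module))"
proof (rule Vmod_factors)
  have L: "snd (Lmodel (p - 1)) = dens_act p (p - 1)" using p2 by (simp add: Lmodel_def)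
  show "has_factors p (dens_act p (p - 1 - 0)) [0, p - 1] (dens p :: (nat \<Rightarrow> 'a) set)"
    using has_factors_extension[OF dens_mod hom_top_coeff image_top_coeff kernel_top_coeff
      simple_W1mod[OF Lmodel_simple] Lmodel_factors[of "p - 1", unfolded L] Lmodel_factors] p_pos by simp
qed (rule p_pos)

lemma Vmod_top_factors: "has_factors p (snd (Vmod p (p - 1))) [p - 1, 0] (fst (Vmod p (p - 1) :: 'a W1module))"
proof (rule Vmod_factors)
  have L: "snd (Lmodel 0) = dens_act p 0" by (simp add: Lmodel_def)
  show "has_factors p (dens_act p (p - 1 - (p - 1))) [p - 1, 0] (dens p :: (nat \<Rightarrow> 'a) set)"
    using has_factors_extension[OF dens_mod hom_dderiv image_dderiv kernel_dderiv
      simple_W1mod[OF Lmodel_simple] Lmodel_factors[of 0, unfolded L] Lmodel_factors] p_pos by simp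
qed (use p_pos in simp)

end

section \<open>The Hamiltonian algebra\<close>

lemma tmult_add_left: "tmult p n (f + g) h \<gamma> = tmult p n f h \<gamma> + tmult p n g h \<gamma>"
  unfolding tmult_def by (auto simp: sum.distrib[symmetric] distrib_right intro!: sum.cong)

lemma tmult_add_right: "tmult p n h (f + g) \<gamma> = tmult p n h f \<gamma> + tmult p n h g \<gamma>"
  unfolding tmult_def by (auto simp: sum.distrib[symmetric] distrib_left intro!: sum.cong)

lemma tmult_scale_left: "tmult p n (fscale c f) g \<gamma> = c * tmult p n f g \<gamma>"
  unfolding tmult_def by (auto simp: sum_distrib_left mult_ac intro!: sum.cong)

lemma tmult_scale_right: "tmult p n f (fscale c g) \<gamma> = c * tmult p n f g \<gamma>"
  unfolding tmult_def by (auto simp: sum_distrib_left mult_ac intro!: sum.cong)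

lemma tmult_commute: "tmult p n f g \<gamma> = tmult p n g f \<gamma>"
  unfolding tmult_def
  by (subst sum.swap) (auto simp: add.commute mult.commute intro!: sum.cong)

lemma tmult_0_left: "tmult p n 0 g \<gamma> = 0"
  and tmult_0_right: "tmult p n g 0 \<gamma> = 0"
  unfolding tmult_def by (auto intro!: sum.neutral)

lemma pd_add: "pd p n j (f + g) = pd p n j f + pd p n j g"
  by (auto simp: pd_def fun_eq_iff distrib_left)

lemma pd_scale: "pd p n j (fscale c f) = fscale c (pd p n j f)"
  by (auto simp: pd_def fun_eq_iff)

lemma pd_0: "pd p n j 0 = 0"
  by (auto simp: pd_def fun_eq_iff)

lemma dcomp_add: "dcomp (D + E) j = dcomp D j + dcomp E j"
  and dcomp_scale: "dcomp (fscale c D) j = fscale c (dcomp D j)"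
  and dcomp_0: "dcomp 0 j = 0"
  by (auto simp: dcomp_def fun_eq_iff)

lemma bracket_add_left: "bracket p n (D + E) F = bracket p n D F + bracket p n E F"
  by (auto simp: bracket_def fun_eq_iff der_apply_def dcomp_add tmult_add_left tmult_add_right pd_add sum.distrib)

lemma bracket_scale_left: "bracket p n (fscale c D) F = fscale c (bracket p n D F)"
  by (auto simp: bracket_def fun_eq_iff der_apply_def dcomp_scale tmult_scale_left tmult_scale_right pd_scale
      sum_distrib_left right_diff_distrib)

lemma bracket_0_left: "bracket p n 0 F = 0"
  by (auto simp: bracket_def fun_eq_iff der_apply_def dcomp_0 tmult_0_left tmult_0_right pd_0)

lemma fin_supp_vecs:
  assumes "finite I" "0 < p"
  shows "finite {\<alpha> :: mono. (\<forall>i. \<alpha> i < p) \<and> (\<forall>i. i \<notin> I \<longrightarrow> \<alpha> i = 0)}"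
    and "card {\<alpha> :: mono. (\<forall>i. \<alpha> i < p) \<and> (\<forall>i. i \<notin> I \<longrightarrow> \<alpha> i = 0)} = p ^ card I"
proof -
  let ?X = "{\<alpha> :: mono. (\<forall>i. \<alpha> i < p) \<and> (\<forall>i. i \<notin> I \<longrightarrow> \<alpha> i = 0)}"
  let ?P = "PiE I (\<lambda>_. {..<p})"
  have b: "bij_betw (\<lambda>\<alpha>. restrict \<alpha> I) ?X ?P"
  proof (rule bij_betw_byWitness[of _ "\<lambda>g i. if i \<in> I then g i else 0"])
    show "\<forall>\<alpha>\<in>?X. (\<lambda>i. if i \<in> I then restrict \<alpha> I i else 0) = \<alpha>"
      by (auto simp: fun_eq_iff)
    show "\<forall>g\<in>?P. restrict (\<lambda>i. if i \<in> I then g i else 0) I = g"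
      by (auto simp: fun_eq_iff restrict_def PiE_def extensional_def)
    show "(\<lambda>\<alpha>. restrict \<alpha> I) ` ?X \<subseteq> ?P" by auto
    show "(\<lambda>g i. if i \<in> I then g i else 0) ` ?P \<subseteq> ?X"
      using assms(2) by (auto simp: PiE_def Pi_def)
  qed
  have P: "finite ?P" "card ?P = p ^ card I"
    using assms by (auto simp: card_PiE intro: finite_PiE)
  show "finite ?X" "card ?X = p ^ card I"
    using bij_betw_finite[OF b] bij_betw_same_card[OF b] P by auto
qed

lemma finite_expvecs: "0 < p \<Longrightarrow> finite (expvecs p n)"
proof -
  assume p: "0 < p"
  have "expvecs p n = {\<alpha>. (\<forall>i. \<alpha> i < p) \<and> (\<forall>i. i \<notin> {1..n} \<longrightarrow> \<alpha> i = 0)}"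
    by (auto simp: expvecs_def not_le)
  then show ?thesis using fin_supp_vecs(1)[of "{1..n}" p] p by simp
qed

lemma expvecs_upd: "\<gamma> \<in> expvecs p n \<Longrightarrow> a < p \<Longrightarrow> 1 \<le> i \<Longrightarrow> i \<le> n \<Longrightarrow> \<gamma>(i := a) \<in> expvecs p n"
  by (auto simp: expvecs_def)

lemma expvecs_updD: "\<gamma>(i := a) \<in> expvecs p n \<Longrightarrow> a < p"
  by (auto simp: expvecs_def) (metis fun_upd_same)

lemma tmult_xmon:
  assumes p: "0 < p" and d: "\<delta> \<in> expvecs p n"
  shows "tmult p n (xmon \<delta>) g \<gamma> =
    (if \<gamma> \<in> expvecs p n \<and> (\<forall>i. \<delta> i \<le> \<gamma> i) then g (\<lambda>i. \<gamma> i - \<delta> i) else 0)"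
proof (cases "\<gamma> \<in> expvecs p n")
  case True
  note fin = finite_expvecs[OF p, of n]
  have "tmult p n (xmon \<delta>) g \<gamma> = (\<Sum>\<alpha>\<in>expvecs p n. if \<delta> = \<alpha> then
      (\<Sum>\<beta>\<in>expvecs p n. if (\<lambda>i. \<delta> i + \<beta> i) = \<gamma> then g \<beta> else 0) else 0)"
    using True unfolding tmult_def by (auto simp: xmon_def intro!: sum.cong sum.neutral)
  also have "\<dots> = (\<Sum>\<beta>\<in>expvecs p n. if (\<lambda>i. \<delta> i + \<beta> i) = \<gamma> then g \<beta> else 0)"
    using d fin by (simp add: sum.delta)
  also have "\<dots> = (if \<forall>i. \<delta> i \<le> \<gamma> i then g (\<lambda>i. \<gamma> i - \<delta> i) else 0)"
  proof (cases "\<forall>i. \<delta> i \<le> \<gamma> i")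
    case le: True
    have "(\<lambda>i. \<delta> i + \<beta> i) = \<gamma> \<longleftrightarrow> (\<lambda>i. \<gamma> i - \<delta> i) = \<beta>" for \<beta>
    proof -
      have "\<delta> i + \<beta> i = \<gamma> i \<longleftrightarrow> \<gamma> i - \<delta> i = \<beta> i" for i using le[rule_format, of i] by linarith
      then show ?thesis by (simp add: fun_eq_iff)
    qed
    moreover have "(\<lambda>i. \<gamma> i - \<delta> i) \<in> expvecs p n"
      using True by (auto simp: expvecs_def less_imp_diff_less)
    ultimately show ?thesis using le fin by (simp add: sum.delta)
  next
    case False
    then have "(\<lambda>i. \<delta> i + \<beta> i) \<noteq> \<gamma>" for \<beta> by (auto simp: fun_eq_iff) (metis le_add1)
    then show ?thesis using False by auto
  qed
  finally show ?thesis using True by simp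
next
  case False
  then show ?thesis by (simp add: tmult_def)
qed

lemma pd_xmon:
  assumes "\<delta> \<in> expvecs p n"
  shows "pd p n l (xmon \<delta>) = fscale (of_nat (\<delta> l)) (xmon (\<delta>(l := \<delta> l - 1)))"
proof
  fix \<alpha>
  have "\<alpha>(l := Suc (\<alpha> l)) = \<delta> \<longleftrightarrow> \<alpha> = \<delta>(l := \<delta> l - 1) \<and> 0 < \<delta> l"
    by (auto simp: fun_eq_iff split: if_splits)
  moreover have "\<delta>(l := \<delta> l - 1) \<in> expvecs p n"
    using assms by (auto simp: expvecs_def less_imp_diff_less)
  ultimately show "pd p n l (xmon \<delta>) \<alpha> = fscale (of_nat (\<delta> l)) (xmon (\<delta>(l := \<delta> l - 1))) \<alpha>"
    using assms by (auto simp: pd_def xmon_def)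
qed

text \<open>If raising the exponent leaves the range, \<open>f\<close> is 0 there, so a single
  formula covers the boundary.\<close>

lemma pd_Alg:
  assumes "f \<in> Alg p n"
  shows "pd p n j f \<alpha> = (if \<alpha> \<in> expvecs p n then of_nat (Suc (\<alpha> j)) * f (\<alpha>(j := Suc (\<alpha> j))) else 0)"
  using assms by (auto simp: pd_def Alg_def)

lemma pd_in_Alg: "pd p n j f \<in> Alg p n"
  by (auto simp: pd_def Alg_def)

lemma DH_apply:
  assumes j: "1 \<le> j" "j \<le> 2 * r"
  shows "DH p r f (j, \<alpha>) = (if j \<le> r then - pd p (2 * r) (j + r) f \<alpha> else pd p (2 * r) (j - r) f \<alpha>)"
proof -
  have "iprime r i = j \<longleftrightarrow> i = iprime r j" if "i \<in> {1..2 * r}" for i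
    using that j by (auto simp: iprime_def)
  then have "DH p r f (j, \<alpha>) = (\<Sum>i\<in>{1..2 * r}. if iprime r j = i then of_int (sigma r i) * pd p (2 * r) i f \<alpha> else 0)"
    unfolding DH_def prod.case by (intro sum.cong) auto
  also have "\<dots> = of_int (sigma r (iprime r j)) * pd p (2 * r) (iprime r j) f \<alpha>"
    using j by (subst sum.delta') (auto simp: iprime_def)
  finally show ?thesis using j by (auto simp: iprime_def sigma_def)
qed

lemma DH_out:
  assumes "j \<notin> {1..2 * r}"
  shows "DH p r f (j, \<alpha>) = 0"
proof -
  have "iprime r i \<noteq> j" if "i \<in> {1..2 * r}" for i
    using that assms by (auto simp: iprime_def)
  then show ?thesis unfolding DH_def by (auto intro!: sum.neutral)
qed

lemma DH_add: "DH p r (f + g) = DH p r f + DH p r g"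
  by (auto simp: DH_def pd_add fun_eq_iff sum.distrib[symmetric] distrib_left intro!: sum.cong)

lemma DH_scale: "DH p r (fscale c f) = fscale c (DH p r f)"
  by (auto simp: DH_def pd_scale fun_eq_iff sum_distrib_left intro!: sum.cong)

lemma DH_0: "DH p r 0 = 0"
  by (auto simp: DH_def pd_0 fun_eq_iff intro!: sum.neutral)

text \<open>Partial derivatives only read coefficients at exponents that were raised by one, never
  the constant term.\<close>

lemma DH_const:
  assumes "\<And>\<alpha>. \<alpha> \<noteq> (\<lambda>_. 0) \<Longrightarrow> f \<alpha> = g \<alpha>"
  shows "DH p r f = DH p r g"
proof -
  have "\<alpha>(j := Suc (\<alpha> j)) \<noteq> (\<lambda>_. 0)" for \<alpha> :: mono and j
    by (metis fun_upd_same nat.distinct(1))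
  then have "pd p (2 * r) j f = pd p (2 * r) j g" for j
    using assms by (auto simp: pd_def fun_eq_iff)
  then show ?thesis by (simp only: DH_def)
qed

section \<open>The derivations \<open>theta\<close> and their bracket with D_H(f)\<close>

definition xy :: "nat \<Rightarrow> nat \<Rightarrow> mono" where
  "xy r i = (\<lambda>k. if k = 1 then i else if k = r + 1 then 1 else 0)"

definition theta :: "nat \<Rightarrow> nat \<Rightarrow> nat \<Rightarrow> nat \<times> mono \<Rightarrow> 'a::field" where
  "theta p r i = - DH p r (xmon (xy r i))"

lemma thetaH_theta: "thetaH p r D = (\<Sum>i<p. fscale (D (1, xpow1 i)) (theta p r i))"
  by (simp only: thetaH_def theta_def xy_def)

context
  fixes p r :: nat
  assumes prime: "prime p" and p2: "2 < p" and char: "CHAR('a::field) = p" and r: "1 \<le> r"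
begin

lemma xy_in: "i < p \<Longrightarrow> xy r i \<in> expvecs p (2 * r)"
  using p2 r by (auto simp: xy_def expvecs_def)

lemma xpow1_in: "i < p \<Longrightarrow> xpow1 i \<in> expvecs p (2 * r)"
  using p2 r by (auto simp: xpow1_def expvecs_def)

lemma dcomp_theta:
  assumes i: "i < p"
  shows "dcomp (theta p r i) 1 = (xmon (xpow1 i) :: mono \<Rightarrow> 'a)"
    and "dcomp (theta p r i) (r + 1) = fscale (- of_nat i) (xmon (xy r (i - 1)) :: mono \<Rightarrow> 'a)"
    and "j \<noteq> 1 \<Longrightarrow> j \<noteq> r + 1 \<Longrightarrow> dcomp (theta p r i) j = (0 :: mono \<Rightarrow> 'a)"
proof -
  have u1: "(xy r i)(r + 1 := 0) = xpow1 i" using r by (auto simp: xy_def xpow1_def fun_eq_iff)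
  have u2: "(xy r i)(1 := i - 1) = xy r (i - 1)" by (auto simp: xy_def fun_eq_iff)
  have v: "xy r i (r + 1) = 1" "xy r i 1 = i" using r by (auto simp: xy_def)
  note pdx = pd_xmon[OF xy_in[OF i]]
  have pd1: "pd p (2 * r) (r + 1) (xmon (xy r i)) = (xmon (xpow1 i) :: mono \<Rightarrow> 'a)"
    by (simp only: pdx v u1 diff_self_eq_0 of_nat_1 fscale.scale_one)
  have pd2: "pd p (2 * r) 1 (xmon (xy r i)) = fscale (of_nat i) (xmon (xy r (i - 1)) :: mono \<Rightarrow> 'a)"
    by (simp only: pdx v u2)
  show "dcomp (theta p r i) 1 = (xmon (xpow1 i) :: mono \<Rightarrow> 'a)"
    using r pd1 DH_apply[of 1 r p "xmon (xy r i) :: mono \<Rightarrow> 'a"] by (simp add: dcomp_def theta_def fun_eq_iff add.commute)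
  show "dcomp (theta p r i) (r + 1) = fscale (- of_nat i) (xmon (xy r (i - 1)) :: mono \<Rightarrow> 'a)"
    using r pd2 DH_apply[of "r + 1" r p "xmon (xy r i) :: mono \<Rightarrow> 'a"] by (simp add: dcomp_def theta_def fun_eq_iff)
  show "dcomp (theta p r i) j = (0 :: mono \<Rightarrow> 'a)" if j: "j \<noteq> 1" "j \<noteq> r + 1"
  proof (cases "j \<in> {1..2 * r}")
    case True
    define l where "l = (if j \<le> r then j + r else j - r)"
    have "l \<noteq> 1" "l \<noteq> r + 1" using j True by (auto simp: l_def)
    then have "xy r i l = 0" by (simp add: xy_def)
    then have "pd p (2 * r) l (xmon (xy r i) :: mono \<Rightarrow> 'a) = 0" using pdx[of l] by simp
    then show ?thesis using True DH_apply[of j r p "xmon (xy r i) :: mono \<Rightarrow> 'a"]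
      by (auto simp: dcomp_def theta_def fun_eq_iff l_def split: if_splits)
  next
    case False
    then show ?thesis using DH_out[OF False, of p "xmon (xy r i) :: mono \<Rightarrow> 'a"] by (auto simp: dcomp_def theta_def fun_eq_iff)
  qed
qed

lemma sum_two:
  assumes "\<And>j. j \<in> {1..2 * r} \<Longrightarrow> j \<noteq> 1 \<Longrightarrow> j \<noteq> r + 1 \<Longrightarrow> h j = (0 :: 'a)"
  shows "(\<Sum>j\<in>{1..2 * r}. h j) = h 1 + h (r + 1)"
proof -
  have "sum h {1..2 * r} = sum h {1, r + 1}"
    using assms r by (intro sum.mono_neutral_right) auto
  also have "\<dots> = h 1 + h (r + 1)" using r by simp
  finally show ?thesis .
qed

lemma tmult_x:
  assumes "i < p"
  shows "tmult p (2 * r) (xmon (xpow1 i)) g \<gamma> =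
    (if \<gamma> \<in> expvecs p (2 * r) \<and> i \<le> \<gamma> 1 then g (\<gamma>(1 := \<gamma> 1 - i)) else 0)"
proof -
  have "(\<forall>k. xpow1 i k \<le> \<gamma> k) \<longleftrightarrow> i \<le> \<gamma> 1" by (auto simp: xpow1_def)
  moreover have "(\<lambda>k. \<gamma> k - xpow1 i k) = \<gamma>(1 := \<gamma> 1 - i)" by (auto simp: xpow1_def fun_eq_iff)
  ultimately show ?thesis using tmult_xmon[OF _ xpow1_in[OF assms], of g \<gamma>] p2 by simp
qed

lemma tmult_xy:
  assumes "i < p"
  shows "tmult p (2 * r) (xmon (xy r i)) g \<gamma> =
    (if \<gamma> \<in> expvecs p (2 * r) \<and> i \<le> \<gamma> 1 \<and> 1 \<le> \<gamma> (r + 1)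
     then g (\<gamma>(1 := \<gamma> 1 - i, r + 1 := \<gamma> (r + 1) - 1)) else 0)"
proof -
  have "(\<forall>k. xy r i k \<le> \<gamma> k) \<longleftrightarrow> i \<le> \<gamma> 1 \<and> 1 \<le> \<gamma> (r + 1)" using r by (auto simp: xy_def)
  moreover have "(\<lambda>k. \<gamma> k - xy r i k) = \<gamma>(1 := \<gamma> 1 - i, r + 1 := \<gamma> (r + 1) - 1)"
    using r by (auto simp: xy_def fun_eq_iff)
  ultimately show ?thesis using tmult_xmon[OF _ xy_in[OF assms], of g \<gamma>] p2 by simp
qed

text \<open>The action of Theta_H(D) on A(2r), written slice by slice: with all exponents but that
  of x_1 frozen, a polynomial in x_1 remains, on which D acts as on T_k with k the exponent of
  x_(r+1).\<close>

definition hact :: "'a W1elem \<Rightarrow> (mono \<Rightarrow> 'a) \<Rightarrow> mono \<Rightarrow> 'a" where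
  "hact D f = (\<lambda>\<gamma>. if \<gamma> \<in> expvecs p (2 * r) then dens_act p (\<gamma> (r + 1)) D (\<lambda>a. f (\<gamma>(1 := a))) (\<gamma> 1) else 0)"

lemma hact_in_Alg: "hact D f \<in> Alg p (2 * r)"
  by (simp add: hact_def Alg_def)

lemma hact_ew:
  "hact (ew i) f \<gamma> = (if \<gamma> \<in> expvecs p (2 * r) \<and> i \<le> Suc (\<gamma> 1) then
    (of_nat (Suc (\<gamma> 1) - i) - of_nat i * of_nat (\<gamma> (r + 1))) * f (\<gamma>(1 := Suc (\<gamma> 1) - i)) else 0)"
  unfolding hact_def dens_act_ew by (auto simp: expvecs_def)

text \<open>In x^i d_1 - i x^(i-1) y d_y, with y = x_(r+1), the second summand multiplies by the
  y-exponent, which is the density weight in \<open>hact\<close>.\<close>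

lemma der_apply_theta:
  fixes g :: "mono \<Rightarrow> 'a"
  assumes i: "i < p" and g: "g \<in> Alg p (2 * r)"
  shows "der_apply p (2 * r) (theta p r i) g \<gamma> = hact (ew i) g (\<gamma> :: mono)"
proof (cases "\<gamma> \<in> expvecs p (2 * r)")
  case True
  have d: "der_apply p (2 * r) (theta p r i) g \<gamma> =
     tmult p (2 * r) (xmon (xpow1 i)) (pd p (2 * r) 1 g) \<gamma> -
     of_nat i * tmult p (2 * r) (xmon (xy r (i - 1))) (pd p (2 * r) (r + 1) g) \<gamma>"
  proof -
    have z: "tmult p (2 * r) (dcomp (theta p r i) j) (pd p (2 * r) j g) \<gamma> = 0"
      if "j \<in> {1..2 * r}" "j \<noteq> 1" "j \<noteq> r + 1" for j
      by (simp only: dcomp_theta(3)[OF i that(2,3)] tmult_0_left)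
    have "der_apply p (2 * r) (theta p r i) g \<gamma> =
        tmult p (2 * r) (dcomp (theta p r i) 1) (pd p (2 * r) 1 g) \<gamma> +
        tmult p (2 * r) (dcomp (theta p r i) (r + 1)) (pd p (2 * r) (r + 1) g) \<gamma>"
      unfolding der_apply_def by (rule sum_two) (rule z)
    then show ?thesis unfolding dcomp_theta(1,2)[OF i] tmult_scale_left by simp
  qed
  have 1: "pd p (2 * r) 1 g (\<gamma>(1 := \<gamma> 1 - i)) = of_nat (Suc (\<gamma> 1) - i) * g (\<gamma>(1 := Suc (\<gamma> 1) - i))" if "i \<le> \<gamma> 1"
  proof -
    have "\<gamma>(1 := \<gamma> 1 - i) \<in> expvecs p (2 * r)"
      using True by (auto simp: expvecs_def less_imp_diff_less)
    then show ?thesis using that by (simp add: pd_Alg[OF g] Suc_diff_le)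
  qed
  have 2: "pd p (2 * r) (r + 1) g (\<gamma>(1 := \<gamma> 1 - (i - 1), r + 1 := \<gamma> (r + 1) - 1)) =
      of_nat (\<gamma> (r + 1)) * g (\<gamma>(1 := \<gamma> 1 - (i - 1)))" if "1 \<le> \<gamma> (r + 1)"
  proof -
    have "\<gamma>(1 := \<gamma> 1 - (i - 1), r + 1 := \<gamma> (r + 1) - 1) \<in> expvecs p (2 * r)"
      using True by (auto simp: expvecs_def less_imp_diff_less)
    moreover have "(\<gamma>(1 := \<gamma> 1 - (i - 1), r + 1 := \<gamma> (r + 1) - 1))(r + 1 := \<gamma> (r + 1)) = \<gamma>(1 := \<gamma> 1 - (i - 1))"
      using r by (auto simp: fun_eq_iff)
    ultimately show ?thesis using that by (simp add: pd_Alg[OF g])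
  qed
  have t1: "tmult p (2 * r) (xmon (xpow1 i)) (pd p (2 * r) 1 g) \<gamma> =
      (if i \<le> Suc (\<gamma> 1) then of_nat (Suc (\<gamma> 1) - i) * g (\<gamma>(1 := Suc (\<gamma> 1) - i)) else 0)"
    using 1 True by (auto simp: tmult_x[OF i] le_Suc_eq simp del: One_nat_def)
  have t2: "of_nat i * tmult p (2 * r) (xmon (xy r (i - 1))) (pd p (2 * r) (r + 1) g) \<gamma> =
      (if i \<le> Suc (\<gamma> 1) then of_nat i * of_nat (\<gamma> (r + 1)) * g (\<gamma>(1 := Suc (\<gamma> 1) - i)) else 0)"
  proof (cases i)
    case (Suc i')
    then have "i - 1 < p" "i - 1 \<le> \<gamma> 1 \<longleftrightarrow> i \<le> Suc (\<gamma> 1)" "\<gamma> 1 - (i - 1) = Suc (\<gamma> 1) - i" using i by auto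
    then show ?thesis using 2 True by (auto simp: tmult_xy not_less_eq_eq simp del: One_nat_def)
  qed simp
  show ?thesis
    unfolding d t1 t2 hact_ew using True by (simp add: left_diff_distrib)
next
  case False
  then show ?thesis by (simp add: der_apply_def tmult_def hact_def)
qed

lemma expvecs_lt: "\<gamma> \<in> expvecs p n \<Longrightarrow> \<gamma> i < p"
  by (simp add: expvecs_def)

lemma pd_Alg_upd:
  fixes f :: "mono \<Rightarrow> 'a"
  assumes f: "f \<in> Alg p (2 * r)" and g: "\<gamma> \<in> expvecs p (2 * r)"
  shows "pd p (2 * r) l f (\<gamma>(1 := b)) = of_nat (Suc ((\<gamma>(1 := b)) l)) * f ((\<gamma>(1 := b))(l := Suc ((\<gamma>(1 := b)) l)))"
proof (cases "b < p")
  case True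
  then have "\<gamma>(1 := b) \<in> expvecs p (2 * r)" using g r by (intro expvecs_upd) auto
  then show ?thesis by (simp add: pd_Alg[OF f])
next
  case False
  have "\<not> (\<gamma>(1 := b)) 1 < p" "\<not> ((\<gamma>(1 := b))(l := Suc ((\<gamma>(1 := b)) l))) 1 < p" using False by auto
  then have "\<gamma>(1 := b) \<notin> expvecs p (2 * r)" "(\<gamma>(1 := b))(l := Suc ((\<gamma>(1 := b)) l)) \<notin> expvecs p (2 * r)"
    using expvecs_lt by blast+
  then show ?thesis using f by (simp add: pd_Alg[OF f] Alg_def)
qed

lemma hact_ew_upd:
  fixes f :: "mono \<Rightarrow> 'a"
  assumes f: "f \<in> Alg p (2 * r)" and g: "\<gamma> \<in> expvecs p (2 * r)" and l: "l \<noteq> 1" "1 \<le> l" "l \<le> 2 * r"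
  shows "hact (ew i) f (\<gamma>(l := m)) = (if i \<le> Suc (\<gamma> 1) then
    (of_nat (Suc (\<gamma> 1) - i) - of_nat i * of_nat ((\<gamma>(l := m)) (r + 1))) * f (\<gamma>(l := m, 1 := Suc (\<gamma> 1) - i)) else 0)"
proof (cases "m < p")
  case True
  then have "\<gamma>(l := m) \<in> expvecs p (2 * r)" using g l by (intro expvecs_upd) auto
  then show ?thesis using l by (simp add: hact_ew)
next
  case False
  have "\<not> (\<gamma>(l := m)) l < p" "\<not> (\<gamma>(l := m, 1 := Suc (\<gamma> 1) - i)) l < p" using False l by auto
  then have "\<gamma>(l := m) \<notin> expvecs p (2 * r)" "\<gamma>(l := m, 1 := Suc (\<gamma> 1) - i) \<notin> expvecs p (2 * r)"
    using expvecs_lt by blast+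
  then show ?thesis using f by (simp add: hact_ew Alg_def)
qed

text \<open>At x-exponent p-1 the left side is cut off by truncation and the right side vanishes
  through its factor p.\<close>

lemma pd_hact_x:
  fixes f :: "mono \<Rightarrow> 'a"
  assumes g: "\<gamma> \<in> expvecs p (2 * r)"
  shows "pd p (2 * r) 1 (hact (ew i) f) \<gamma> = (if i \<le> Suc (Suc (\<gamma> 1)) then of_nat (Suc (\<gamma> 1)) *
    ((of_nat (Suc (Suc (\<gamma> 1)) - i) - of_nat i * of_nat (\<gamma> (r + 1))) * f (\<gamma>(1 := Suc (Suc (\<gamma> 1)) - i))) else 0)"
proof (cases "Suc (\<gamma> 1) < p")
  case True
  then have "\<gamma>(1 := Suc (\<gamma> 1)) \<in> expvecs p (2 * r)" using g r by (intro expvecs_upd) auto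
  then show ?thesis using g r by (simp add: pd_Alg[OF hact_in_Alg] hact_ew del: of_nat_Suc)
next
  case False
  then have "Suc (\<gamma> 1) = p" using expvecs_lt[OF g, of 1] by linarith
  then have 0: "of_nat (Suc (\<gamma> 1)) = (0 :: 'a)" using of_nat_p[OF prime p2 char] by simp
  then show ?thesis using g by (simp add: pd_Alg[OF hact_in_Alg] del: of_nat_Suc)
qed

text \<open>Differentiation in a variable other than x_1 only changes the density weight, raising it
  by one when l = r+1; that shift is what the bracket has to compensate.\<close>

lemma pd_hact:
  fixes f :: "mono \<Rightarrow> 'a"
  assumes f: "f \<in> Alg p (2 * r)" and g: "\<gamma> \<in> expvecs p (2 * r)" and l: "l \<noteq> 1" "1 \<le> l" "l \<le> 2 * r"
  shows "pd p (2 * r) l (hact (ew i) f) \<gamma> = (if i \<le> Suc (\<gamma> 1) then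
    (of_nat (Suc (\<gamma> 1) - i) - of_nat i * of_nat ((\<gamma>(l := Suc (\<gamma> l))) (r + 1))) *
      pd p (2 * r) l f (\<gamma>(1 := Suc (\<gamma> 1) - i)) else 0)"
proof -
  have "(\<gamma>(1 := Suc (\<gamma> 1) - i))(l := Suc ((\<gamma>(1 := Suc (\<gamma> 1) - i)) l)) = \<gamma>(l := Suc (\<gamma> l), 1 := Suc (\<gamma> 1) - i)"
    using l by (auto simp: fun_eq_iff)
  then have 1: "pd p (2 * r) l f (\<gamma>(1 := Suc (\<gamma> 1) - i)) = of_nat (Suc (\<gamma> l)) * f (\<gamma>(l := Suc (\<gamma> l), 1 := Suc (\<gamma> 1) - i))"
    unfolding pd_Alg_upd[OF f g] using l by simp
  have 2: "pd p (2 * r) l (hact (ew i) f) \<gamma> = of_nat (Suc (\<gamma> l)) * hact (ew i) f (\<gamma>(l := Suc (\<gamma> l)))"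
    using g by (simp add: pd_Alg[OF hact_in_Alg])
  show ?thesis unfolding 1 2 hact_ew_upd[OF f g l] by (simp only: mult.left_commute split: if_split) simp
qed

text \<open>The index j' of the statement. It is used with D_H(f) sorted by components: the
  coefficient of d_j is \<sigma>(j') d_j'(f), whose sign is \<open>dsgn j\<close>.\<close>

definition dual :: "nat \<Rightarrow> nat" where
  "dual j = (if j \<le> r then j + r else j - r)"

definition dsgn :: "nat \<Rightarrow> 'a" where
  "dsgn j = (if j \<le> r then - 1 else 1)"

lemma dcomp_DH:
  assumes "j \<in> {1..2 * r}"
  shows "dcomp (DH p r f) j = fscale (dsgn j) (pd p (2 * r) (dual j) f)"
  using assms DH_apply[of j r p f] by (auto simp: dcomp_def fun_eq_iff dsgn_def dual_def)

text \<open>An instance of [D_H(g), D_H(f)] = D_H(D_H(g) f), checked componentwise. D_H(f) acts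
  nontrivially only on the components 1 and r+1 of \<open>theta\<close>; for all other j it suffices
  that Theta_H(x^i d) commutes with the derivative in question.\<close>

lemma bracket_theta:
  fixes f :: "mono \<Rightarrow> 'a"
  assumes i: "i < p" and f: "f \<in> Alg p (2 * r)"
  shows "bracket p (2 * r) (theta p r i) (DH p r f) = DH p r (hact (ew i) f)"
proof
  fix x :: "nat \<times> mono"
  obtain j \<gamma> where x: "x = (j, \<gamma>)" by (cases x)
  let ?n = "2 * r" and ?E = "DH p r f"
  have br: "bracket p ?n (theta p r i) ?E (j, \<gamma>) =
    der_apply p ?n (theta p r i) (dcomp ?E j) \<gamma> - der_apply p ?n ?E (dcomp (theta p r i) j) \<gamma>"
    by (simp add: bracket_def)
  have der0: "der_apply p ?n D 0 \<gamma> = 0" for D :: "nat \<times> mono \<Rightarrow> 'a"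
    by (simp add: der_apply_def pd_0 tmult_0_right)
  consider "j \<notin> {1..?n}" | "\<gamma> \<notin> expvecs p ?n" "j \<in> {1..?n}" | "\<gamma> \<in> expvecs p ?n" "j \<in> {1..?n}" by blast
  then have "bracket p ?n (theta p r i) ?E (j, \<gamma>) = DH p r (hact (ew i) f) (j, \<gamma>)"
  proof cases
    case 1
    have "dcomp ?E j = 0" using DH_out[OF 1] by (auto simp: dcomp_def fun_eq_iff)
    moreover have "j \<noteq> 1" "j \<noteq> r + 1" using 1 r by auto
    note dcomp_theta(3)[OF i this]
    ultimately show ?thesis unfolding br DH_out[OF 1] by (simp only: der0 diff_self)
  next
    case 2
    then show ?thesis using dcomp_DH[OF 2(2), of "hact (ew i) f"]
      unfolding br by (simp add: der_apply_def tmult_def dcomp_def fun_eq_iff pd_def)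
  next
    case 3
    note g = 3(1)
    let ?a = "\<gamma> 1" and ?k = "\<gamma> (r + 1)"
    have T1: "der_apply p ?n (theta p r i) (dcomp ?E j) \<gamma> = (if i \<le> Suc ?a then
        (of_nat (Suc ?a - i) - of_nat i * of_nat ?k) * (dsgn j * pd p ?n (dual j) f (\<gamma>(1 := Suc ?a - i))) else 0)"
    proof -
      have "dcomp ?E j \<in> Alg p ?n" unfolding dcomp_DH[OF 3(2)]
        using pd_in_Alg[of p ?n "dual j" f] by (simp add: Alg_def)
      then show ?thesis using g by (simp add: der_apply_theta[OF i] hact_ew dcomp_DH[OF 3(2)])
    qed
    have R: "DH p r (hact (ew i) f) (j, \<gamma>) = dsgn j * pd p ?n (dual j) (hact (ew i) f) \<gamma>"
      using fun_cong[OF dcomp_DH[OF 3(2), of "hact (ew i) f"], of \<gamma>] by (simp add: dcomp_def)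
    have E1: "dcomp ?E 1 = fscale (- 1) (pd p ?n (r + 1) f)"
      using dcomp_DH[of 1 f] r by (simp add: dsgn_def dual_def add.commute)
    have Er: "dcomp ?E (r + 1) = pd p ?n 1 f"
      using dcomp_DH[of "r + 1" f] r by (simp add: dsgn_def dual_def)
    consider "j = 1" | "j = r + 1" | "j \<noteq> 1" "j \<noteq> r + 1" by blast
    then show ?thesis
    proof cases
      case 1
      have d: "dual j = r + 1" "dsgn j = - 1" using 1 r by (auto simp: dual_def dsgn_def)
      have z: "pd p ?n l (xmon (xpow1 i)) = (0 :: mono \<Rightarrow> 'a)" if "l \<noteq> 1" for l
        using that by (simp only: pd_xmon[OF xpow1_in[OF i]]) (simp add: xpow1_def)
      have x1: "pd p ?n 1 (xmon (xpow1 i)) = fscale (of_nat i) (xmon (xpow1 (i - 1)) :: mono \<Rightarrow> 'a)"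
      proof -
        have "(xpow1 i)(1 := xpow1 i 1 - 1) = xpow1 (i - 1)" "xpow1 i 1 = i" by (auto simp: xpow1_def fun_eq_iff)
        then show ?thesis by (simp only: pd_xmon[OF xpow1_in[OF i]])
      qed
      \<comment> \<open>D_H(f) applied to x^i is -i x^(i-1) d_y f. Subtracting it turns weight k
        into k+1, as needed for the y-derivative of \<open>hact\<close>.\<close>
      have "der_apply p ?n ?E (dcomp (theta p r i) j) \<gamma> =
          tmult p ?n (dcomp ?E 1) (pd p ?n 1 (xmon (xpow1 i))) \<gamma> + tmult p ?n (dcomp ?E (r + 1)) (pd p ?n (r + 1) (xmon (xpow1 i))) \<gamma>"
        unfolding der_apply_def 1 dcomp_theta(1)[OF i] by (rule sum_two) (subst z, assumption, rule tmult_0_right)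
      also have "\<dots> = - (of_nat i * tmult p ?n (xmon (xpow1 (i - 1))) (pd p ?n (r + 1) f) \<gamma>)"
      proof -
        have "r + 1 \<noteq> 1" using r by simp
        then show ?thesis unfolding x1 E1 z[OF \<open>r + 1 \<noteq> 1\<close>] tmult_0_right tmult_scale_left tmult_scale_right
          by (simp add: tmult_commute[of p ?n "xmon _"])
      qed
      also have "of_nat i * tmult p ?n (xmon (xpow1 (i - 1))) (pd p ?n (r + 1) f) \<gamma> =
          (if i \<le> Suc ?a then of_nat i * pd p ?n (r + 1) f (\<gamma>(1 := Suc ?a - i)) else 0)"
      proof (cases i)
        case (Suc i')
        then have "i - 1 < p" "i - 1 \<le> ?a \<longleftrightarrow> i \<le> Suc ?a" "?a - (i - 1) = Suc ?a - i" using i by auto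
        then show ?thesis using g by (simp add: tmult_x del: One_nat_def)
      qed simp
      finally have T2: "der_apply p ?n ?E (dcomp (theta p r i) j) \<gamma> = - \<dots>" .
      have "r + 1 \<noteq> 1" "1 \<le> r + 1" "r + 1 \<le> 2 * r" using r by auto
      note P = pd_hact[OF f g this]
      show ?thesis unfolding br T1 T2 R d P by (simp add: algebra_simps)
    next
      case 2
      have d: "dual j = 1" "dsgn j = 1" using 2 r by (auto simp: dual_def dsgn_def)
      \<comment> \<open>For small i the truncated exponents i-1 and i-2 are harmless: they come with
        the coefficients i and i(i-1).\<close>
      have i1: "i - 1 < p" "i - 2 < p" using i by auto
      note pdx = pd_xmon[OF xy_in[OF i1(1)]]
      have v: "xy r (i - 1) 1 = i - 1" "xy r (i - 1) (r + 1) = 1" using r by (auto simp: xy_def)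
      have u: "(xy r (i - 1))(1 := i - 1 - 1) = xy r (i - 2)" "(xy r (i - 1))(r + 1 := 1 - 1) = xpow1 (i - 1)"
        using r by (auto simp: xy_def xpow1_def fun_eq_iff)
      have x1: "pd p ?n 1 (xmon (xy r (i - 1))) = fscale (of_nat (i - 1)) (xmon (xy r (i - 2)) :: mono \<Rightarrow> 'a)"
        unfolding pdx v u ..
      have x2: "pd p ?n (r + 1) (xmon (xy r (i - 1))) = (xmon (xpow1 (i - 1)) :: mono \<Rightarrow> 'a)"
        unfolding pdx v u by simp
      have z: "pd p ?n l (xmon (xy r (i - 1))) = (0 :: mono \<Rightarrow> 'a)" if "l \<noteq> 1" "l \<noteq> r + 1" for l
      proof -
        have "xy r (i - 1) l = 0" using that by (simp add: xy_def)
        then show ?thesis unfolding pdx by simp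
      qed
      \<comment> \<open>The component is -i x^(i-1) y. Its x- and y-derivatives supply the terms
        with u'' and u' that appear when u f' - k u' f is differentiated in x.\<close>
      have "der_apply p ?n ?E (dcomp (theta p r i) j) \<gamma> =
          tmult p ?n (dcomp ?E 1) (pd p ?n 1 (dcomp (theta p r i) (r + 1))) \<gamma> +
          tmult p ?n (dcomp ?E (r + 1)) (pd p ?n (r + 1) (dcomp (theta p r i) (r + 1))) \<gamma>"
        unfolding der_apply_def 2
      proof (rule sum_two)
        fix l assume l: "l \<noteq> 1" "l \<noteq> r + 1"
        show "tmult p ?n (dcomp ?E l) (pd p ?n l (dcomp (theta p r i) (r + 1))) \<gamma> = 0"
          unfolding dcomp_theta(2)[OF i] pd_scale tmult_scale_right by (simp only: z[OF l] tmult_0_right mult_zero_right)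
      qed
      also have "\<dots> = of_nat i * of_nat (i - 1) * tmult p ?n (xmon (xy r (i - 2))) (pd p ?n (r + 1) f) \<gamma>
          - of_nat i * tmult p ?n (xmon (xpow1 (i - 1))) (pd p ?n 1 f) \<gamma>"
        unfolding dcomp_theta(2)[OF i] pd_scale x1 x2 E1 Er tmult_scale_left tmult_scale_right
          tmult_commute[of p ?n "xmon _"] by (simp add: algebra_simps)
      also have "of_nat i * of_nat (i - 1) * tmult p ?n (xmon (xy r (i - 2))) (pd p ?n (r + 1) f) \<gamma> =
          (if i \<le> Suc (Suc ?a) then of_nat i * of_nat (i - 1) * of_nat ?k * f (\<gamma>(1 := Suc (Suc ?a) - i)) else 0)"
      proof (cases "2 \<le> i")
        case True
        have "pd p ?n (r + 1) f (\<gamma>(1 := ?a - (i - 2), r + 1 := ?k - 1)) = of_nat ?k * f (\<gamma>(1 := ?a - (i - 2)))" if "1 \<le> ?k"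
        proof -
          have "\<gamma>(1 := ?a - (i - 2), r + 1 := ?k - 1) \<in> expvecs p ?n"
            using g by (auto simp: expvecs_def less_imp_diff_less)
          moreover have "(\<gamma>(1 := ?a - (i - 2), r + 1 := ?k - 1))(r + 1 := ?k) = \<gamma>(1 := ?a - (i - 2))"
            using r by (auto simp: fun_eq_iff)
          ultimately show ?thesis using that by (simp add: pd_Alg[OF f])
        qed
        moreover have "i - 2 \<le> ?a \<longleftrightarrow> i \<le> Suc (Suc ?a)" "i - 2 \<le> ?a \<Longrightarrow> ?a - (i - 2) = Suc (Suc ?a) - i" using True by auto
        ultimately show ?thesis using g by (auto simp: tmult_xy[OF i1(2)] not_less_eq_eq simp del: One_nat_def)
      next
        case False
        then have "i = 0 \<or> i = 1" by linarith
        then show ?thesis by auto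
      qed
      also have "of_nat i * tmult p ?n (xmon (xpow1 (i - 1))) (pd p ?n 1 f) \<gamma> =
          (if i \<le> Suc ?a then of_nat i * of_nat (Suc (Suc ?a) - i) * f (\<gamma>(1 := Suc (Suc ?a) - i)) else 0)"
      proof (cases i)
        case (Suc i')
        then have "i - 1 \<le> ?a \<longleftrightarrow> i \<le> Suc ?a" "?a - (i - 1) = Suc ?a - i"
          "i \<le> Suc ?a \<Longrightarrow> Suc (Suc ?a - i) = Suc (Suc ?a) - i" by auto
        then show ?thesis using g by (simp add: tmult_x[OF i1(1)] pd_Alg_upd[OF f g] del: One_nat_def of_nat_Suc)
      qed simp
      finally have T2: "der_apply p ?n ?E (dcomp (theta p r i) j) \<gamma> =
          (if i \<le> Suc (Suc ?a) then of_nat i * of_nat (i - 1) * of_nat ?k * f (\<gamma>(1 := Suc (Suc ?a) - i)) else 0) -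
          (if i \<le> Suc ?a then of_nat i * of_nat (Suc (Suc ?a) - i) * f (\<gamma>(1 := Suc (Suc ?a) - i)) else 0)" .
      let ?F = "f (\<gamma>(1 := Suc (Suc ?a) - i))"
      have T1': "der_apply p ?n (theta p r i) (dcomp ?E j) \<gamma> = (if i \<le> Suc ?a then
          (of_nat (Suc ?a - i) - of_nat i * of_nat ?k) * (of_nat (Suc (Suc ?a) - i) * ?F) else 0)"
        unfolding T1 d pd_Alg_upd[OF f g] by (simp add: Suc_diff_le del: of_nat_Suc)
      show ?thesis
        unfolding br T1' T2 R d pd_hact_x[OF g]
      proof -
        \<comment> \<open>For i = a+2 only the term with i(i-1) remains on the left, matching the
          right side at exponent 0; for larger i everything is out of range.\<close>
        consider "i \<le> Suc ?a" | "i = Suc (Suc ?a)" | "Suc (Suc ?a) < i" by linarith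
        then show "(if i \<le> Suc ?a then (of_nat (Suc ?a - i) - of_nat i * of_nat ?k) * (of_nat (Suc (Suc ?a) - i) * ?F) else 0) -
          ((if i \<le> Suc (Suc ?a) then of_nat i * of_nat (i - 1) * of_nat ?k * ?F else 0) -
           (if i \<le> Suc ?a then of_nat i * of_nat (Suc (Suc ?a) - i) * ?F else 0)) =
          1 * (if i \<le> Suc (Suc ?a) then of_nat (Suc ?a) * ((of_nat (Suc (Suc ?a) - i) - of_nat i * of_nat ?k) * ?F) else 0)"
        proof cases
          case 1
          then obtain c where c: "Suc ?a = c + i" by (metis le_add_diff_inverse2)
          then have e: "Suc ?a - i = c" "Suc (Suc ?a) - i = Suc c" "i \<le> Suc ?a" "i \<le> Suc (Suc ?a)" by auto
          have m: "of_nat i * of_nat (i - 1) = (of_nat i * (of_nat i - 1) :: 'a)"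
            by (cases i) (auto simp: algebra_simps)
          have "(of_nat c - of_nat i * of_nat ?k) * (of_nat (Suc c) * F) - (of_nat i * (of_nat i - 1) * of_nat ?k * F - of_nat i * of_nat (Suc c) * F)
            = of_nat (c + i) * ((of_nat (Suc c) - of_nat i * of_nat ?k) * F)" for F :: 'a
            by (simp add: algebra_simps)
          then show ?thesis unfolding m using e by (simp only: c if_True mult_1_left)
        next
          case 2
          then show ?thesis by (simp add: algebra_simps)
        qed simp
      qed
    next
      case neq: 3
      have l: "dual j \<noteq> 1" "dual j \<noteq> r + 1" "1 \<le> dual j" "dual j \<le> 2 * r"
        using neq 3(2) r by (auto simp: dual_def)
      then have k: "(\<gamma>(dual j := Suc (\<gamma> (dual j)))) (r + 1) = ?k" by auto
      have T2: "der_apply p ?n ?E (dcomp (theta p r i) j) \<gamma> = 0"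
        by (simp only: dcomp_theta(3)[OF i neq] der0)
      show ?thesis unfolding br T1 T2 R pd_hact[OF f g l(1,3,4)] k by simp
    qed
  qed
  then show "bracket p ?n (theta p r i) ?E x = DH p r (hact (ew i) f) x" by (simp only: x)
qed

end

section \<open>Passage from truncated polynomials to H(2r)\<close>

lemma sum_fun_apply: "(\<Sum>i\<in>A. g i) x = (\<Sum>i\<in>A. g i x)"
  by (induction A rule: infinite_finite_induct) auto

lemma sum_in_subspace_span:
  assumes "finite A" "\<And>\<alpha>. \<alpha> \<in> A \<Longrightarrow> v \<alpha> \<in> S"
  shows "(\<Sum>\<alpha>\<in>A. fscale (c \<alpha>) (v \<alpha>)) \<in> module.span fscale S"
  using assms by (intro fscale.span_sum fscale.span_scale fscale.span_base) auto

context
  fixes p r :: nat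
  assumes prime: "prime p" and p2: "2 < p" and char: "CHAR('a::field) = p" and r: "1 \<le> r"
begin

definition topv :: mono where
  "topv = (\<lambda>i. if 1 \<le> i \<and> i \<le> 2 * r then p - 1 else 0)"

definition Balg :: "(mono \<Rightarrow> 'a) set" where
  "Balg = {f \<in> Alg p (2 * r). f (\<lambda>_. 0) = 0 \<and> f topv = 0}"

text \<open>\<open>DH\<close> identifies \<open>Balg\<close> with \<open>H(2r)\<close>; the constant term, which \<open>DH\<close> kills, is reset to \<open>0\<close>.\<close>

definition bact :: "'a W1elem \<Rightarrow> (mono \<Rightarrow> 'a) \<Rightarrow> mono \<Rightarrow> 'a" where
  "bact D f = (hact p r D f)((\<lambda>_. 0) := 0)"

lemma slice_in_dens: "f \<in> Alg p (2 * r) \<Longrightarrow> (\<lambda>a. f (\<gamma>(1 := a))) \<in> dens p"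
  using expvecs_updD[of \<gamma> 1 _ p "2 * r"] by (auto simp: Alg_def dens_def not_le[symmetric])

lemma hact_expand:
  assumes D: "D \<in> W1 p" and f: "f \<in> Alg p (2 * r)"
  shows "hact p r D f = (\<Sum>i<p. fscale (D (1, xpow1 i)) (hact p r (ew i) f :: mono \<Rightarrow> 'a))"
proof
  fix \<gamma>
  have p0: "0 < p" using p2 by simp
  let ?s = "\<lambda>a. f (\<gamma>(1 := a))"
  have "dens_act p (\<gamma> (r + 1)) D ?s (\<gamma> 1) = (\<Sum>i<p. fscale (D (1, xpow1 i)) (dens_act p (\<gamma> (r + 1)) (ew i) ?s)) (\<gamma> 1)"
    using W1mod_expand[OF p0 dens_W1mod[OF p0 char] D slice_in_dens[OF f]] by (rule fun_cong)
  then show "hact p r D f \<gamma> = (\<Sum>i<p. fscale (D (1, xpow1 i)) (hact p r (ew i) f)) \<gamma>"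
    unfolding sum_fun_apply hact_def[OF prime p2 char r] by (simp add: sum_fun_apply)
qed

lemma Hact_DH:
  assumes D: "D \<in> W1 p" and f: "f \<in> Alg p (2 * r)"
  shows "Hact p r D (DH p r f) = (DH p r (hact p r D f) :: nat \<times> mono \<Rightarrow> 'a)"
proof -
  have "bracket p (2 * r) (\<Sum>i<n. fscale (D (1, xpow1 i)) (theta p r i)) (DH p r f) =
      DH p r (\<Sum>i<n. fscale (D (1, xpow1 i)) (hact p r (ew i) f))" if "n \<le> p" for n
    using that
  proof (induction n)
    case 0
    show ?case by (simp only: lessThan_0 sum.empty bracket_0_left DH_0)
  next
    case (Suc n)
    have n: "n < p" "n \<le> p" using Suc.prems by auto
    show ?case
      by (simp only: sum.lessThan_Suc bracket_add_left bracket_scale_left DH_add DH_scale Suc.IH[OF n(2)]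
          bracket_theta[OF prime p2 char r n(1) f])
  qed
  from this[OF order_refl] show ?thesis
    unfolding Hact_def thetaH_theta hact_expand[OF D f] .
qed

lemma topv_in: "topv \<in> expvecs p (2 * r)"
  using p2 by (auto simp: topv_def expvecs_def)

lemma topv_nonzero: "topv \<noteq> (\<lambda>_. 0)"
  using p2 r by (auto simp: topv_def fun_eq_iff intro!: exI[of _ 1])

lemma Balg_Alg: "f \<in> Balg \<Longrightarrow> f \<in> Alg p (2 * r)"
  by (simp add: Balg_def)

lemma Balg_subspace: "module.subspace fscale Balg"
  by (intro fscale.subspaceI) (auto simp: Balg_def Alg_def)

text \<open>The top monomial has both x- and y-exponent p-1, so its coefficient is the x^(p-1)
  coefficient of an element in the image of the action on T_(p-1), which is 0.\<close>

lemma bact_in: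
  assumes D: "D \<in> W1 p"
  shows "bact D f \<in> Balg"
proof -
  have "topv 1 = p - 1" "topv (r + 1) = p - 1" using r by (auto simp: topv_def)
  then have "hact p r D f topv = 0"
    using dens_act_top[OF prime p2 char D, of "\<lambda>a. f (topv(1 := a))"] topv_in by (simp add: hact_def[OF prime p2 char r])
  then show ?thesis
    using hact_in_Alg[OF prime p2 char r, of D f] topv_nonzero by (auto simp: Balg_def bact_def Alg_def)
qed

lemma DH_image_Balg: "DH p r ` Balg = Hset p r"
proof
  let ?G = "{DH p r (xmon \<alpha> :: mono \<Rightarrow> 'a) | \<alpha>. \<alpha> \<in> expvecs p (2 * r) \<and> \<alpha> \<noteq> (\<lambda>_. 0) \<and> \<alpha> \<noteq> topv}"
  have H: "Hset p r = module.span fscale ?G" by (simp add: Hset_def topv_def)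
  let ?A = "expvecs p (2 * r) - {\<lambda>_. 0, topv}"
  have finA: "finite ?A" using finite_expvecs[of p "2 * r"] p2 by simp
  show "DH p r ` Balg \<subseteq> Hset p r"
  proof
    fix y assume "y \<in> DH p r ` Balg"
    then obtain f where f: "f \<in> Balg" "y = DH p r f" by blast
    have feq: "f = (\<Sum>\<alpha>\<in>?A. fscale (f \<alpha>) (xmon \<alpha>))"
    proof
      fix \<gamma>
      have "(\<Sum>\<alpha>\<in>?A. fscale (f \<alpha>) (xmon \<alpha>)) \<gamma> = (\<Sum>\<alpha>\<in>?A. if \<gamma> = \<alpha> then f \<alpha> else 0)"
        unfolding sum_fun_apply by (intro sum.cong) (auto simp: xmon_def)
      also have "\<dots> = (if \<gamma> \<in> ?A then f \<gamma> else 0)" using finA by (simp add: sum.delta)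
      also have "\<dots> = f \<gamma>" using f(1) by (auto simp: Balg_def Alg_def)
      finally show "f \<gamma> = (\<Sum>\<alpha>\<in>?A. fscale (f \<alpha>) (xmon \<alpha>)) \<gamma>" by simp
    qed
    have sum: "DH p r (\<Sum>\<alpha>\<in>A. fscale (f \<alpha>) (xmon \<alpha>)) = (\<Sum>\<alpha>\<in>A. fscale (f \<alpha>) (DH p r (xmon \<alpha>)))" if "finite A" for A
      using that
    proof (induction A rule: finite_induct)
      case empty
      show ?case by (simp only: sum.empty DH_0)
    next
      case (insert x A)
      then show ?case by (simp only: sum.insert DH_add DH_scale simp_thms)
    qed
    have "y = (\<Sum>\<alpha>\<in>?A. fscale (f \<alpha>) (DH p r (xmon \<alpha>)))"
      using trans[OF f(2) trans[OF arg_cong[OF feq, of "DH p r"] sum[OF finA]]] .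
    also have "\<dots> \<in> module.span fscale ?G"
      by (rule sum_in_subspace_span[OF finA]) auto
    finally show "y \<in> Hset p r" using H by simp
  qed
  show "Hset p r \<subseteq> DH p r ` Balg"
    unfolding H
  proof (rule fscale.span_minimal)
    show "?G \<subseteq> DH p r ` Balg"
    proof
      fix y assume "y \<in> ?G"
      then obtain \<alpha> where a: "y = DH p r (xmon \<alpha>)" "\<alpha> \<in> expvecs p (2 * r)" "\<alpha> \<noteq> (\<lambda>_. 0)" "\<alpha> \<noteq> topv" by blast
      then have "xmon \<alpha> \<in> Balg" by (auto simp: Balg_def Alg_def xmon_def)
      then show "y \<in> DH p r ` Balg" using a by blast
    qed
    show "module.subspace fscale (DH p r ` Balg)"
    proof (rule fscale.subspaceI)
      show "0 \<in> DH p r ` Balg" by (rule image_eqI[of _ _ 0]) (simp_all only: DH_0 fscale.subspace_0[OF Balg_subspace])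
      fix x y :: "nat \<times> mono \<Rightarrow> 'a" and c :: 'a assume "x \<in> DH p r ` Balg"
      then obtain f where f: "f \<in> Balg" "x = DH p r f" by blast
      show "fscale c x \<in> DH p r ` Balg"
        unfolding f(2) DH_scale[symmetric] using fscale.subspace_scale[OF Balg_subspace f(1)] by blast
      assume "y \<in> DH p r ` Balg"
      then obtain g where g: "g \<in> Balg" "y = DH p r g" by blast
      show "x + y \<in> DH p r ` Balg"
        unfolding f(2) g(2) DH_add[symmetric] using fscale.subspace_add[OF Balg_subspace f(1) g(1)] by blast
    qed
  qed
qed

text \<open>Every non-constant monomial has an exponent between 1 and p-1, and the corresponding
  partial derivative recovers its coefficient up to that invertible factor.\<close>

lemma DH_inj:
  assumes f: "f \<in> Balg" and 0: "DH p r f = 0"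
  shows "f = 0"
proof
  fix \<alpha>
  show "f \<alpha> = 0 \<alpha>"
  proof (cases "\<alpha> \<in> expvecs p (2 * r) \<and> \<alpha> \<noteq> (\<lambda>_. 0)")
    case True
    then obtain i where i: "\<alpha> i \<noteq> 0" by auto
    then have ir: "1 \<le> i" "i \<le> 2 * r" using True by (auto simp: expvecs_def) (metis not_less_eq_eq not_less less_one One_nat_def)+
    let ?\<beta> = "\<alpha>(i := \<alpha> i - 1)"
    have b: "?\<beta> \<in> expvecs p (2 * r)" "?\<beta>(i := Suc (?\<beta> i)) = \<alpha>"
      using True i by (auto simp: expvecs_def less_imp_diff_less fun_eq_iff)
    then have "pd p (2 * r) i f ?\<beta> = of_nat (\<alpha> i) * f \<alpha>"
      using i pd_Alg[OF Balg_Alg[OF f], of i ?\<beta>] by simp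
    moreover have "pd p (2 * r) i f ?\<beta> = 0"
    proof (cases "i \<le> r")
      case True
      then show ?thesis using DH_apply[of "i + r" r p f ?\<beta>] ir 0 by simp
    next
      case False
      then have e: "1 \<le> i - r" "i - r \<le> 2 * r" "i - r \<le> r" "i - r + r = i" using ir by auto
      show ?thesis using DH_apply[OF e(1,2), of p f ?\<beta>] e(3,4) 0 by simp
    qed
    moreover have "of_nat (\<alpha> i) \<noteq> (0 :: 'a)"
      using of_nat_nonzero[OF prime p2 char, of "\<alpha> i"] i expvecs_lt[OF prime p2 char r, of \<alpha> "2 * r" i] True by simp
    ultimately show ?thesis by simp
  qed (use f in \<open>auto simp: Balg_def Alg_def\<close>)
qed

lemma DH_iso: "is_iso p Balg bact (Hset p r) (Hact p r) (DH p r)"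
proof (rule isoI[OF _ Balg_subspace DH_inj DH_image_Balg])
  have "DH p r (bact D f) = Hact p r D (DH p r f)" if "D \<in> W1 p" "f \<in> Balg" for D f
    unfolding Hact_DH[OF that(1) Balg_Alg[OF that(2)]] by (rule DH_const) (simp add: bact_def)
  then show "is_hom p Balg bact (Hset p r) (Hact p r) (DH p r)"
    unfolding is_hom_def using DH_image_Balg by (auto simp: DH_add DH_scale simp del: fscale_apply plus_fun_apply)
qed

section \<open>The decomposition of the Hamiltonian algebra\<close>

definition rest :: "mono set" where
  "rest = {\<beta> \<in> expvecs p (2 * r). \<beta> 1 = 0 \<and> \<beta> (r + 1) = 0}"

definition topr :: mono where
  "topr = topv(1 := 0, r + 1 := 0)"

text \<open>Projection to one summand T_k y^k z^\<beta>: for \<open>b\<close> = (\<beta>, k), the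
  coefficient of y^k z^\<beta> as a polynomial in x.\<close>

definition cf :: "mono \<times> nat \<Rightarrow> (mono \<Rightarrow> 'a) \<Rightarrow> nat \<Rightarrow> 'a" where
  "cf b f = (\<lambda>a. f ((fst b)(1 := a, r + 1 := snd b)))"

lemma finite_rest: "finite rest" and card_rest: "card rest = p ^ (2 * r - 2)"
proof -
  let ?I = "{1..2 * r} - {1, r + 1}"
  have "rest = {\<alpha>. (\<forall>i. \<alpha> i < p) \<and> (\<forall>i. i \<notin> ?I \<longrightarrow> \<alpha> i = 0)}"
    using r by (auto simp: rest_def expvecs_def not_le)
  moreover have "card ?I = 2 * r - 2" using r by (subst card_Diff_subset) auto
  ultimately show "finite rest" "card rest = p ^ (2 * r - 2)"
    using fin_supp_vecs[of ?I p] p2 by auto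
qed

lemma zero_in_rest: "(\<lambda>_. 0) \<in> rest"
  using p2 by (auto simp: rest_def expvecs_def)

lemma topr_in_rest: "topr \<in> rest"
  using p2 r by (auto simp: rest_def expvecs_def topr_def topv_def)

lemma rest_upd: "\<beta> \<in> rest \<Longrightarrow> k < p \<Longrightarrow> a < p \<Longrightarrow> \<beta>(1 := a, r + 1 := k) \<in> expvecs p (2 * r)"
  using r by (intro expvecs_upd) (auto simp: rest_def)

lemma cf_in_dens:
  assumes "f \<in> Alg p (2 * r)"
  shows "cf b f \<in> dens p"
proof -
  have "(fst b)(1 := a, r + 1 := snd b) \<notin> expvecs p (2 * r)" if "p \<le> a" for a
  proof
    assume "(fst b)(1 := a, r + 1 := snd b) \<in> expvecs p (2 * r)"
    then have "((fst b)(1 := a, r + 1 := snd b)) 1 < p" by (rule expvecs_lt[OF prime p2 char r])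
    then show False using that r by simp
  qed
  then show ?thesis using assms by (simp add: cf_def dens_def Alg_def)
qed

lemma cf_add: "cf b (f + g) = cf b f + cf b g"
  and cf_scale: "cf b (fscale c f) = fscale c (cf b f)"
  by (auto simp: cf_def fun_eq_iff)

lemma cf_hact:
  assumes "\<beta> \<in> rest" "k < p"
  shows "cf (\<beta>, k) (hact p r D f) = dens_act p k D (cf (\<beta>, k) f)"
proof
  fix a
  show "cf (\<beta>, k) (hact p r D f) a = dens_act p k D (cf (\<beta>, k) f) a"
  proof (cases "a < p")
    case True
    have "(\<lambda>b. f ((\<beta>(1 := a, r + 1 := k))(1 := b))) = cf (\<beta>, k) f"
      using r by (auto simp: cf_def fun_eq_iff fun_upd_twist)
    moreover have "(\<beta>(1 := a, r + 1 := k)) (r + 1) = k" "(\<beta>(1 := a, r + 1 := k)) 1 = a" using r by auto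
    moreover have cf: "cf (\<beta>, k) (hact p r D f) a = hact p r D f (\<beta>(1 := a, r + 1 := k))"
      by (simp only: cf_def fst_conv snd_conv)
    ultimately show ?thesis
      unfolding cf hact_def[OF prime p2 char r] using rest_upd[OF assms True] by (simp only: if_True)
  next
    case False
    then show ?thesis
      using cf_in_dens[OF hact_in_Alg[OF prime p2 char r], of "(\<beta>, k)" D f] by (simp add: dens_def dens_act_def)
  qed
qed

lemma upd_zero: "\<beta> \<in> rest \<Longrightarrow> \<beta>(1 := a, r + 1 := k) = (\<lambda>_. 0) \<longleftrightarrow> \<beta> = (\<lambda>_. 0) \<and> a = 0 \<and> k = 0"
  using r by (auto simp: rest_def fun_eq_iff split: if_splits)

lemma upd_top: "\<beta> \<in> rest \<Longrightarrow> \<beta>(1 := a, r + 1 := k) = topv \<longleftrightarrow> \<beta> = topr \<and> a = p - 1 \<and> k = p - 1"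
proof -
  assume b: "\<beta> \<in> rest"
  have t: "topv 1 = p - 1" "topv (r + 1) = p - 1" using r by (auto simp: topv_def)
  have r1: "r + 1 \<noteq> 1" using r by simp
  show ?thesis
  proof
    assume eq: "\<beta>(1 := a, r + 1 := k) = topv"
    have "a = p - 1" "k = p - 1" using fun_cong[OF eq, of 1] fun_cong[OF eq, of "r + 1"] t r1 by auto
    moreover have "\<beta> = topr"
    proof
      fix i
      show "\<beta> i = topr i" using fun_cong[OF eq, of i] b by (auto simp: topr_def rest_def split: if_splits)
    qed
    ultimately show "\<beta> = topr \<and> a = p - 1 \<and> k = p - 1" by blast
  next
    assume "\<beta> = topr \<and> a = p - 1 \<and> k = p - 1"
    then show "\<beta>(1 := a, r + 1 := k) = topv" using t by (auto simp: topr_def fun_eq_iff)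
  qed
qed

text \<open>T_k is V(p-1-k), which is simple for 0 < k < p-1. Where \<open>Balg\<close> misses the
  constant or the top monomial, L(p-1) is left. For r = 1 these two slots share the same \<beta> and
  are told apart by k.\<close>

definition ctype :: "mono \<times> nat \<Rightarrow> 'a W1module" where
  "ctype b = (if snd b = p - 1 then (if fst b = topr then Lmod p (p - 1) else Vmod p 0)
    else if snd b = 0 then (if fst b = (\<lambda>_. 0) then Lmod p (p - 1) else Vmod p (p - 1))
    else Lmod p (p - 1 - snd b))"

text \<open>The polynomials in x that may occur as a component of an element of
  \<open>Balg\<close>.\<close>

definition slice_ok :: "mono \<times> nat \<Rightarrow> (nat \<Rightarrow> 'a) \<Rightarrow> bool" where
  "slice_ok b c \<longleftrightarrow> c \<in> dens p \<and> (b = (\<lambda>_. 0, 0) \<longrightarrow> c 0 = 0) \<and> (b = (topr, p - 1) \<longrightarrow> c (p - 1) = 0)"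

text \<open>Surjectivity is phrased through an admissible slice c rather than a preimage in
  \<open>Balg\<close>, so that slices for all \<open>b\<close> can be prescribed independently and
  glued.\<close>

definition component_map :: "mono \<times> nat \<Rightarrow> ((mono \<Rightarrow> 'a) \<Rightarrow> nat \<Rightarrow> 'a) \<Rightarrow> bool" where
  "component_map b \<phi> \<longleftrightarrow> is_hom p Balg bact (fst (ctype b)) (snd (ctype b)) \<phi>
    \<and> (\<forall>v\<in>Balg. \<phi> v = 0 \<longrightarrow> cf b v = 0)
    \<and> (\<forall>w\<in>fst (ctype b). \<exists>c. slice_ok b c \<and> (\<forall>v\<in>Balg. cf b v = c \<longrightarrow> \<phi> v = w))"

text \<open>Slot (0, 0) is excluded because \<open>bact\<close> resets the constant term there, so
  that \<open>cf\<close> does not intertwine with the plain action on T_0.\<close>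

lemma component_map_comp:
  assumes \<psi>: "is_iso p X (dens_act p k) (fst (ctype (\<beta>, k))) (snd (ctype (\<beta>, k))) \<psi>"
    and X: "module.subspace fscale X" "\<And>v. v \<in> Balg \<Longrightarrow> cf (\<beta>, k) v \<in> X" "\<And>c. c \<in> X \<Longrightarrow> slice_ok (\<beta>, k) c"
    and b: "\<beta> \<in> rest" "k < p" "(\<beta>, k) \<noteq> (\<lambda>_. 0, 0)"
  shows "component_map (\<beta>, k) (\<psi> \<circ> cf (\<beta>, k))"
proof -
  have act: "cf (\<beta>, k) (bact D f) = dens_act p k D (cf (\<beta>, k) f)" for D f
  proof -
    have "cf (\<beta>, k) (bact D f) = cf (\<beta>, k) (hact p r D f)"
      using upd_zero[OF b(1)] b(3) by (auto simp: cf_def bact_def fun_eq_iff)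
    then show ?thesis using cf_hact[OF b(1,2)] by simp
  qed
  have "is_hom p Balg bact X (dens_act p k) (cf (\<beta>, k))"
    unfolding is_hom_def using X(2) act cf_add cf_scale by blast
  then have "is_hom p Balg bact (fst (ctype (\<beta>, k))) (snd (ctype (\<beta>, k))) (\<psi> \<circ> cf (\<beta>, k))"
    using hom_comp iso_hom[OF \<psi>] by blast
  moreover have "cf (\<beta>, k) v = 0" if "v \<in> Balg" "(\<psi> \<circ> cf (\<beta>, k)) v = 0" for v
    using iso_kernel[OF \<psi> X(1)] X(2)[OF that(1)] that(2) unfolding o_apply by blast
  moreover have "\<exists>c. slice_ok (\<beta>, k) c \<and> (\<forall>v\<in>Balg. cf (\<beta>, k) v = c \<longrightarrow> (\<psi> \<circ> cf (\<beta>, k)) v = w)"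
    if "w \<in> fst (ctype (\<beta>, k))" for w
  proof -
    have "w \<in> \<psi> ` X" using that unfolding iso_image[OF \<psi>] .
    then obtain c where c: "c \<in> X" "w = \<psi> c" by (rule imageE)
    show ?thesis
    proof (intro exI[of _ c] conjI ballI impI)
      show "slice_ok (\<beta>, k) c" using X(3)[OF c(1)] .
      show "(\<psi> \<circ> cf (\<beta>, k)) v = w" if "cf (\<beta>, k) v = c" for v using that c(2) by (simp only: o_apply)
    qed
  qed
  ultimately show ?thesis unfolding component_map_def by blast
qed

lemma component_map_exists:
  assumes b: "\<beta> \<in> rest" "k < p"
  shows "\<exists>\<phi>. component_map (\<beta>, k) \<phi>"
proof -
  have p1: "p - 1 < p" "0 < p" "p - 1 \<noteq> 0" using p2 by auto
  obtain \<psi>L where \<psi>L: "is_iso p (fst (Lmodel p (p - 1) :: 'a W1module)) (snd (Lmodel p (p - 1))) (fst (Lmod p (p - 1))) (snd (Lmod p (p - 1))) \<psi>L"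
    using Lmodel_iso_Lmod[OF prime p2 char p1(1)] by blast
  consider "\<beta> = (\<lambda>_. 0)" "k = 0" | "\<beta> = topr" "k = p - 1" |
      "(\<beta>, k) \<noteq> (\<lambda>_. 0, 0)" "(\<beta>, k) \<noteq> (topr, p - 1)" by blast
  then show ?thesis
  proof cases
    case 1
    have t: "ctype (\<beta>, k) = Lmod p (p - 1)" using 1 p1 by (simp add: ctype_def)
    let ?\<phi> = "\<lambda>v. \<psi>L (dderiv (cf (\<beta>, k) v))"
    note hd = hom_dderiv[OF prime p2 char]
    \<comment> \<open>In the exceptional slot the derivative removes the conflict: it does not see
      the constant term that \<open>bact\<close> resets, and it is injective on polynomials without
      constant term.\<close>
    have act: "dderiv (cf (\<beta>, k) (bact D f)) = dderiv (dens_act p 0 D (cf (\<beta>, k) f))" for D f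
    proof -
      have "cf (\<beta>, k) (bact D f) (Suc a) = dens_act p 0 D (cf (\<beta>, k) f) (Suc a)" for a
      proof -
        have "cf (\<beta>, k) (bact D f) (Suc a) = cf (\<beta>, k) (hact p r D f) (Suc a)"
          using upd_zero[OF b(1), of "Suc a" k] by (simp add: cf_def bact_def)
        then show ?thesis using cf_hact[OF b] 1(2) by simp
      qed
      then show ?thesis by (simp add: dderiv_def[OF prime p2 char] fun_eq_iff)
    qed
    have "is_hom p Balg bact (fst (Lmodel p (p - 1))) (snd (Lmodel p (p - 1))) (\<lambda>v. dderiv (cf (\<beta>, k) v))"
      unfolding is_hom_def
      by (intro conjI ballI allI)
        (simp_all only: act cf_add cf_scale hom_in[OF hd] hom_add[OF hd] hom_scale[OF hd] hom_act[OF hd] cf_in_dens Balg_Alg)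
    then have "is_hom p Balg bact (fst (ctype (\<beta>, k))) (snd (ctype (\<beta>, k))) ?\<phi>"
      unfolding t using hom_comp[OF _ iso_hom[OF \<psi>L]] by (simp only: o_def)
    moreover have "cf (\<beta>, k) v = 0" if v: "v \<in> Balg" "?\<phi> v = 0" for v
    proof -
      have c: "cf (\<beta>, k) v \<in> dens p" using cf_in_dens[OF Balg_Alg[OF v(1)]] .
      have "dderiv (cf (\<beta>, k) v) \<in> fst (Lmodel p (p - 1) :: 'a W1module)" using hom_in[OF hd c] .
      then have "dderiv (cf (\<beta>, k) v) = 0"
        using v(2) iso_kernel[OF \<psi>L W1mod_subspace[OF simple_W1mod[OF Lmodel_simple[OF prime p2 char p1(1)]]]] by blast
      then have "cf (\<beta>, k) v \<in> fst (Lmodel p 0)" using kernel_dderiv[OF prime p2 char] c by blast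
      then have z: "cf (\<beta>, k) v a = 0" if "1 \<le> a" for a using that by (simp add: Lmodel_def[OF prime p2 char])
      have "cf (\<beta>, k) v 0 = v (\<lambda>_. 0)" using upd_zero[OF b(1), of 0 k] 1 by (simp add: cf_def)
      then have "cf (\<beta>, k) v 0 = 0" using v(1) by (simp add: Balg_def)
      then have "cf (\<beta>, k) v a = 0" for a using z[of a] by (cases a) auto
      then show ?thesis by (auto simp: fun_eq_iff)
    qed
    moreover have "\<exists>c. slice_ok (\<beta>, k) c \<and> (\<forall>v\<in>Balg. cf (\<beta>, k) v = c \<longrightarrow> ?\<phi> v = w)" if w: "w \<in> fst (ctype (\<beta>, k))" for w
    proof -
      have "w \<in> \<psi>L ` fst (Lmodel p (p - 1))" using w unfolding iso_image[OF \<psi>L] t .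
      then obtain y where y: "w = \<psi>L y" "y \<in> fst (Lmodel p (p - 1))" by (rule imageE)
      then have "y \<in> dderiv ` dens p" unfolding image_dderiv[OF prime p2 char] by blast
      then obtain c where c: "y = dderiv c" "c \<in> dens p" by (rule imageE)
      \<comment> \<open>The antiderivative is normalised to constant term 0, as \<open>Balg\<close>
        demands; its derivative is unaffected.\<close>
      have "slice_ok (\<beta>, k) (c(0 := 0))" using c(2) p1 1 by (auto simp: slice_ok_def dens_def)
      moreover have "dderiv (c(0 := 0)) = y" unfolding c(1) by (auto simp: dderiv_def[OF prime p2 char] fun_eq_iff)
      ultimately show ?thesis unfolding y(1) by (intro exI[of _ "c(0 := 0)"]) auto
    qed
    ultimately have "component_map (\<beta>, k) ?\<phi>" unfolding component_map_def by blast
    then show ?thesis by blast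
  next
    case 2
    have t: "ctype (\<beta>, k) = Lmod p (p - 1)" using 2 by (simp add: ctype_def)
    have Q: "fst (Lmodel p (p - 1) :: 'a W1module) = {f \<in> dens p. f (p - 1) = 0}" "snd (Lmodel p (p - 1) :: 'a W1module) = dens_act p (p - 1)"
      using p1 by (auto simp: Lmodel_def[OF prime p2 char])
    have "component_map (\<beta>, k) (\<psi>L \<circ> cf (\<beta>, k))"
    proof (rule component_map_comp[OF _ _ _ _ b])
      show "is_iso p (fst (Lmodel p (p - 1))) (dens_act p k) (fst (ctype (\<beta>, k))) (snd (ctype (\<beta>, k))) \<psi>L"
        using \<psi>L[unfolded Q(2)] unfolding t by (simp only: 2(2))
      show "module.subspace fscale (fst (Lmodel p (p - 1) :: 'a W1module))"
        using W1mod_subspace[OF simple_W1mod[OF Lmodel_simple[OF prime p2 char p1(1)]]] .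
      show "(\<beta>, k) \<noteq> (\<lambda>_. 0, 0)" using 2 p1 by simp
      show "slice_ok (\<beta>, k) c" if "c \<in> fst (Lmodel p (p - 1))" for c
        using that p1 2(2) unfolding Q by (auto simp: slice_ok_def)
      show "cf (\<beta>, k) v \<in> fst (Lmodel p (p - 1))" if "v \<in> Balg" for v
      proof -
        have "cf (\<beta>, k) v (p - 1) = v topv" using upd_top[OF b(1), of "p - 1" k] 2 by (simp add: cf_def)
        then show ?thesis unfolding Q using cf_in_dens[OF Balg_Alg[OF that]] that by (simp add: Balg_def)
      qed
    qed
    then show ?thesis by blast
  next
    case 3
    have "\<exists>\<psi>. is_iso p (dens p :: (nat \<Rightarrow> 'a) set) (dens_act p k) (fst (ctype (\<beta>, k))) (snd (ctype (\<beta>, k))) \<psi>"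
    proof (cases "k = p - 1 \<or> k = 0")
      case True
      then have "ctype (\<beta>, k) = Vmod p (p - 1 - k)" using 3 p1 by (auto simp: ctype_def)
      then show ?thesis using dens_iso_Vmod[OF prime p2 char b(2)] by simp
    next
      case False
      then have t: "ctype (\<beta>, k) = Lmod p (p - 1 - k)" by (auto simp: ctype_def)
      have "p - 1 - k \<noteq> 0" "p - 1 - k \<noteq> p - 1" "p - 1 - (p - 1 - k) = k" "p - 1 - k < p" using False b p1 by auto
      then show ?thesis
        using Lmodel_iso_Lmod[OF prime p2 char, of "p - 1 - k"] unfolding t
        by (simp add: Lmodel_def[OF prime p2 char] del: One_nat_def)
    qed
    then obtain \<psi> where "is_iso p (dens p :: (nat \<Rightarrow> 'a) set) (dens_act p k) (fst (ctype (\<beta>, k))) (snd (ctype (\<beta>, k))) \<psi>" by blast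
    then have "component_map (\<beta>, k) (\<psi> \<circ> cf (\<beta>, k))"
      by (rule component_map_comp[OF _ dens_subspace _ _ b 3(1)]) (use 3 cf_in_dens Balg_Alg in \<open>auto simp: slice_ok_def\<close>)
    then show ?thesis by blast
  qed
qed

lemma Balg_iso:
  assumes js: "distinct js" "set js = rest \<times> {..<p}"
  shows "\<exists>F. is_iso p Balg bact (fst (dsum (map ctype js))) (snd (dsum (map ctype js))) F"
proof -
  define \<phi> where "\<phi> b = (SOME \<phi>. component_map b \<phi>)" for b
  have \<phi>: "component_map b (\<phi> b)" if "b \<in> set js" for b
  proof -
    have "\<exists>\<phi>. component_map b \<phi>" using component_map_exists that unfolding js(2) by (cases b) auto
    then show ?thesis unfolding \<phi>_def by (rule someI_ex)
  qed
  have "is_iso p Balg bact (fst (dsum (map ctype js))) (snd (dsum (map ctype js)))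
     (\<lambda>v (k, x). if k < length (map ctype js) then (\<lambda>k. \<phi> (js ! k)) k v x else 0)"
  proof (rule dsum_iso[OF Balg_subspace])
    show "is_hom p Balg bact (fst (map ctype js ! k)) (snd (map ctype js ! k)) (\<phi> (js ! k))" if "k < length (map ctype js)" for k
      using \<phi>[of "js ! k"] that by (simp add: component_map_def)
    show "v = 0" if v: "v \<in> Balg" "\<And>k. k < length (map ctype js) \<Longrightarrow> \<phi> (js ! k) v = 0" for v
    proof
      fix \<gamma>
      show "v \<gamma> = 0 \<gamma>"
      proof (cases "\<gamma> \<in> expvecs p (2 * r)")
        case True
        let ?b = "(\<gamma>(1 := 0, r + 1 := 0), \<gamma> (r + 1))"
        have "?b \<in> set js" unfolding js(2) using True p2 r by (auto simp: rest_def expvecs_def)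
        then obtain k where k: "k < length js" "js ! k = ?b" by (auto simp: in_set_conv_nth)
        then have "\<phi> ?b v = 0" using v(2)[of k] by simp
        then have "cf ?b v = 0" using \<phi>[OF \<open>?b \<in> set js\<close>] v(1) unfolding component_map_def by blast
        moreover have "cf ?b v (\<gamma> 1) = v \<gamma>"
        proof -
          have "(\<gamma>(1 := 0, r + 1 := 0))(1 := \<gamma> 1, r + 1 := \<gamma> (r + 1)) = \<gamma>" using r by (auto simp: fun_eq_iff)
          then show ?thesis by (simp only: cf_def fst_conv snd_conv)
        qed
        ultimately show ?thesis by simp
      next
        case False
        then show ?thesis using v(1) by (simp add: Balg_def Alg_def)
      qed
    qed
    show "\<exists>v\<in>Balg. \<forall>k<length (map ctype js). \<phi> (js ! k) v = w k"
      if w: "\<And>k. k < length (map ctype js) \<Longrightarrow> w k \<in> fst (map ctype js ! k)" for w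
    proof -
      have "\<exists>c. slice_ok (js ! k) c \<and> (\<forall>v\<in>Balg. cf (js ! k) v = c \<longrightarrow> \<phi> (js ! k) v = w k)" if "k < length js" for k
        using \<phi>[of "js ! k"] w[of k] that unfolding component_map_def by simp
      then have "\<forall>k. \<exists>c. k < length js \<longrightarrow> slice_ok (js ! k) c \<and> (\<forall>v\<in>Balg. cf (js ! k) v = c \<longrightarrow> \<phi> (js ! k) v = w k)" by blast
      then obtain C where C: "\<And>k. k < length js \<Longrightarrow> slice_ok (js ! k) (C k) \<and> (\<forall>v\<in>Balg. cf (js ! k) v = C k \<longrightarrow> \<phi> (js ! k) v = w k)"
        by metis
      \<comment> \<open>Distinctness of \<open>js\<close> makes the slot number a function of the
        pair (\<beta>, k).\<close>
      define idx where "idx b = (THE k. k < length js \<and> js ! k = b)" for b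
      have idx: "idx (js ! k) = k" if "k < length js" for k
        unfolding idx_def using js(1) that by (intro the_equality) (auto simp: nth_eq_iff_index_eq)
      \<comment> \<open>Glue the prescribed slices: each exponent belongs to exactly one slot, with
        its x-exponent as position inside the slice.\<close>
      define v where "v \<gamma> = (if \<gamma> \<in> expvecs p (2 * r) then C (idx (\<gamma>(1 := 0, r + 1 := 0), \<gamma> (r + 1))) (\<gamma> 1) else 0)" for \<gamma>
      have vcf: "cf (js ! k) v = C k" if k: "k < length js" for k
      proof
        fix a
        obtain \<beta> m where bm: "js ! k = (\<beta>, m)" by (cases "js ! k")
        then have b: "\<beta> \<in> rest" "m < p" using js(2) k nth_mem[OF k] by auto
        show "cf (js ! k) v a = C k a"
        proof (cases "a < p")
          case True
          have "(\<beta>(1 := a, r + 1 := m))(1 := 0, r + 1 := 0) = \<beta>" using b(1) by (auto simp: fun_eq_iff rest_def)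
          moreover have "(\<beta>(1 := a, r + 1 := m)) (r + 1) = m" "(\<beta>(1 := a, r + 1 := m)) 1 = a" using r by auto
          ultimately have "v (\<beta>(1 := a, r + 1 := m)) = C (idx (\<beta>, m)) a"
            unfolding v_def using rest_upd[OF b True] by (simp only: if_True)
          then show ?thesis using idx[OF k] bm by (simp add: cf_def)
        next
          case False
          then have "C k a = 0" using C[OF k] by (simp add: slice_ok_def dens_def)
          moreover have "v \<in> Alg p (2 * r)" by (simp add: v_def Alg_def)
          then have "cf (js ! k) v a = 0" using cf_in_dens[of v "js ! k"] False by (simp add: dens_def)
          ultimately show ?thesis by simp
        qed
      qed
      have z1: "v (\<lambda>_. 0) = 0"
      proof -
        have "(\<lambda>_. 0, 0) \<in> set js" unfolding js(2) using zero_in_rest p2 by simp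
        then obtain k where k: "k < length js" "js ! k = (\<lambda>_. 0, 0)" by (auto simp: in_set_conv_nth)
        have "C k 0 = 0" using C[OF k(1)] k(2) by (simp add: slice_ok_def)
        moreover have "cf (js ! k) v 0 = v (\<lambda>_. 0)"
          using upd_zero[OF zero_in_rest, of 0 0] by (simp add: cf_def k(2))
        ultimately show ?thesis using vcf[OF k(1)] by simp
      qed
      have z2: "v topv = 0"
      proof -
        have "(topr, p - 1) \<in> set js" unfolding js(2) using topr_in_rest p2 by simp
        then obtain k where k: "k < length js" "js ! k = (topr, p - 1)" by (auto simp: in_set_conv_nth)
        have "C k (p - 1) = 0" using C[OF k(1)] k(2) by (simp add: slice_ok_def)
        moreover have "cf (js ! k) v (p - 1) = v topv"
          using upd_top[OF topr_in_rest, of "p - 1" "p - 1"] by (simp add: cf_def k(2))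
        ultimately show ?thesis using vcf[OF k(1)] by simp
      qed
      have "v \<in> Balg" using z1 z2 by (simp add: Balg_def Alg_def v_def)
      then show ?thesis using C vcf by auto
    qed
  qed
  then show ?thesis by blast
qed

text \<open>The slots are enumerated in the order in which the theorem lists the summands; the two
  exceptional ones come last and give the two copies of L(p-1).\<close>

lemma index_list:
  defines "q \<equiv> p ^ (2 * r - 2)"
  obtains js where "distinct js" "set js = rest \<times> {..<p}"
    "map ctype js = replicate (q - 1) (Vmod p 0)
       @ concat (map (\<lambda>i. replicate q (Lmod p i)) [1..<p - 1])
       @ replicate (q - 1) (Vmod p (p - 1)) @ replicate 2 (Lmod p (p - 1))"
proof -
  obtain bs where bs: "set bs = rest" "distinct bs" using finite_distinct_list[OF finite_rest] by blast
  have len: "length bs = q" using distinct_card[OF bs(2)] bs(1) card_rest by (simp add: q_def)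
  have q: "0 < q" using p2 by (simp add: q_def)
  let ?z = "(\<lambda>_. 0) :: mono"
  \<comment> \<open>L(i) comes from y-exponent p-1-i, because T_k is V(p-1-k).\<close>
  define js where "js = map (\<lambda>\<beta>. (\<beta>, p - 1)) (remove1 topr bs)
     @ concat (map (\<lambda>i. map (\<lambda>\<beta>. (\<beta>, p - 1 - i)) bs) [1..<p - 1])
     @ map (\<lambda>\<beta>. (\<beta>, 0)) (remove1 ?z bs) @ [(topr, p - 1), (?z, 0)]"
  have p1: "p - 1 \<noteq> 0" using p2 by simp
  have rm: "set (remove1 topr bs) = rest - {topr}" "set (remove1 ?z bs) = rest - {?z}"
    using bs by auto
  have lr: "length (remove1 topr bs) = q - 1" "length (remove1 ?z bs) = q - 1"
    using len bs(1) topr_in_rest zero_in_rest by (auto simp: length_remove1)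
  have set: "set js = rest \<times> {..<p}"
  proof
    show "set js \<subseteq> rest \<times> {..<p}"
      using rm topr_in_rest zero_in_rest p2 bs(1) by (auto simp: js_def)
    show "rest \<times> {..<p} \<subseteq> set js"
    proof
      fix x assume "x \<in> rest \<times> {..<p}"
      then obtain \<beta> k where x: "x = (\<beta>, k)" "\<beta> \<in> rest" "k < p" by auto
      consider "k = p - 1" | "k = 0" | "0 < k" "k < p - 1" using x(3) by linarith
      then show "x \<in> set js"
      proof cases
        case 1
        then show ?thesis using x rm by (cases "\<beta> = topr") (auto simp: js_def)
      next
        case 2
        then show ?thesis using x rm by (cases "\<beta> = ?z") (auto simp: js_def)
      next
        case 3
        define i where "i = p - 1 - k"
        have i: "i \<in> set [1..<p - 1]" "p - 1 - i = k" using 3 by (auto simp: i_def)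
        have xi: "x \<in> set (map (\<lambda>\<beta>. (\<beta>, p - 1 - i)) bs)" using x(1,2) bs(1) i(2) by auto
        have "map (\<lambda>\<beta>. (\<beta>, p - 1 - i)) bs \<in> set (map (\<lambda>i. map (\<lambda>\<beta>. (\<beta>, p - 1 - i)) bs) [1..<p - 1])"
          using imageI[OF i(1)] unfolding set_map .
        then have "x \<in> set (concat (map (\<lambda>i. map (\<lambda>\<beta>. (\<beta>, p - 1 - i)) bs) [1..<p - 1]))"
          unfolding set_concat using xi by (rule UN_I)
        then show ?thesis by (simp add: js_def)
      qed
    qed
  qed
  \<comment> \<open>Distinctness follows by counting: the list has as many entries as the set it
    enumerates has elements.\<close>
  have "length js = p * q"
  proof -
    have "length (concat (map (\<lambda>i. map (\<lambda>\<beta>. (\<beta>, p - 1 - i)) bs) [1..<p - 1])) = (p - 2) * q"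
      by (simp add: length_concat o_def sum_list_triv len numeral_2_eq_2)
    then have "length js = (q - 1) + (p - 2) * q + (q - 1) + 2" using lr by (simp add: js_def)
    also have "\<dots> = (p - 2) * q + 2 * q" using q by simp
    also have "\<dots> = (p - 2 + 2) * q" by (simp only: add_mult_distrib)
    also have "p - 2 + 2 = p" using p2 by simp
    finally show ?thesis .
  qed
  then have "distinct js"
    by (intro card_distinct) (simp add: set card_cartesian_product card_rest q_def)
  moreover have "map ctype js = replicate (q - 1) (Vmod p 0)
       @ concat (map (\<lambda>i. replicate q (Lmod p i)) [1..<p - 1])
       @ replicate (q - 1) (Vmod p (p - 1)) @ replicate 2 (Lmod p (p - 1))"
  proof -
    have 1: "map ctype (map (\<lambda>\<beta>. (\<beta>, p - 1)) (remove1 topr bs)) = replicate (q - 1) (Vmod p 0)"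
      unfolding lr(1)[symmetric] map_replicate_const[symmetric] map_map
      by (rule map_cong[OF refl]) (use rm in \<open>auto simp: ctype_def\<close>)
    have 2: "map ctype (map (\<lambda>\<beta>. (\<beta>, 0)) (remove1 ?z bs)) = replicate (q - 1) (Vmod p (p - 1))"
      unfolding lr(2)[symmetric] map_replicate_const[symmetric] map_map
      by (rule map_cong[OF refl]) (use rm p1 in \<open>auto simp: ctype_def\<close>)
    have 3: "map ctype (concat (map (\<lambda>i. map (\<lambda>\<beta>. (\<beta>, p - 1 - i)) bs) [1..<p - 1])) = concat (map (\<lambda>i. replicate q (Lmod p i)) [1..<p - 1])"
    proof -
      have "map ctype (map (\<lambda>\<beta>. (\<beta>, p - 1 - i)) bs) = replicate q (Lmod p i)" if i: "i \<in> set [1..<p - 1]" for i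
      proof -
        have i': "p - 1 - i \<noteq> p - 1" "p - 1 - i \<noteq> 0" "p - 1 - (p - 1 - i) = i" using i by auto
        have "ctype (\<beta>, p - 1 - i) = Lmod p i" for \<beta> unfolding ctype_def snd_conv fst_conv using i' by (simp only: if_False)
        then show ?thesis unfolding len[symmetric] map_replicate_const[symmetric] map_map by simp
      qed
      then show ?thesis unfolding map_concat map_map by (intro arg_cong[of _ _ concat] map_cong) auto
    qed
    have 4: "map ctype [(topr, p - 1), (?z, 0)] = replicate 2 (Lmod p (p - 1))"
      using p1 by (simp add: ctype_def numeral_2_eq_2)
    show ?thesis unfolding js_def map_append 1 2 3 4 by simp
  qed
  ultimately show ?thesis using that set by blast
qed

end

section \<open>Counting factors and the final assembly\<close>

lemma count_concat_replicate: "count_list (concat (replicate n xs)) x = n * count_list xs x"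
  by (induction n) (simp_all add: count_list_append)

lemma count_concat_map:
  "count_list (concat (concat (map (\<lambda>i. replicate q [i]) [a..<b]))) (j::nat) = (if a \<le> j \<and> j < b then q else 0)"
proof (induction b)
  case (Suc b)
  have "count_list (replicate q b) j = (if b = j then q else 0)"
    by (induction q) auto
  then show ?case using Suc by (auto simp: count_list_append)
qed simp

lemma list_all2_replicateI: "P x y \<Longrightarrow> list_all2 P (replicate n x) (replicate n y)"
  by (simp add: list_all2_conv_all_nth)

lemma list_all2_concat_map:
  assumes "\<And>i. i \<in> set xs \<Longrightarrow> list_all2 P (f i) (g i)"
  shows "list_all2 P (concat (map f xs)) (concat (map g xs))"
  using assms by (induction xs) (simp_all add: list_all2_appendI)

lemma card_indices_rev: "card {i. i < length js \<and> rev js ! i = j} = count_list js j"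
proof -
  have "count_list js j = length (filter (\<lambda>x. x = j) (rev js))"
    by (induction js) auto
  also have "\<dots> = card {i. i < length (rev js) \<and> rev js ! i = j}"
    by (rule length_filter_conv_card)
  finally show ?thesis by simp
qed

theorem theorem5p4:
  fixes p r :: nat
  assumes "CHAR('a::alg_closed_field) = p" and "prime p" and "2 < p" and "1 \<le> r"
  defines "q \<equiv> p ^ (2*r - 2)"
  shows "(\<exists>f. is_iso p (Hset p r :: (nat \<times> mono \<Rightarrow> 'a) set) (Hact p r)
                (fst (dsum (replicate (q - 1) (Vmod p 0)
                        @ concat (map (\<lambda>i. replicate q (Lmod p i)) [1..<p-1])
                        @ replicate (q - 1) (Vmod p (p - 1))
                        @ replicate 2 (Lmod p (p - 1)))))
                (snd (dsum (replicate (q - 1) (Vmod p 0)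
                        @ concat (map (\<lambda>i. replicate q (Lmod p i)) [1..<p-1])
                        @ replicate (q - 1) (Vmod p (p - 1))
                        @ replicate 2 (Lmod p (p - 1))))) f)
       \<and> (\<exists>Cs. is_comp_series p (Hset p r :: (nat \<times> mono \<Rightarrow> 'a) set) (Hact p r) Cs)
       \<and> (\<forall>Cs. is_comp_series p (Hset p r :: (nat \<times> mono \<Rightarrow> 'a) set) (Hact p r) Cs \<longrightarrow>
            (\<forall>i. Suc i < length Cs \<longrightarrow> (\<exists>j<p. factor_iso p (Hact p r) (Cs ! i) (Cs ! Suc i)
                                             (fst (Lmod p j)) (snd (Lmod p j))))
          \<and> (\<forall>j<p. card {i. Suc i < length Cs \<and> factor_iso p (Hact p r) (Cs ! i) (Cs ! Suc i)
                                             (fst (Lmod p j)) (snd (Lmod p j))}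
                   = (if j = 0 then 2 * q - 2 else if j = p - 1 then 2 * q else q)))"
proof -
  note pp = assms(2,3,1) and ppr = assms(2,3,1,4)
  define Ms :: "'a W1module list" where "Ms = replicate (q - 1) (Vmod p 0)
      @ concat (map (\<lambda>i. replicate q (Lmod p i)) [1..<p-1])
      @ replicate (q - 1) (Vmod p (p - 1)) @ replicate 2 (Lmod p (p - 1))"
  let ?H = "Hset p r :: (nat \<times> mono \<Rightarrow> 'a) set" and ?act = "Hact p r :: 'a W1elem \<Rightarrow> _"
  have p1: "0 < p" "p - 1 < p" "p - 1 \<noteq> 0" using assms(3) by auto
  have q: "0 < q" using p1 by (simp add: q_def)
  obtain js where js: "distinct js" "set js = rest p r \<times> {..<p}" "map (ctype p r) js = Ms"
    using index_list[OF ppr] unfolding Ms_def q_def by blast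
  obtain F where F: "is_iso p (Balg p r) (bact p r) (fst (dsum Ms)) (snd (dsum Ms)) F"
    using Balg_iso[OF ppr js(1,2)] unfolding js(3) by blast
  \<comment> \<open>\<open>Balg\<close> is not yet known to be a module, but it is a subspace closed
    under \<open>bact\<close>, which is enough to invert \<open>F\<close>. The module axioms then
    travel from the direct sum to H(2r).\<close>
  have Finv: "is_iso p (fst (dsum Ms)) (snd (dsum Ms)) (Balg p r) (bact p r) (inv_into (Balg p r) F)"
    by (rule iso_inv_closed[OF F Balg_subspace[OF ppr]]) (rule bact_in[OF ppr])
  note G = iso_comp[OF Finv DH_iso[OF ppr]]
  have WL: "is_W1mod p (fst (Lmod p j :: 'a W1module)) (snd (Lmod p j))" if "j < p" for j
    using simple_W1mod[OF Lmod_simple[OF pp that]] .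
  \<comment> \<open>Top factor first: V(0) has factors L(0), L(p-1), and V(p-1) has them in the
    opposite order.\<close>
  have fac: "list_all2 (\<lambda>m ks. is_W1mod p (fst m) (snd m) \<and> has_factors p (snd m) ks (fst m)) Ms
     (replicate (q - 1) [0, p - 1] @ concat (map (\<lambda>i. replicate q [i]) [1..<p-1])
      @ replicate (q - 1) [p - 1, 0] @ replicate 2 [p - 1])" (is "list_all2 _ _ ?jss")
    unfolding Ms_def
    by (intro list_all2_appendI list_all2_concat_map list_all2_replicateI conjI)
      (auto intro!: WL Vmod_W1mod[OF pp] Vmod_0_factors[OF pp] Vmod_top_factors[OF pp] has_factors_Lmod p1
        simp del: has_factors.simps One_nat_def)
  have W: "is_W1mod p (fst (dsum Ms)) (snd (dsum Ms))"
    by (rule dsum_W1mod) (use fac in \<open>auto simp: list_all2_conv_all_nth in_set_conv_nth\<close>)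
  note H = iso_inv[OF G W]
  have WH: "is_W1mod p ?H ?act" using W1mod_image[OF iso_hom[OF G] iso_image[OF G] W] .
  let ?ks = "concat ?jss"
  have kp: "\<forall>j\<in>set ?ks. j < p" using p1 by auto
  have "has_factors p ?act ?ks ?H" using has_factors_iso[OF WH H dsum_has_factors[OF fac]] .
  then obtain Ks where Ks: "is_comp_series p ?H ?act Ks" "length Ks = Suc (length ?ks)"
    "\<And>i. i < length ?ks \<Longrightarrow> factor_iso p ?act (Ks ! i) (Ks ! Suc i) (fst (Lmod p (rev ?ks ! i))) (snd (Lmod p (rev ?ks ! i)))"
    using has_factors_comp_series[OF Lmod_simple[OF pp] WH _ kp] by blast
  have rk: "rev ?ks ! i < p" if "i < length ?ks" for i
    using kp that nth_mem[of i "rev ?ks"] by (simp only: length_rev set_rev)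
  have count: "count_list ?ks j = (if j = 0 then 2 * q - 2 else if j = p - 1 then 2 * q else q)" if "j < p" for j
  proof -
    have "count_list ?ks j = (q - 1) * count_list [0, p - 1] j + (if 1 \<le> j \<and> j < p - 1 then q else 0)
        + (q - 1) * count_list [p - 1, 0] j + 2 * count_list [p - 1] j"
      by (simp only: concat_append count_list_append count_concat_replicate count_concat_map add.assoc)
    also have "\<dots> = (if j = 0 then 2 * q - 2 else if j = p - 1 then 2 * q else q)"
    proof -
      obtain m where m: "q = Suc m" using q gr0_implies_Suc by blast
      consider "j = 0" | "j = p - 1" "j \<noteq> 0" | "1 \<le> j" "j < p - 1" using \<open>j < p\<close> by linarith
      then show ?thesis using p1(3) m by cases auto
    qed
    finally show ?thesis .
  qed
  \<comment> \<open>A factor of \<open>Ks\<close> is isomorphic to exactly one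
    \<open>Lmod p j\<close>, so counting isomorphic factors is counting list entries.\<close>
  have Kcard: "card {i. Suc i < length Ks \<and> factor_iso p ?act (Ks ! i) (Ks ! Suc i) (fst (Lmod p j)) (snd (Lmod p j))}
      = (if j = 0 then 2 * q - 2 else if j = p - 1 then 2 * q else q)" if j: "j < p" for j
  proof -
    have "factor_iso p ?act (Ks ! i) (Ks ! Suc i) (fst (Lmod p j)) (snd (Lmod p j)) \<longleftrightarrow> rev ?ks ! i = j"
      if i: "i < length ?ks" for i
    proof
      have "Suc i < length Ks" using i Ks(2) by simp
      then have W': "is_W1mod p (Ks ! Suc i) ?act" using submod_W1mod[OF WH comp_series_submod[OF Ks(1)]] by blast
      assume "factor_iso p ?act (Ks ! i) (Ks ! Suc i) (fst (Lmod p j)) (snd (Lmod p j))"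
      then show "rev ?ks ! i = j" by (rule factor_iso_Lmod_unique[OF pp W' rk[OF i] j Ks(3)[OF i]])
    next
      assume "rev ?ks ! i = j"
      then show "factor_iso p ?act (Ks ! i) (Ks ! Suc i) (fst (Lmod p j)) (snd (Lmod p j))" using Ks(3)[OF i] by simp
    qed
    then have "{i. Suc i < length Ks \<and> factor_iso p ?act (Ks ! i) (Ks ! Suc i) (fst (Lmod p j)) (snd (Lmod p j))}
        = {i. i < length ?ks \<and> rev ?ks ! i = j}"
      unfolding Ks(2) Suc_less_eq by blast
    then show ?thesis using card_indices_rev[of ?ks j] count[OF j] by (simp only:)
  qed
  have "\<exists>j<p. factor_iso p ?act (Cs ! i) (Cs ! Suc i) (fst (Lmod p j)) (snd (Lmod p j))"
    if Cs: "is_comp_series p ?H ?act Cs" and i: "Suc i < length Cs" for Cs i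
  proof -
    obtain t where t: "Suc t < length Ks" "\<And>(L :: (nat \<Rightarrow> 'a) set) actL.
        factor_iso p ?act (Ks ! t) (Ks ! Suc t) L actL \<Longrightarrow> factor_iso p ?act (Cs ! i) (Cs ! Suc i) L actL"
      using jordan_hoelder_factor[OF WH Cs Ks(1) i] by blast
    have "t < length ?ks" using t(1) Ks(2) by simp
    then show ?thesis using rk t(2)[OF Ks(3)] by blast
  qed
  moreover have "card {i. Suc i < length Cs \<and> factor_iso p ?act (Cs ! i) (Cs ! Suc i) (fst (Lmod p j)) (snd (Lmod p j))}
      = (if j = 0 then 2 * q - 2 else if j = p - 1 then 2 * q else q)"
    if Cs: "is_comp_series p ?H ?act Cs" and j: "j < p" for Cs j
    \<comment> \<open>The inequality for the pairs (Cs, Ks) and (Ks, Cs) transfers the count from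
      the explicit series to an arbitrary one.\<close>
    by (rule trans[OF antisym[OF jordan_hoelder_card_le[OF WH Cs Ks(1)] jordan_hoelder_card_le[OF WH Ks(1) Cs]] Kcard[OF j]])
  ultimately show ?thesis
    unfolding Ms_def[symmetric] using H Ks(1)
    by (intro conjI allI impI exI[of "is_comp_series p ?H ?act"] exI[of "is_iso p ?H ?act (fst (dsum Ms)) (snd (dsum Ms))"]) blast+
qed

end
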